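(* Let $d>2$, $\beta>0$ and $\rho>\rho_c(\beta)$, and let $\nu_\rho$ be the boson random point field on $\mathbb{R}^d$ with particle density $\rho$. Let $f\ge 0$ be a bounded measurable function with compact support in $\mathbb{R}^d$, not almost everywhere zero. Put $$Z_\kappa=\frac{\langle f(\cdot/\kappa),\xi\rangle-\kappa^d\rho\int_{\mathbb{R}^d}f(x)\,dx}{\sqrt{2(\rho-\rho_c)}\;\|(-\beta\Delta)^{-1/2}f\|_2\;\kappa^{(d+2)/2}} .$$ Then for every $t\in\mathbb{R}$, $$\lim_{\kappa\to\infty}\int_{Q(\mathbb{R}^d)}e^{itZ_\kappa}\,\nu_\rho(d\xi)=e^{-t^2/2}.$$
   Context: $Q(\mathbb{R}^d)$ is the Polish space of locally finite non-negative integer-valued Borel measures (point measures) on $\mathbb{R}^d$; for $\xi=\sum_j\delta_{x_j}\in Q(\mathbb{R}^d)$, $\langle f,\xi\rangle=\sum_j f(x_j)$. $\Delta$ is the self-adjoint Laplacian in $L^2(\mathbb{R}^d)$, $G=e^{\beta\Delta}$, and the critical density is $\rho_c=\rho_c(\beta)=\int_{\mathbb{R}^d}\frac{1}{e^{\beta|p|^2}-1}\frac{dp}{(2\pi)^d}$ (finite since $d>2$). With the Fourier transform $\widetilde h(p)=(2\pi)^{-d/2}\int e^{-ip\cdot x}h(x)\,dx$, one has $\|(-\beta\Delta)^{-1/2}f\|_2^2=\int_{\mathbb{R}^d}\frac{|\widetilde f(p)|^2}{\beta|p|^2}\,dp$. For a non-negative bounded measurable compactly supported $f$, put $W_f=(G(1-G)^{-1})^{1/2}\sqrt{1-e^{-f}}$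 (a bounded operator on $L^2(\mathbb{R}^d)$, functions acting by multiplication) and $K_f=W_f^*W_f$ (a trace-class operator). For $\rho>\rho_c$, $\nu_\rho$ is the Borel probability measure on $Q(\mathbb{R}^d)$ characterized by $$\int_{Q(\mathbb{R}^d)}e^{-\langle f,\xi\rangle}\,\nu_\rho(d\xi)=\frac{\exp\big(-(\rho-\rho_c)\langle\sqrt{1-e^{-f}},(1+K_f)^{-1}\sqrt{1-e^{-f}}\rangle\big)}{\mathrm{Det}[1+K_f]}$$ for all non-negative bounded measurable $f$ with compact support, where $\mathrm{Det}$ is the Fredholm determinant and $\langle\cdot,\cdot\rangle$ on the right is the $L^2(\mathbb{R}^d)$ inner product. The existence of $\nu_\rho$ is known and may be assumed. *)

theory Defs
  imports "HOL-Probability.Probability" "Jordan_Normal_Form.Determinant"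
begin

section \<open>The space of point measures\<close>

definition point_measures :: "'a::euclidean_space measure set" where
  "point_measures = {\<xi>. sets \<xi> = sets borel
     \<and> (\<forall>K. compact K \<longrightarrow> emeasure \<xi> K < \<infinity>)
     \<and> (\<forall>A\<in>sets borel. emeasure \<xi> A = \<infinity> \<or> (\<exists>n::nat. emeasure \<xi> A = of_nat n))}"

definition compactly_supported :: "('a::euclidean_space \<Rightarrow> real) \<Rightarrow> bool" where
  "compactly_supported f \<longleftrightarrow> compact (closure {x. f x \<noteq> 0})"

text \<open>Bounded measurable functions of compact support are integrable with respect to every point
  measure, so for them this is the finite sum of the values of \<open>f\<close> at the points of \<open>\<xi>\<close>.\<close>

definition pairing :: "('a::euclidean_space \<Rightarrow> real) \<Rightarrow> 'a measure \<Rightarrow> real" where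
  "pairing f \<xi> = (LINT x|\<xi>. f x)"

text \<open>The Polish topology on the space of point measures is the vague topology.\<close>

definition vague_topology :: "'a::euclidean_space measure topology" where
  "vague_topology = topology_generated_by
     {{\<xi> \<in> point_measures. pairing g \<xi> \<in> U} | g U.
        continuous_on UNIV g \<and> compactly_supported g \<and> open U}"

definition borel_point_measures :: "'a::euclidean_space measure measure" where
  "borel_point_measures = sigma point_measures {U. openin vague_topology U}"

lemma topspace_vague_topology: "topspace vague_topology = point_measures"
proof
  show "topspace vague_topology \<subseteq> (point_measures :: 'a measure set)"
    by (auto simp: vague_topology_def)
next
  let ?S = "{{\<xi> \<in> point_measures. pairing g \<xi> \<in> U} | g U.
        continuous_on UNIV g \<and> compactly_supported (g :: 'a \<Rightarrow> real) \<and> open U}"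
  have "{\<xi> \<in> point_measures. pairing (\<lambda>_::'a. 0) \<xi> \<in> UNIV} \<in> ?S"
    by (intro CollectI exI[of _ "\<lambda>_. 0"] exI[of _ UNIV]) (simp add: compactly_supported_def)
  then show "(point_measures :: 'a measure set) \<subseteq> topspace vague_topology"
    unfolding vague_topology_def topology_generated_by_topspace by blast
qed

lemma space_borel_point_measures [simp]: "space borel_point_measures = point_measures"
  by (simp add: borel_point_measures_def space_measure_of_conv)

lemma sets_borel_point_measures:
  "sets borel_point_measures = sigma_sets point_measures {U. openin vague_topology U}"
proof -
  have "{U. openin vague_topology U} \<subseteq> Pow (point_measures :: 'a measure set)"
    using openin_subset topspace_vague_topology by blast
  then show ?thesis
    by (simp add: borel_point_measures_def)
qed


section \<open>Operators on \<open>L\<^sup>2\<close>\<close>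

text \<open>Elements of the complex Hilbert space \<open>L\<^sup>2\<close> are represented by square-integrable functions,
  two of which denote the same element if they agree almost everywhere.  An operator is a map on
  representatives; where its value is picked by \<open>SOME\<close>, that value is determined up to almost
  everywhere equality whenever the argument lies in the domain of the operator, and is
  unspecified outside the domain.\<close>

definition L2 :: "('a::euclidean_space \<Rightarrow> complex) set" where
  "L2 = {h \<in> borel_measurable lborel. integrable lborel (\<lambda>x. (cmod (h x))\<^sup>2)}"

definition L2_inner :: "('a::euclidean_space \<Rightarrow> complex) \<Rightarrow> ('a \<Rightarrow> complex) \<Rightarrow> complex" where
  "L2_inner g h = (LINT x|lborel. cnj (g x) * h x)"

definition L2_norm :: "('a::euclidean_space \<Rightarrow> complex) \<Rightarrow> real" where
  "L2_norm h = sqrt (LINT x|lborel. (cmod (h x))\<^sup>2)"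

definition fourier_L1 :: "('a::euclidean_space \<Rightarrow> complex) \<Rightarrow> 'a \<Rightarrow> complex" where
  "fourier_L1 h p =
     of_real ((2 * pi) powr (- real DIM('a) / 2)) * (LINT x|lborel. exp (- \<i> * of_real (inner p x)) * h x)"

text \<open>The extension of the Fourier transform from \<open>L\<^sup>1 \<inter> L\<^sup>2\<close> to \<open>L\<^sup>2\<close> by continuity.\<close>

definition fourier_L2 :: "('a::euclidean_space \<Rightarrow> complex) \<Rightarrow> 'a \<Rightarrow> complex" where
  "fourier_L2 h = (SOME g. g \<in> L2 \<and>
     (\<lambda>n::nat. \<integral>\<^sup>+p. ennreal ((cmod (fourier_L1 (\<lambda>x. indicator (ball 0 (real n)) x * h x) p - g p))\<^sup>2) \<partial>lborel)
       \<longlonglongrightarrow> 0)"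

text \<open>The self-adjoint Laplacian \<open>\<Delta>\<close> is unitarily equivalent, via the Fourier transform, to
  multiplication by \<open>-|p|\<^sup>2\<close>.  Accordingly \<open>fun_laplacian \<phi>\<close> is the operator \<open>\<phi>(\<Delta>)\<close> of the
  functional calculus, with domain those \<open>h\<close> for which the right-hand side below is square
  integrable.  The value of \<open>\<phi>\<close> at \<open>0\<close> is irrelevant, since \<open>{0}\<close> is a null set.\<close>

definition fun_laplacian ::
  "(real \<Rightarrow> real) \<Rightarrow> ('a::euclidean_space \<Rightarrow> complex) \<Rightarrow> ('a \<Rightarrow> complex)" where
  "fun_laplacian \<phi> h = (SOME g. g \<in> L2 \<and>
     (AE p in lborel. fourier_L2 g p = of_real (\<phi> (- (norm p)\<^sup>2)) * fourier_L2 h p))"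

definition L2_adjoint ::
  "(('a::euclidean_space \<Rightarrow> complex) \<Rightarrow> ('a \<Rightarrow> complex)) \<Rightarrow> ('a \<Rightarrow> complex) \<Rightarrow> ('a \<Rightarrow> complex)" where
  "L2_adjoint A h = (SOME k. k \<in> L2 \<and> (\<forall>g\<in>L2. L2_inner g k = L2_inner (A g) h))"

definition inv_one_plus ::
  "(('a::euclidean_space \<Rightarrow> complex) \<Rightarrow> ('a \<Rightarrow> complex)) \<Rightarrow> ('a \<Rightarrow> complex) \<Rightarrow> ('a \<Rightarrow> complex)" where
  "inv_one_plus K h = (SOME u. u \<in> L2 \<and> (AE x in lborel. u x + K u x = h x))"

definition L2_orthonormal_basis :: "(nat \<Rightarrow> 'a::euclidean_space \<Rightarrow> complex) \<Rightarrow> bool" where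
  "L2_orthonormal_basis e \<longleftrightarrow> (\<forall>i. e i \<in> L2)
     \<and> (\<forall>i j. L2_inner (e i) (e j) = (if i = j then 1 else 0))
     \<and> (\<forall>h\<in>L2. (\<forall>i. L2_inner (e i) h = 0) \<longrightarrow> (AE x in lborel. h x = 0))"

text \<open>The Fredholm determinant is the extension of \<open>F \<mapsto> det (1 + F)\<close> from finite rank operators to
  trace-class operators that is continuous in trace norm.  If \<open>P\<^sub>n\<close> is the projection onto the span
  of the first \<open>n\<close> vectors of an orthonormal basis and \<open>K\<close> is of trace class, then
  \<open>P\<^sub>n K P\<^sub>n\<close> tends to \<open>K\<close> in trace norm; hence the limit below exists and does not depend on the
  basis.\<close>

definition fredholm_det :: "(('a::euclidean_space \<Rightarrow> complex) \<Rightarrow> ('a \<Rightarrow> complex)) \<Rightarrow> complex" where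
  "fredholm_det K = (THE D. \<forall>e. L2_orthonormal_basis e \<longrightarrow>
     (\<lambda>n. Determinant.det (Matrix.mat n n
            (\<lambda>(i, j). (if i = j then 1 else 0) + L2_inner (e i) (K (e j))))) \<longlonglongrightarrow> D)"


section \<open>The boson random point field\<close>

definition critical_density :: "'a::euclidean_space itself \<Rightarrow> real \<Rightarrow> real" where
  "critical_density _ \<beta> =
     (LINT p|lborel. 1 / (exp (\<beta> * (norm (p::'a))\<^sup>2) - 1) / (2 * pi) ^ DIM('a))"

definition sqrt_one_minus_exp :: "('a \<Rightarrow> real) \<Rightarrow> 'a \<Rightarrow> complex" where
  "sqrt_one_minus_exp f x = of_real (sqrt (1 - exp (- f x)))"

text \<open>Here \<open>G = e\<^bsup>\<beta>\<Delta>\<^esup>\<close>, so \<open>(G(1-G)\<^bsup>-1\<^esup>)\<^bsup>1/2\<^esup>\<close> is the function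
  \<open>s \<mapsto> (e\<^bsup>\<beta>s\<^esup> / (1 - e\<^bsup>\<beta>s\<^esup>))\<^bsup>1/2\<^esup>\<close> of \<open>\<Delta>\<close>.\<close>

definition W_op ::
  "real \<Rightarrow> ('a::euclidean_space \<Rightarrow> real) \<Rightarrow> ('a \<Rightarrow> complex) \<Rightarrow> ('a \<Rightarrow> complex)" where
  "W_op \<beta> f h = fun_laplacian (\<lambda>s. sqrt (exp (\<beta> * s) / (1 - exp (\<beta> * s))))
                   (\<lambda>x. sqrt_one_minus_exp f x * h x)"

definition K_op ::
  "real \<Rightarrow> ('a::euclidean_space \<Rightarrow> real) \<Rightarrow> ('a \<Rightarrow> complex) \<Rightarrow> ('a \<Rightarrow> complex)" where
  "K_op \<beta> f h = L2_adjoint (W_op \<beta> f) (W_op \<beta> f h)"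

definition test_function :: "('a::euclidean_space \<Rightarrow> real) \<Rightarrow> bool" where
  "test_function f \<longleftrightarrow> f \<in> borel_measurable borel \<and> (\<forall>x. 0 \<le> f x) \<and> bounded (range f)
     \<and> compactly_supported f"

definition boson_field :: "real \<Rightarrow> real \<Rightarrow> 'a::euclidean_space measure measure \<Rightarrow> bool" where
  "boson_field \<beta> \<rho> \<nu> \<longleftrightarrow> prob_space \<nu> \<and> sets \<nu> = sets borel_point_measures
     \<and> (\<forall>f. test_function f \<longrightarrow>
          complex_of_real (LINT \<xi>|\<nu>. exp (- pairing f \<xi>)) =
            exp (- of_real (\<rho> - critical_density TYPE('a) \<beta>) *
                   L2_inner (sqrt_one_minus_exp f)
                     (inv_one_plus (K_op \<beta> f) (sqrt_one_minus_exp f)))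
            / fredholm_det (K_op \<beta> f))"

text \<open>The function \<open>s \<mapsto> (-\<beta>s)\<^bsup>-1/2\<^esup>\<close> of \<open>\<Delta>\<close> is the operator \<open>(-\<beta>\<Delta>)\<^bsup>-1/2\<^esup>\<close>.\<close>

definition inv_sqrt_laplacian_norm :: "real \<Rightarrow> ('a::euclidean_space \<Rightarrow> real) \<Rightarrow> real" where
  "inv_sqrt_laplacian_norm \<beta> f =
     L2_norm (fun_laplacian (\<lambda>s. (- \<beta> * s) powr (- 1 / 2)) (\<lambda>x. of_real (f x)))"

definition Z_normalized ::
  "real \<Rightarrow> real \<Rightarrow> ('a::euclidean_space \<Rightarrow> real) \<Rightarrow> real \<Rightarrow> 'a measure \<Rightarrow> real" where
  "Z_normalized \<beta> \<rho> f \<kappa> \<xi> =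
     (pairing (\<lambda>x. f (x /\<^sub>R \<kappa>)) \<xi> - \<kappa> ^ DIM('a) * \<rho> * (LINT x|lborel. f x))
     / (sqrt (2 * (\<rho> - critical_density TYPE('a) \<beta>)) * inv_sqrt_laplacian_norm \<beta> f
        * \<kappa> powr ((real DIM('a) + 2) / 2))"

end

theory Submission
  imports Defs "Jordan_Normal_Form.Schur_Decomposition" "HOL-Complex_Analysis.Complex_Analysis"
begin

text \<open>
  Write \<open>u Z\<^sub>\<kappa> = \<epsilon> (\<langle>f(\<cdot>/\<kappa>), \<xi>\<rangle> - \<dots>)\<close> with \<open>\<epsilon>\<^sup>2 \<kappa>\<^bsup>d+2\<^esup>\<close> constant, and let \<open>s\<^sup>2 = 1 - exp(-\<epsilon> f(\<cdot>/\<kappa>))\<close>.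
  The operator \<open>K\<close> has the kernel \<open>s(x) A(x-y) s(y)\<close>, where \<open>A\<close> is a sum of heat kernels: it is
  non-negative, bounded by \<open>A(0) = \<rho>\<^sub>c\<close> and vanishes at infinity.  Up to errors controlled by the
  Hilbert--Schmidt norm of \<open>K\<close>, which tends to 0 by these properties of \<open>A\<close>, the logarithm of the
  Fredholm determinant is \<open>Tr K = \<rho>\<^sub>c \<integral> s\<^sup>2\<close>, and \<open>\<langle>s, (1+K)\<^sup>-\<^sup>1 s\<rangle>\<close> is \<open>\<integral> s\<^sup>2 - \<langle>s, K s\<rangle>\<close>.  Hence the
  Laplace transform of \<open>Z\<^sub>\<kappa>\<close> at \<open>u > 0\<close> behaves like \<open>exp((\<rho> - \<rho>\<^sub>c) \<langle>s, K s\<rangle>)\<close>.  In Fourier space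
  \<open>\<langle>s, K s\<rangle>\<close> only sees momenta of order \<open>1/\<kappa>\<close>, where \<open>G(1-G)\<^sup>-\<^sup>1\<close> is asymptotic to \<open>(-\<beta>\<Delta>)\<^sup>-\<^sup>1\<close>; so the
  limit is \<open>exp(u\<^sup>2/2)\<close>.  Convergence of Laplace transforms on the positive axis is enough, because
  Montel's theorem extends it to the right half plane.

  Measurability of \<open>\<langle>f, \<xi>\<rangle>\<close> in \<open>\<xi>\<close> is read off from the Laplace transform: its value is nonzero, whereas
  the integral of a function that is not integrable is 0.
\<close>

section \<open>Determinants of positive semidefinite matrices\<close>

text \<open>Centring works because two linear terms combine: minus the logarithm of the Laplace
  transform contains \<open>rho_c * S2\<close> from the determinant and
  \<open>(\<rho> - rho_c) * S2\<close> from the resolvent, and their sum \<open>\<rho> * S2\<close>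
  differs from \<epsilon> times the subtracted mean by O(\<epsilon>^2 \<kappa>^d) = O(\<kappa>^-2).
  The exponent d+2 belongs to the remaining term: at momenta of order 1/\<kappa> the symbol of
  G(1-G)^-1 is of order \<kappa>^2, so <s, K s> is of order \<epsilon>^2 \<kappa>^(d+2). The
  obstacle is that the integral of s^2 itself grows like \<kappa>^((d-2)/2); therefore the error of
  the resolvent expansion is measured by the energy <s, K s>, which stays bounded, and not by the
  norm of s. The operators are given through choices (\<open>SOME\<close>, \<open>THE\<close>), so
  each of them requires an existence proof: Plancherel's theorem with surjectivity for functions of
  the Laplacian, a witness for the adjoint, a solution of the resolvent equation, and a limit common
  to all bases for the determinant. The formula for the field speaks of nonnegative f only, hence of
  positive Laplace variables only.\<close>

definition mat_trace :: "complex mat \<Rightarrow> complex" where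
  "mat_trace A = (\<Sum>i<dim_row A. A $$ (i, i))"

lemma mat_trace_mult_commute:
  assumes "A \<in> carrier_mat n m" "B \<in> carrier_mat m n"
  shows "mat_trace (A * B) = mat_trace (B * A)"
proof -
  have "mat_trace (A * B) = (\<Sum>i<n. \<Sum>j<m. A $$ (i, j) * B $$ (j, i))"
    unfolding mat_trace_def using assms
    by (intro sum.cong) (auto simp: scalar_prod_def lessThan_atLeast0)
  also have "\<dots> = (\<Sum>j<m. \<Sum>i<n. B $$ (j, i) * A $$ (i, j))"
    by (subst sum.swap) (simp add: mult.commute)
  also have "\<dots> = mat_trace (B * A)"
    unfolding mat_trace_def using assms
    by (intro sum.cong) (auto simp: scalar_prod_def lessThan_atLeast0)
  finally show ?thesis .
qed

lemma mat_trace_similar: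
  assumes "similar_mat_wit A B P Q" "A \<in> carrier_mat n n"
  shows "mat_trace A = mat_trace B"
proof -
  note w = similar_mat_witD2[OF assms(2,1)]
  have "mat_trace A = mat_trace (P * (B * Q))"
    using w by (simp add: assoc_mult_mat[of _ n n _ n _ n])
  also have "\<dots> = mat_trace ((B * Q) * P)"
    by (rule mat_trace_mult_commute) (use w in auto)
  also have "\<dots> = mat_trace B"
    using w by (simp add: assoc_mult_mat[of _ n n _ n _ n])
  finally show ?thesis .
qed

text \<open>Schur's triangular form: the similarity that triangularizes \<open>A\<close> also
  triangularizes \<open>1\<^sub>m n + A\<close> and \<open>A * A\<close>, so one list of diagonal
  entries, counted with multiplicity, serves all four formulas.\<close>

lemma complex_mat_eigenvalue_list:
  fixes A :: "complex mat"
  assumes A: "A \<in> carrier_mat n n"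
  obtains es where "length es = n" "\<And>e. e \<in> set es \<Longrightarrow> eigenvalue A e"
    "Determinant.det A = (\<Prod>i<n. es ! i)" "Determinant.det (1\<^sub>m n + A) = (\<Prod>i<n. 1 + es ! i)"
    "mat_trace A = (\<Sum>i<n. es ! i)" "mat_trace (A * A) = (\<Sum>i<n. (es ! i)\<^sup>2)"
proof -
  obtain es where es: "char_poly A = (\<Prod>e\<leftarrow>es. [:- e, 1:])" "length es = n"
    using char_poly_factorized[OF A] by blast
  obtain B P Q where BPQ: "schur_decomposition A es = (B, P, Q)"
    using prod_cases3 by blast
  from schur_decomposition[OF A es(1) BPQ]
  have sim: "similar_mat_wit A B P Q" and ut: "upper_triangular B" and diag: "diag_mat B = es"
    by auto
  note w = similar_mat_witD2[OF A sim]
  have B: "B \<in> carrier_mat n n" using w by auto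
  have Bii: "B $$ (i, i) = es ! i" if "i < n" for i
    using diag that B by (auto simp: diag_mat_def)
  have Blow: "B $$ (i, j) = 0" if "j < i" "i < n" for i j
    using ut that B by auto
  have detA: "Determinant.det A = Determinant.det B"
    by (rule det_similar) (use sim in \<open>auto simp: similar_mat_def\<close>)
  have detB: "Determinant.det B = (\<Prod>i<n. es ! i)"
    unfolding det_upper_triangular[OF ut B] diag using es(2)
    by (simp add: prod.list_conv_set_nth lessThan_atLeast0)
  have sim1: "similar_mat_wit (1\<^sub>m n + A) (1\<^sub>m n + B) P Q"
    unfolding similar_mat_wit_def Let_def
  proof (intro conjI)
    show "P * Q = 1\<^sub>m (dim_row (1\<^sub>m n + A))" "Q * P = 1\<^sub>m (dim_row (1\<^sub>m n + A))"
      using w A by auto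
    have "P * (1\<^sub>m n + B) * Q = (P * 1\<^sub>m n + P * B) * Q"
      using w by (simp add: mult_add_distrib_mat[of _ n n _ n])
    also have "\<dots> = P * 1\<^sub>m n * Q + P * B * Q"
      using w by (intro add_mult_distrib_mat[of _ n n _ _ n]) auto
    also have "\<dots> = 1\<^sub>m n + A"
      using w by simp
    finally show "1\<^sub>m n + A = P * (1\<^sub>m n + B) * Q" ..
  qed (use w A in auto)
  have ut1: "upper_triangular (1\<^sub>m n + B)"
    using ut B by (auto simp: upper_triangular_def)
  have "Determinant.det (1\<^sub>m n + A) = Determinant.det (1\<^sub>m n + B)"
    by (rule det_similar) (use sim1 in \<open>auto simp: similar_mat_def\<close>)
  also have "\<dots> = prod_list (diag_mat (1\<^sub>m n + B))"
    by (rule det_upper_triangular[OF ut1, of n]) (use B in auto)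
  also have "diag_mat (1\<^sub>m n + B) = map (\<lambda>e. 1 + e) es"
    unfolding diag_mat_def using B es(2) Bii by (intro nth_equalityI) auto
  also have "prod_list \<dots> = (\<Prod>i<n. 1 + es ! i)"
    using es(2) by (simp add: prod.list_conv_set_nth lessThan_atLeast0)
  finally have det1: "Determinant.det (1\<^sub>m n + A) = (\<Prod>i<n. 1 + es ! i)" .
  have trA: "mat_trace A = (\<Sum>i<n. es ! i)"
    unfolding mat_trace_similar[OF sim A] using B Bii by (auto simp: mat_trace_def)
  have sim2: "similar_mat_wit (A * A) (B * B) P Q"
  proof -
    have carr: "P \<in> carrier_mat n n" "Q \<in> carrier_mat n n" using w by auto
    \<comment> \<open>The factor \<open>1\<^sub>m n\<close> is inserted in order to be read as
      \<open>Q * P\<close>, which splits the product into two copies of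
      \<open>P * B * Q\<close>.\<close>
    have "P * (B * B) * Q = (P * B) * (1\<^sub>m n * (B * Q))"
      using B carr by (simp add: assoc_mult_mat[of _ n n _ n _ n])
    also have "1\<^sub>m n * (B * Q) = Q * (P * (B * Q))"
      using assoc_mult_mat[OF carr(2,1), of "B * Q" n] B carr w by auto
    also have "(P * B) * (Q * (P * (B * Q))) = (P * B * Q) * (P * B * Q)"
      using B carr by (simp add: assoc_mult_mat[of _ n n _ n _ n])
    also have "\<dots> = A * A" using w by simp
    finally show ?thesis
      unfolding similar_mat_wit_def Let_def using w A by auto
  qed
  have "(B * B) $$ (i, i) = (es ! i)\<^sup>2" if i: "i < n" for i
  proof -
    have "(B * B) $$ (i, i) = (\<Sum>j<n. B $$ (i, j) * B $$ (j, i))"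
      using B i by (auto simp: scalar_prod_def lessThan_atLeast0)
    also have "\<dots> = (\<Sum>j<n. if j = i then (es ! i)\<^sup>2 else 0)"
    proof (intro sum.cong refl)
      fix j assume "j \<in> {..<n}"
      then show "B $$ (i, j) * B $$ (j, i) = (if j = i then (es ! i)\<^sup>2 else 0)"
        using Blow[of j i] Blow[of i j] Bii i
        by (cases j i rule: linorder_cases) (auto simp: power2_eq_square)
    qed
    finally show ?thesis using i by simp
  qed
  then have "mat_trace (B * B) = (\<Sum>i<n. (es ! i)\<^sup>2)"
    using B by (auto simp: mat_trace_def intro!: sum.cong)
  moreover have "mat_trace (A * A) = mat_trace (B * B)"
    by (rule mat_trace_similar[OF sim2]) (use A in auto)
  moreover have "eigenvalue A e" if "e \<in> set es" for e
    unfolding eigenvalue_root_char_poly[OF A] es(1) using that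
    by (auto simp: poly_prod_list prod_list_zero_iff)
  ultimately show ?thesis
    using that[of es] es(2) detA detB det1 trA by auto
qed

section \<open>Positive semidefinite matrices: bounds and monotonicity of det (1 + M)\<close>

text \<open>For complex \<open>z\<close> the relation \<open>0 \<le> z\<close> says that
  \<open>z\<close> is real and nonnegative, so the condition includes hermitian symmetry.\<close>

definition psd_mat :: "nat \<Rightarrow> complex mat \<Rightarrow> bool" where
  "psd_mat n M \<longleftrightarrow> M \<in> carrier_mat n n \<and> (\<forall>v\<in>carrier_vec n. 0 \<le> (M *\<^sub>v v) \<bullet>c v)"

lemma eigenvalue_nonneg_if_psd:
  assumes "psd_mat n M" "eigenvalue M e"
  shows "0 \<le> e"
proof -
  have M: "M \<in> carrier_mat n n" using assms by (auto simp: psd_mat_def)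
  obtain v where v: "v \<in> carrier_vec n" "v \<noteq> 0\<^sub>v n" "M *\<^sub>v v = e \<cdot>\<^sub>v v"
    using assms(2) M unfolding eigenvalue_def eigenvector_def by auto
  have pos: "0 < v \<bullet>c v"
    using v(1,2) conjugate_square_greater_0_vec by blast
  have "0 \<le> (e \<cdot>\<^sub>v v) \<bullet>c v"
    using assms(1) v by (auto simp: psd_mat_def)
  also have "(e \<cdot>\<^sub>v v) \<bullet>c v = e * (v \<bullet>c v)"
    using v(1) by simp
  finally have "0 \<le> e * (v \<bullet>c v)" .
  then show ?thesis
    using pos by (auto simp: less_eq_complex_def less_complex_def zero_le_mult_iff)
qed

lemma det_one_plus_psd:
  assumes "psd_mat n M"
  obtains es :: "nat \<Rightarrow> real" where "\<And>i. 0 \<le> es i"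
    "Determinant.det (1\<^sub>m n + M) = of_real (\<Prod>i<n. 1 + es i)"
    "mat_trace M = of_real (\<Sum>i<n. es i)"
    "mat_trace (M * M) = of_real (\<Sum>i<n. (es i)\<^sup>2)"
proof -
  have M: "M \<in> carrier_mat n n" using assms by (auto simp: psd_mat_def)
  obtain es where es: "length es = n" "\<And>e. e \<in> set es \<Longrightarrow> eigenvalue M e"
    "Determinant.det (1\<^sub>m n + M) = (\<Prod>i<n. 1 + es ! i)"
    "mat_trace M = (\<Sum>i<n. es ! i)" "mat_trace (M * M) = (\<Sum>i<n. (es ! i)\<^sup>2)"
    using complex_mat_eigenvalue_list[OF M] by metis
  have "0 \<le> es ! i" if "i < n" for i
    using es(1,2) that eigenvalue_nonneg_if_psd[OF assms] by auto
  then have re: "es ! i = of_real (Re (es ! i))" "0 \<le> Re (es ! i)" if "i < n" for i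
    using that by (auto simp: less_eq_complex_def complex_eq_iff)
  \<comment> \<open>Padding with 0 beyond \<open>n\<close> makes nonnegativity hold for every
    index.\<close>
  define r where "r i = (if i < n then Re (es ! i) else 0)" for i
  have r: "es ! i = of_real (r i)" if "i < n" for i
    using re(1)[OF that] that by (simp add: r_def)
  show ?thesis
  proof (rule that[of r])
    show "0 \<le> r i" for i using re(2) by (simp add: r_def)
  qed (simp_all add: es(3-5) r)
qed

text \<open>For an eigenvalue x >= 0 one has x - x^2 \<le> ln (1 + x) \<le> x. Summation turns log
  det into the trace up to the trace of the square, which for \<open>K\<close> is controlled by the
  squared Hilbert-Schmidt norm.\<close>

lemma det_one_plus_psd_bounds:
  assumes "psd_mat n M"
  shows "Im (Determinant.det (1\<^sub>m n + M)) = 0"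
    and "1 \<le> Re (Determinant.det (1\<^sub>m n + M))"
    and "Re (Determinant.det (1\<^sub>m n + M)) \<le> exp (Re (mat_trace M))"
    and "exp (Re (mat_trace M) - Re (mat_trace (M * M))) \<le> Re (Determinant.det (1\<^sub>m n + M))"
proof -
  obtain es :: "nat \<Rightarrow> real" where es: "\<And>i. 0 \<le> es i"
    "Determinant.det (1\<^sub>m n + M) = of_real (\<Prod>i<n. 1 + es i)"
    "mat_trace M = of_real (\<Sum>i<n. es i)"
    "mat_trace (M * M) = of_real (\<Sum>i<n. (es i)\<^sup>2)"
    using det_one_plus_psd[OF assms] by metis
  show "Im (Determinant.det (1\<^sub>m n + M)) = 0" by (simp only: es(2) Im_complex_of_real)
  show "1 \<le> Re (Determinant.det (1\<^sub>m n + M))"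
    unfolding es(2) Re_complex_of_real by (intro prod_ge_1) (use es(1) in auto)
  have "(\<Prod>i<n. 1 + es i) \<le> (\<Prod>i<n. exp (es i))"
    by (intro prod_mono) (use es(1) in \<open>auto simp: add_nonneg_nonneg\<close>)
  then show "Re (Determinant.det (1\<^sub>m n + M)) \<le> exp (Re (mat_trace M))"
    unfolding es(2,3) Re_complex_of_real by (simp add: exp_sum)
  have "exp (x - x\<^sup>2) \<le> 1 + x" if "0 \<le> x" for x :: real
  proof -
    \<comment> \<open>For x \<le> 1 this is a Taylor bound of the logarithm; for x > 1 the left side
      is already negative.\<close>
    have "x - x\<^sup>2 \<le> ln (1 + x)"
    proof (cases "x \<le> 1")
      case False
      then have "x * 1 \<le> x * x" by (intro mult_left_mono) auto
      then have "x - x\<^sup>2 \<le> 0" by (simp add: power2_eq_square)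
      also have "0 \<le> ln (1 + x)" using that by simp
      finally show ?thesis .
    qed (use that ln_one_plus_pos_lower_bound in blast)
    then have "exp (x - x\<^sup>2) \<le> exp (ln (1 + x))" by simp
    then show ?thesis using that by simp
  qed
  then have "(\<Prod>i<n. exp (es i - (es i)\<^sup>2)) \<le> (\<Prod>i<n. 1 + es i)"
    by (intro prod_mono) (use es(1) in auto)
  then show "exp (Re (mat_trace M) - Re (mat_trace (M * M))) \<le> Re (Determinant.det (1\<^sub>m n + M))"
    unfolding es(2,3,4) Re_complex_of_real
    by (simp add: exp_sum[symmetric] sum_subtractf)
qed

text \<open>1 + M + R factors as (1 + M)(1 + A) with A = (1 + M)^-1 R. Although A need not be
  hermitian, its eigenvalues are nonnegative: A v = e v means R v = e (1 + M) v, and pairing with v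
  gives a nonnegative number on the left and e times a positive one on the right.\<close>

lemma det_one_plus_psd_mono:
  assumes M: "psd_mat n M" and R: "psd_mat n R"
  shows "Re (Determinant.det (1\<^sub>m n + M)) \<le> Re (Determinant.det (1\<^sub>m n + (M + R)))"
proof -
  have carr: "M \<in> carrier_mat n n" "R \<in> carrier_mat n n"
    using M R by (auto simp: psd_mat_def)
  define C where "C = 1\<^sub>m n + M"
  have C: "C \<in> carrier_mat n n" using carr by (auto simp: C_def)
  have detC: "Im (Determinant.det C) = 0" "1 \<le> Re (Determinant.det C)"
    using det_one_plus_psd_bounds[OF M] by (auto simp: C_def)
  then have "Determinant.det C \<noteq> 0" by (metis not_one_le_zero zero_complex.simps(1))
  then obtain C' where C': "C' \<in> carrier_mat n n" "C' * C = 1\<^sub>m n" "C * C' = 1\<^sub>m n"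
    using det_non_zero_imp_unit[OF C, of "()"] by (auto simp: Units_def ring_mat_def)
  define A where "A = C' * R"
  have A: "A \<in> carrier_mat n n" using C' carr by (auto simp: A_def)
  have CA: "C * (1\<^sub>m n + A) = 1\<^sub>m n + (M + R)"
  proof -
    have "C * (1\<^sub>m n + A) = C + (C * C') * R"
      unfolding A_def assoc_mult_mat[OF C C'(1) carr(2)] using C C' carr
      by (subst mult_add_distrib_mat[of _ n n _ n]) auto
    also have "\<dots> = C + R" unfolding C'(3) using carr by simp
    also have "\<dots> = 1\<^sub>m n + (M + R)" using carr by (simp add: C_def assoc_add_mat[of _ n n])
    finally show ?thesis .
  qed
  have ev: "0 \<le> e" if ev_e: "eigenvalue A e" for e
  proof -
    obtain v where v: "v \<in> carrier_vec n" "v \<noteq> 0\<^sub>v n" "A *\<^sub>v v = e \<cdot>\<^sub>v v"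
      using ev_e A unfolding eigenvalue_def eigenvector_def by auto
    have pos: "0 < v \<bullet>c v"
      using v(1,2) conjugate_square_greater_0_vec by blast
    have "C * A = R"
      unfolding A_def assoc_mult_mat[OF C C'(1) carr(2), symmetric] C'(3) using carr by simp
    then have "R *\<^sub>v v = C *\<^sub>v (A *\<^sub>v v)"
      using assoc_mult_mat_vec[OF C A v(1)] by simp
    also have "\<dots> = e \<cdot>\<^sub>v (C *\<^sub>v v)"
      unfolding v(3) using C v(1) by (simp add: mult_mat_vec)
    finally have "(R *\<^sub>v v) \<bullet>c v = e * ((C *\<^sub>v v) \<bullet>c v)"
      using C v by simp
    also have "(C *\<^sub>v v) \<bullet>c v = v \<bullet>c v + (M *\<^sub>v v) \<bullet>c v"
      using carr v unfolding C_def by (simp add: add_mult_distrib_mat_vec[of _ n n] add_scalar_prod_distrib[of _ n])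
    finally have eq: "(R *\<^sub>v v) \<bullet>c v = e * (v \<bullet>c v + (M *\<^sub>v v) \<bullet>c v)" .
    have "0 \<le> (R *\<^sub>v v) \<bullet>c v" "0 \<le> (M *\<^sub>v v) \<bullet>c v"
      using M R v by (auto simp: psd_mat_def)
    then show ?thesis
      using pos unfolding eq by (auto simp: less_eq_complex_def less_complex_def zero_le_mult_iff)
  qed
  obtain es where es: "length es = n" "\<And>e. e \<in> set es \<Longrightarrow> eigenvalue A e"
    "Determinant.det (1\<^sub>m n + A) = (\<Prod>i<n. 1 + es ! i)"
    using complex_mat_eigenvalue_list[OF A] by metis
  have "es ! i = of_real (Re (es ! i)) \<and> 0 \<le> Re (es ! i)" if "i < n" for i
    using es(1,2) that ev[of "es ! i"] by (auto simp: less_eq_complex_def complex_eq_iff)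
  then have re: "1 + es ! i = of_real (1 + Re (es ! i))" "0 \<le> Re (es ! i)" if "i < n" for i
    using that by auto
  have "(\<Prod>i<n. 1 + es ! i) = (\<Prod>i<n. of_real (1 + Re (es ! i)))"
    by (intro prod.cong refl re(1)) auto
  then have "Determinant.det (1\<^sub>m n + A) = of_real (\<Prod>i<n. 1 + Re (es ! i))" "1 \<le> (\<Prod>i<n. 1 + Re (es ! i))"
    unfolding es(3) using re(2) by (auto intro!: prod_ge_1)
  then have "Re (Determinant.det (1\<^sub>m n + (M + R))) = Re (Determinant.det C) * (\<Prod>i<n. 1 + Re (es ! i))"
    unfolding CA[symmetric] det_mult[OF C add_carrier_mat[OF A]]
    by (simp only: Re_complex_of_real Im_complex_of_real times_complex.sel)
  with \<open>1 \<le> (\<Prod>i<n. 1 + Re (es ! i))\<close> detC(2) show ?thesis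
    unfolding C_def by (simp add: mult_le_cancel_left1)
qed

section \<open>Gram matrices: exchange of rows and columns, monotonicity\<close>

text \<open>Sylvester's identity. The products of the block matrices \<open>?L\<close> and
  \<open>?U\<close> in the two orders are block triangular and carry the two determinants.\<close>

lemma det_one_plus_mult_commute:
  fixes A B :: "complex mat"
  assumes A: "A \<in> carrier_mat n m" and B: "B \<in> carrier_mat m n"
  shows "Determinant.det (1\<^sub>m n + A * B) = Determinant.det (1\<^sub>m m + B * A)"
proof -
  let ?U = "four_block_mat (1\<^sub>m n) (- A) B (1\<^sub>m m)"
  let ?L = "four_block_mat (1\<^sub>m n) A (0\<^sub>m m n) (1\<^sub>m m)"
  have dL: "Determinant.det ?L = 1"
    by (subst det_four_block_mat_lower_left_zero[OF _ A refl]) auto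
  have LU: "?L * ?U = four_block_mat (1\<^sub>m n + A * B) (0\<^sub>m n m) B (1\<^sub>m m)"
    by (subst mult_four_block_mat[of _ n n _ m _ m _ _ n _ m]) (use A B in auto)
  have UL: "?U * ?L = four_block_mat (1\<^sub>m n) (0\<^sub>m n m) B (1\<^sub>m m + B * A)"
    by (subst mult_four_block_mat[of _ n n _ m _ m _ _ n _ m])
       (use A B in \<open>auto simp: comm_add_mat[of _ m m]\<close>)
  have U: "?U \<in> carrier_mat (n + m) (n + m)" and L: "?L \<in> carrier_mat (n + m) (n + m)"
    using A B by auto
  have "Determinant.det (1\<^sub>m n + A * B) = Determinant.det (?L * ?U)"
    unfolding LU by (subst det_four_block_mat_upper_right_zero[of _ n _ m]) (use A B in auto)
  also have "\<dots> = Determinant.det (?U * ?L)"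
    using det_mult[OF L U] det_mult[OF U L] by simp
  also have "\<dots> = Determinant.det (1\<^sub>m m + B * A)"
    unfolding UL by (subst det_four_block_mat_upper_right_zero[of _ n _ m]) (use A B in auto)
  finally show ?thesis .
qed

text \<open>The adjoint of X times X, for the N by n matrix X. Rows and columns are truncated
  separately, so that the two limits can be taken in either order.\<close>

definition gram_mat :: "(nat \<Rightarrow> nat \<Rightarrow> complex) \<Rightarrow> nat \<Rightarrow> nat \<Rightarrow> complex mat" where
  "gram_mat X N n = Matrix.mat n n (\<lambda>(i, j). \<Sum>k<N. cnj (X k i) * X k j)"

lemma psd_of_quadratic_form:
  assumes "M \<in> carrier_mat n n"
    and "\<And>c :: nat \<Rightarrow> complex. 0 \<le> (\<Sum>i<n. \<Sum>j<n. cnj (c i) * M $$ (i, j) * c j)"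
  shows "psd_mat n M"
  unfolding psd_mat_def
proof (intro conjI ballI assms(1))
  fix v :: "complex vec" assume v: "v \<in> carrier_vec n"
  have "(M *\<^sub>v v) \<bullet>c v = (\<Sum>i<n. (\<Sum>j<n. M $$ (i, j) * v $ j) * cnj (v $ i))"
    using assms(1) v by (auto simp: scalar_prod_def lessThan_atLeast0 intro!: sum.cong)
  also have "\<dots> = (\<Sum>i<n. \<Sum>j<n. cnj (v $ i) * M $$ (i, j) * v $ j)"
    by (simp add: sum_distrib_right sum_distrib_left mult_ac)
  finally show "0 \<le> (M *\<^sub>v v) \<bullet>c v" using assms(2) by simp
qed

lemma psd_gram_mat: "psd_mat n (gram_mat X N n)"
proof (rule psd_of_quadratic_form)
  fix c :: "nat \<Rightarrow> complex"
  have "(\<Sum>i<n. \<Sum>j<n. cnj (c i) * gram_mat X N n $$ (i, j) * c j)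
      = (\<Sum>i<n. \<Sum>j<n. \<Sum>k<N. cnj (c i * X k i) * (c j * X k j))"
    by (intro sum.cong refl) (simp add: gram_mat_def sum_distrib_left sum_distrib_right mult_ac)
  also have "\<dots> = (\<Sum>k<N. \<Sum>i<n. \<Sum>j<n. cnj (c i * X k i) * (c j * X k j))"
    by (subst sum.swap[of _ "{..<N}"]) (subst sum.swap[of _ "{..<N}" "{..<n}"], simp)
  also have "\<dots> = (\<Sum>k<N. of_real ((cmod (\<Sum>i<n. c i * X k i))\<^sup>2))"
    by (intro sum.cong refl, subst sum.swap)
       (simp add: complex_norm_square sum_product mult.commute del: complex_cnj_mult of_real_power)
  also have "\<dots> \<ge> 0" by (intro sum_nonneg) (simp add: less_eq_complex_def)
  finally show "0 \<le> (\<Sum>i<n. \<Sum>j<n. cnj (c i) * gram_mat X N n $$ (i, j) * c j)" .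
qed (simp add: gram_mat_def)

lemma det_gram_mat_swap:
  "Determinant.det (1\<^sub>m n + gram_mat X N n)
     = Determinant.det (1\<^sub>m N + gram_mat (\<lambda>i k. cnj (X k i)) n N)"
proof -
  let ?X = "Matrix.mat N n (\<lambda>(k, i). X k i)" and ?Y = "Matrix.mat n N (\<lambda>(i, k). cnj (X k i))"
  have "gram_mat X N n = ?Y * ?X"
    by (intro eq_matI) (auto simp: gram_mat_def scalar_prod_def lessThan_atLeast0)
  moreover have "gram_mat (\<lambda>i k. cnj (X k i)) n N = ?X * ?Y"
    by (intro eq_matI) (auto simp: gram_mat_def scalar_prod_def lessThan_atLeast0)
  ultimately show ?thesis
    by (simp add: det_one_plus_mult_commute[of _ n N])
qed

text \<open>Additional rows of X add their own Gram matrix, which is positive semidefinite.\<close>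

lemma det_gram_mat_mono:
  assumes "N \<le> N'"
  shows "Re (Determinant.det (1\<^sub>m n + gram_mat X N n)) \<le> Re (Determinant.det (1\<^sub>m n + gram_mat X N' n))"
proof -
  have "gram_mat X N' n = gram_mat X N n + gram_mat (\<lambda>k. X (N + k)) (N' - N) n"
  proof (intro eq_matI)
    fix i j assume "i < dim_row (gram_mat X N n + gram_mat (\<lambda>k. X (N + k)) (N' - N) n)"
      "j < dim_col (gram_mat X N n + gram_mat (\<lambda>k. X (N + k)) (N' - N) n)"
    moreover have "(\<Sum>k<N'. f k) = (\<Sum>k<N. f k) + (\<Sum>k<N' - N. f (N + k))" for f :: "nat \<Rightarrow> complex"
    proof -
      have "{..<N'} = {..<N} \<union> {N..<N'}" using assms by auto
      then have "(\<Sum>k<N'. f k) = (\<Sum>k<N. f k) + (\<Sum>k\<in>{N..<N'}. f k)"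
        by (simp add: sum.union_disjoint ivl_disj_int)
      also have "(\<Sum>k\<in>{N..<N'}. f k) = (\<Sum>k<N' - N. f (N + k))"
        using sum.shift_bounds_nat_ivl[of f 0 N "N' - N"] assms by (simp add: lessThan_atLeast0 add.commute)
      finally show ?thesis .
    qed
    ultimately show "gram_mat X N' n $$ (i, j) = (gram_mat X N n + gram_mat (\<lambda>k. X (N + k)) (N' - N) n) $$ (i, j)"
      by (auto simp: gram_mat_def)
  qed (auto simp: gram_mat_def)
  then show ?thesis
    using det_one_plus_psd_mono[OF psd_gram_mat psd_gram_mat] by simp
qed

lemma tendsto_det:
  fixes M :: "'b \<Rightarrow> complex mat"
  assumes "\<And>k. M k \<in> carrier_mat n n" "L \<in> carrier_mat n n"
    and "\<And>i j. i < n \<Longrightarrow> j < n \<Longrightarrow> ((\<lambda>k. M k $$ (i, j)) \<longlongrightarrow> L $$ (i, j)) F"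
  shows "((\<lambda>k. Determinant.det (M k)) \<longlongrightarrow> Determinant.det L) F"
  unfolding det_def'[OF assms(1)] det_def'[OF assms(2)]
  by (intro tendsto_sum tendsto_mult tendsto_const tendsto_prod assms(3))
     (auto simp: permutes_def dest: permutes_in_image)

text \<open>Both limits are the supremum of the determinants of the finite truncations, which increase in
  either size; this makes the Fredholm determinant independent of the basis.\<close>

lemma lim_det_gram_swap:
  assumes M: "\<And>i j. (\<lambda>N. \<Sum>k<N. cnj (X k i) * X k j) \<longlonglongrightarrow> M i j"
    and L: "\<And>k l. (\<lambda>n. \<Sum>i<n. X k i * cnj (X l i)) \<longlonglongrightarrow> L k l"
    and bdd: "\<And>n N. (\<Sum>i<n. \<Sum>k<N. (cmod (X k i))\<^sup>2) \<le> T"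
  obtains D :: real where
    "(\<lambda>n. Determinant.det (Matrix.mat n n (\<lambda>(i, j). (if i = j then 1 else 0) + M i j))) \<longlonglongrightarrow> of_real D"
    "(\<lambda>n. Determinant.det (Matrix.mat n n (\<lambda>(k, l). (if k = l then 1 else 0) + L k l))) \<longlonglongrightarrow> of_real D"
proof -
  define a where "a n N = Re (Determinant.det (1\<^sub>m n + gram_mat X N n))" for n N
  have det_a: "Determinant.det (1\<^sub>m n + gram_mat X N n) = of_real (a n N)" for n N
    using det_one_plus_psd_bounds(1)[OF psd_gram_mat[of n X N]] by (simp add: a_def complex_eq_iff)
  have a_swap: "a n N = Re (Determinant.det (1\<^sub>m N + gram_mat (\<lambda>i k. cnj (X k i)) n N))" for n N
    unfolding a_def by (subst det_gram_mat_swap) simp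
  have mono1: "a n N \<le> a n N'" if "N \<le> N'" for n N N'
    unfolding a_def by (rule det_gram_mat_mono[OF that])
  have mono2: "a n N \<le> a n' N" if "n \<le> n'" for n n' N
    unfolding a_swap by (rule det_gram_mat_mono[OF that])
  \<comment> \<open>The trace of a Gram matrix is the sum of the squared entries of X, so
    \<open>T\<close> bounds all determinants at once.\<close>
  have a_le: "a n N \<le> exp T" for n N
  proof -
    have re: "Re (cnj z * z) = (cmod z)\<^sup>2" for z
      unfolding cmod_power2 by (simp add: power2_eq_square)
    have "Re (mat_trace (gram_mat X N n)) = (\<Sum>i<n. Re (\<Sum>k<N. cnj (X k i) * X k i))"
      by (simp add: mat_trace_def gram_mat_def)
    also have "\<dots> = (\<Sum>i<n. \<Sum>k<N. (cmod (X k i))\<^sup>2)"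
      by (simp only: Re_sum re)
    finally have "Re (mat_trace (gram_mat X N n)) = (\<Sum>i<n. \<Sum>k<N. (cmod (X k i))\<^sup>2)" .
    then have "a n N \<le> exp (\<Sum>i<n. \<Sum>k<N. (cmod (X k i))\<^sup>2)"
      unfolding a_def using det_one_plus_psd_bounds(3)[OF psd_gram_mat[of n X N]] by simp
    also have "\<dots> \<le> exp T" using bdd by simp
    finally show ?thesis .
  qed
  define D where "D = (SUP p. a (fst p) (snd p))"
  have bd: "bdd_above (range (\<lambda>p. a (fst p) (snd p)))"
    using a_le by (intro bdd_aboveI[of _ "exp T"]) auto
  have a_D: "a n N \<le> D" for n N
    unfolding D_def using cSUP_upper[OF _ bd, of "(n, N)"] by simp
  have a_near: "\<exists>n N. y < a n N" if "y < D" for y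
    using that less_cSUP_iff[OF _ bd, of y] unfolding D_def by auto
  \<comment> \<open>Iterated limits of a bounded double sequence that increases in both indices
    equal its supremum. \<open>b\<close> is a variable so that both orders of the limits are
    instances.\<close>
  have lim: "(\<lambda>n. m n) \<longlonglongrightarrow> D"
    if 1: "\<And>n. (\<lambda>N. b n N) \<longlonglongrightarrow> m n" and 2: "\<And>n N. b n N \<le> D"
      and 3: "\<And>y. y < D \<Longrightarrow> \<exists>n N. y < b n N"
      and 4: "\<And>n n' N N'. n \<le> n' \<Longrightarrow> N \<le> N' \<Longrightarrow> b n N \<le> b n' N'" for b :: "nat \<Rightarrow> nat \<Rightarrow> real" and m
  proof (rule order_tendstoI)
    have mD: "m n \<le> D" for n
      by (rule LIMSEQ_le_const2[OF 1]) (use 2 in auto)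
    have bm: "b n N \<le> m n" for n N
      by (rule LIMSEQ_le_const[OF 1]) (use 4[OF order_refl] in blast)
    { fix y assume "D < y" then show "eventually (\<lambda>n. m n < y) sequentially"
        using mD by (auto intro: le_less_trans always_eventually) }
    { fix y assume "y < D"
      then obtain n N where "y < b n N" using 3 by blast
      then have "y < m n'" if "n \<le> n'" for n'
        using bm[of n' N] 4[OF that order_refl, of N] by linarith
      then show "eventually (\<lambda>n. y < m n) sequentially"
        by (auto simp: eventually_sequentially) }
  qed
  have id_plus: "Matrix.mat n n (\<lambda>(i, j). (if i = j then 1 else 0) + H i j) = 1\<^sub>m n + Matrix.mat n n (\<lambda>(i, j). H i j)" for n and H :: "nat \<Rightarrow> nat \<Rightarrow> complex"
    by (intro eq_matI) auto
  define m where "m n = Re (Determinant.det (1\<^sub>m n + Matrix.mat n n (\<lambda>(i, j). M i j)))" for n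
  define l where "l n = Re (Determinant.det (1\<^sub>m n + Matrix.mat n n (\<lambda>(i, j). L i j)))" for n
  have m0: "(\<lambda>N. complex_of_real (a n N)) \<longlonglongrightarrow> Determinant.det (1\<^sub>m n + Matrix.mat n n (\<lambda>(i, j). M i j))" for n
    unfolding det_a[symmetric]
    by (rule tendsto_det[of _ n]) (auto simp: gram_mat_def intro!: tendsto_intros M)
  have l0: "(\<lambda>n. complex_of_real (a n N)) \<longlonglongrightarrow> Determinant.det (1\<^sub>m N + Matrix.mat N N (\<lambda>(i, j). L i j))" for N
    unfolding det_a[symmetric] det_gram_mat_swap[of _ X]
    by (rule tendsto_det[of _ N]) (auto simp: gram_mat_def intro!: tendsto_intros L)
  \<comment> \<open>A limit of real numbers is real: the imaginary parts form a constant
    sequence.\<close>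
  have m1: "Determinant.det (1\<^sub>m n + Matrix.mat n n (\<lambda>(i, j). M i j)) = of_real (m n)" for n
    using tendsto_Im[OF m0[of n]] by (simp add: m_def complex_eq_iff LIMSEQ_const_iff)
  have l1: "Determinant.det (1\<^sub>m n + Matrix.mat n n (\<lambda>(i, j). L i j)) = of_real (l n)" for n
    using tendsto_Im[OF l0[of n]] by (simp add: l_def complex_eq_iff LIMSEQ_const_iff)
  have mono: "a n N \<le> a n' N'" if "n \<le> n'" "N \<le> N'" for n n' N N'
    using mono1[OF that(2), of n] mono2[OF that(1), of N'] by linarith
  have "m \<longlonglongrightarrow> D"
    using m0 m1 a_D a_near mono
    by (intro lim[of a]) (auto simp: tendsto_of_real_iff)
  moreover have a_near': "\<exists>N n. y < a n N" if "y < D" for y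
    using a_near[OF that] by blast
  have "l \<longlonglongrightarrow> D"
    using l0 l1 a_D a_near' mono
    by (intro lim[of "\<lambda>N n. a n N"]) (auto simp: tendsto_of_real_iff)
  ultimately show ?thesis
    using that[of D] by (simp add: id_plus m1 l1 tendsto_of_real_iff)
qed

section \<open>From Laplace transforms to characteristic functions\<close>

text \<open>The lower bound makes exp (- z Z) bounded for Re z >= 0, so that every transform below
  exists. In the application it comes from the nonnegativity of \<open>pairing\<close>, with a
  constant that depends on the scale.\<close>

locale bounded_below_rv = prob_space +
  fixes Z :: "'a \<Rightarrow> real" and c :: real
  assumes Z_meas [measurable]: "Z \<in> borel_measurable M"
    and Z_ge: "\<And>\<omega>. \<omega> \<in> space M \<Longrightarrow> c \<le> Z \<omega>"
begin

definition lap :: "complex \<Rightarrow> complex" where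
  "lap z = (LINT \<omega>|M. exp (- z * of_real (Z \<omega>)))"

lemma norm_exp_le:
  assumes "\<omega> \<in> space M" "0 \<le> Re z"
  shows "cmod (exp (- z * of_real (Z \<omega>))) \<le> exp (- Re z * c)"
  using mult_left_mono[OF Z_ge[OF assms(1)] assms(2)] by simp

lemma integrable_lap:
  assumes "0 \<le> Re z"
  shows "integrable M (\<lambda>\<omega>. exp (- z * of_real (Z \<omega>)))"
  by (rule integrable_const_bound[of _ "exp (- Re z * c)"])
     (use norm_exp_le[OF _ assms] in \<open>auto intro!: AE_I2\<close>)

lemma integrable_real_lap:
  assumes "0 \<le> u"
  shows "integrable M (\<lambda>\<omega>. exp (- u * Z \<omega>))"
  by (rule integrable_const_bound[of _ "exp (- u * c)"])
     (use Z_ge assms in \<open>auto intro!: AE_I2 mult_left_mono\<close>)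

lemma lap_of_real: "lap (of_real u) = of_real (LINT \<omega>|M. exp (- u * Z \<omega>))"
  unfolding lap_def by (subst integral_complex_of_real[symmetric]) (simp flip: exp_of_real)

lemma norm_lap_le:
  assumes "0 \<le> Re z"
  shows "cmod (lap z) \<le> (LINT \<omega>|M. exp (- Re z * Z \<omega>))"
proof -
  have "cmod (lap z) \<le> (LINT \<omega>|M. cmod (exp (- z * of_real (Z \<omega>))))"
    unfolding lap_def by (rule integral_norm_bound)
  also have "\<dots> = (LINT \<omega>|M. exp (- Re z * Z \<omega>))" by simp
  finally show ?thesis .
qed

text \<open>Two values on the real axis bound the transform on a whole vertical strip. Pointwise
  convergence there thus gives the local boundedness that Montel's theorem demands.\<close>

lemma norm_lap_le_between:
  assumes "0 \<le> a" "a \<le> Re z" "Re z \<le> b"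
  shows "cmod (lap z) \<le> (LINT \<omega>|M. exp (- a * Z \<omega>)) + (LINT \<omega>|M. exp (- b * Z \<omega>))"
proof -
  have pos: "0 \<le> Re z" "0 \<le> b" using assms by auto
  have "(LINT \<omega>|M. exp (- Re z * Z \<omega>)) \<le> (LINT \<omega>|M. exp (- a * Z \<omega>) + exp (- b * Z \<omega>))"
  proof (rule integral_mono)
    fix \<omega>
    have "- Re z * Z \<omega> \<le> - a * Z \<omega> \<or> - Re z * Z \<omega> \<le> - b * Z \<omega>"
      using mult_right_mono[OF assms(2), of "Z \<omega>"] mult_right_mono_neg[OF assms(3), of "Z \<omega>"]
      by (cases "0 \<le> Z \<omega>") auto
    then show "exp (- Re z * Z \<omega>) \<le> exp (- a * Z \<omega>) + exp (- b * Z \<omega>)"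
      by (smt (verit) exp_gt_zero exp_le_cancel_iff)
  qed (use integrable_real_lap[OF pos(1)] integrable_real_lap[OF pos(2)] integrable_real_lap[OF assms(1)] in auto)
  also have "\<dots> = (LINT \<omega>|M. exp (- a * Z \<omega>)) + (LINT \<omega>|M. exp (- b * Z \<omega>))"
    by (rule Bochner_Integration.integral_add[OF integrable_real_lap[OF assms(1)] integrable_real_lap[OF pos(2)]])
  finally show ?thesis using norm_lap_le[OF pos(1)] by linarith
qed

text \<open>With d = Re z / 4, an increment of size at most d costs a factor exp (d |Z|) |Z|, at
  most exp (2 d |Z|) / d. The decay exp (-4 d Z) outweighs it where Z is positive, and the lower
  bound c takes care of negative Z.\<close>

lemma lap_difference_quotient_bound:
  assumes x: "0 < Re z" and h: "h \<noteq> 0" "cmod h \<le> Re z / 4" and \<omega>: "\<omega> \<in> space M"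
  shows "cmod ((exp (- (z + h) * of_real (Z \<omega>)) - exp (- z * of_real (Z \<omega>))) / h)
      \<le> 4 / Re z * exp (2 * Re z * \<bar>c\<bar>)"
proof -
  define d where "d = Re z / 4"
  have d: "0 < d" "Re z = 4 * d" using x by (auto simp: d_def)
  let ?Z = "Z \<omega>"
  have "exp (- (z + h) * of_real ?Z) - exp (- z * of_real ?Z)
      = exp (- z * of_real ?Z) * (exp (- h * of_real ?Z) - 1)"
    by (simp add: ring_distribs exp_add exp_diff divide_inverse exp_minus mult_ac)
  then have "cmod ((exp (- (z + h) * of_real ?Z) - exp (- z * of_real ?Z)) / h)
      = exp (- 4 * d * ?Z) * cmod (exp (- h * of_real ?Z) - 1) / cmod h"
    using d by (simp add: norm_mult norm_divide)
  also have "cmod (exp (- h * of_real ?Z) - 1) \<le> exp \<bar>Re (- h * of_real ?Z)\<bar> * cmod (- h * of_real ?Z)"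
    using Taylor_exp[of "- h * of_real ?Z" 0] by simp
  also have "\<dots> \<le> exp (d * \<bar>?Z\<bar>) * (cmod h * \<bar>?Z\<bar>)"
  proof (intro mult_mono)
    have "\<bar>Re h\<bar> \<le> d" using abs_Re_le_cmod[of h] h by (simp add: d_def)
    then show "exp \<bar>Re (- h * of_real ?Z)\<bar> \<le> exp (d * \<bar>?Z\<bar>)"
      by (simp add: abs_mult mult_right_mono)
  qed (auto simp: norm_mult)
  finally have 1: "cmod ((exp (- (z + h) * of_real ?Z) - exp (- z * of_real ?Z)) / h)
      \<le> exp (- 4 * d * ?Z) * (exp (d * \<bar>?Z\<bar>) * \<bar>?Z\<bar>)"
    using h by (simp add: divide_simps mult_left_mono mult_ac)
  have "d * \<bar>?Z\<bar> \<le> exp (d * \<bar>?Z\<bar>)"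
    using exp_ge_add_one_self[of "d * \<bar>?Z\<bar>"] by linarith
  then have "\<bar>?Z\<bar> \<le> exp (d * \<bar>?Z\<bar>) / d"
    using d by (simp add: field_simps)
  then have "exp (- 4 * d * ?Z) * (exp (d * \<bar>?Z\<bar>) * \<bar>?Z\<bar>)
      \<le> exp (- 4 * d * ?Z) * (exp (d * \<bar>?Z\<bar>) * (exp (d * \<bar>?Z\<bar>) / d))"
    by (intro mult_left_mono) auto
  also have "\<dots> = exp (- 4 * d * ?Z + 2 * (d * \<bar>?Z\<bar>)) / d"
    by (simp add: exp_add[symmetric] mult_ac)
  also have "\<dots> \<le> exp (8 * d * \<bar>c\<bar>) / d"
  proof -
    \<comment> \<open>For negative \<open>?Z\<close> the left side is at most |c| while the right
      side is at least 2 |c|.\<close>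
    have "\<bar>?Z\<bar> \<le> 2 * ?Z + 4 * \<bar>c\<bar>" using Z_ge[OF \<omega>] by linarith
    then have "(2 * d) * \<bar>?Z\<bar> \<le> (2 * d) * (2 * ?Z + 4 * \<bar>c\<bar>)" using d by (intro mult_left_mono) auto
    then show ?thesis using d by (intro divide_right_mono) (auto simp: algebra_simps)
  qed
  finally have 2: "exp (- 4 * d * ?Z) * (exp (d * \<bar>?Z\<bar>) * \<bar>?Z\<bar>) \<le> exp (8 * d * \<bar>c\<bar>) / d" .
  have "4 / Re z * exp (2 * Re z * \<bar>c\<bar>) = exp (8 * d * \<bar>c\<bar>) / d"
    using d by simp
  then show ?thesis using order_trans[OF 1 2] by simp
qed

lemma lap_has_field_derivative:
  assumes x: "0 < Re z"
  shows "(lap has_field_derivative (LINT \<omega>|M. - of_real (Z \<omega>) * exp (- z * of_real (Z \<omega>)))) (at z)"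
  unfolding DERIV_def tendsto_at_iff_sequentially
proof (intro allI impI)
  fix h :: "nat \<Rightarrow> complex"
  assume h0: "\<forall>i. h i \<in> UNIV - {0}" and h: "h \<longlonglongrightarrow> 0"
  have "eventually (\<lambda>i. cmod (h i) < Re z / 4) sequentially"
    using tendsto_norm_zero[OF h] x by (intro order_tendstoD(2)[of _ 0]) auto
  then obtain N where N: "\<And>i. N \<le> i \<Longrightarrow> cmod (h i) < Re z / 4"
    by (auto simp: eventually_sequentially)
  \<comment> \<open>Dropping finitely many terms brings all increments into the range of the
    majorant.\<close>
  define k where "k = (\<lambda>i. h (i + N))"
  have k0: "k i \<noteq> 0" and k: "k \<longlonglongrightarrow> 0" and ksmall: "cmod (k i) \<le> Re z / 4" for i
    using h0 h N[of "i + N"] by (auto simp: k_def LIMSEQ_ignore_initial_segment)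
  have q: "(lap (z + k i) - lap z) / k i
      = (LINT \<omega>|M. (exp (- (z + k i) * of_real (Z \<omega>)) - exp (- z * of_real (Z \<omega>))) / k i)" for i
  proof -
    have "\<bar>Re (k i)\<bar> \<le> Re z / 4" using ksmall[of i] abs_Re_le_cmod[of "k i"] by linarith
    then have "0 \<le> Re (z + k i)" using x by (simp add: abs_le_iff)
    then show ?thesis
      unfolding lap_def using integrable_lap[of "z + k i"] integrable_lap[of z] x by simp
  qed
  have "(\<lambda>i. LINT \<omega>|M. (exp (- (z + k i) * of_real (Z \<omega>)) - exp (- z * of_real (Z \<omega>))) / k i)
      \<longlonglongrightarrow> (LINT \<omega>|M. - of_real (Z \<omega>) * exp (- z * of_real (Z \<omega>)))"
  proof (rule integral_dominated_convergence)
    show "integrable M (\<lambda>\<omega>. 4 / Re z * exp (2 * Re z * \<bar>c\<bar>))" by simp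
    show "AE \<omega> in M. (\<lambda>i. (exp (- (z + k i) * of_real (Z \<omega>)) - exp (- z * of_real (Z \<omega>))) / k i)
        \<longlonglongrightarrow> - of_real (Z \<omega>) * exp (- z * of_real (Z \<omega>))"
    proof (intro AE_I2)
      fix \<omega>
      have "((\<lambda>w. exp (- w * of_real (Z \<omega>))) has_field_derivative - of_real (Z \<omega>) * exp (- z * of_real (Z \<omega>))) (at z)"
        by (auto intro!: derivative_eq_intros)
      then show "(\<lambda>i. (exp (- (z + k i) * of_real (Z \<omega>)) - exp (- z * of_real (Z \<omega>))) / k i)
        \<longlonglongrightarrow> - of_real (Z \<omega>) * exp (- z * of_real (Z \<omega>))"
        unfolding DERIV_def tendsto_at_iff_sequentially using k k0 by (auto simp: o_def)
    qed
    show "AE \<omega> in M. norm ((exp (- (z + k i) * of_real (Z \<omega>)) - exp (- z * of_real (Z \<omega>))) / k i)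
        \<le> 4 / Re z * exp (2 * Re z * \<bar>c\<bar>)" for i
      using lap_difference_quotient_bound[OF x k0 ksmall] by (intro AE_I2)
  qed measurable
  then have "(\<lambda>i. ((\<lambda>h. (lap (z + h) - lap z) / h) \<circ> h) (i + N))
      \<longlonglongrightarrow> (LINT \<omega>|M. - of_real (Z \<omega>) * exp (- z * of_real (Z \<omega>)))"
    by (simp only: o_def q[unfolded k_def] k_def)
  then show "((\<lambda>h. (lap (z + h) - lap z) / h) \<circ> h) \<longlonglongrightarrow> (LINT \<omega>|M. - of_real (Z \<omega>) * exp (- z * of_real (Z \<omega>)))"
    by (rule LIMSEQ_offset)
qed

lemma lap_holomorphic: "lap holomorphic_on {z. 0 < Re z}"
  using lap_has_field_derivative
  by (auto simp: holomorphic_on_def field_differentiable_def intro: has_field_derivative_at_within)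

text \<open>Since |exp (i t Z)| = 1, the difference is at most the expectation of |1 - exp (- d Z)|,
  and Cauchy-Schwarz leaves only the real transforms at d and 2 d. Their limits are known, so the
  passage from the boundary into the half plane is controlled along the whole sequence.\<close>

lemma lap_shift_bound:
  assumes "0 \<le> d"
  shows "cmod (lap (- \<i> * of_real t) - lap (of_real d - \<i> * of_real t))
      \<le> sqrt (1 - 2 * (LINT \<omega>|M. exp (- d * Z \<omega>)) + (LINT \<omega>|M. exp (- (2 * d) * Z \<omega>)))"
proof -
  define Y where "Y \<omega> = \<bar>1 - exp (- d * Z \<omega>)\<bar>" for \<omega>
  have intd: "integrable M (\<lambda>\<omega>. exp (- d * Z \<omega>))" "integrable M (\<lambda>\<omega>. exp (- (2 * d) * Z \<omega>))"
    using integrable_real_lap[of d] integrable_real_lap[of "2 * d"] assms by simp_all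
  have Y2: "(Y \<omega>)\<^sup>2 = 1 - 2 * exp (- d * Z \<omega>) + exp (- (2 * d) * Z \<omega>)" for \<omega>
  proof -
    have "exp (- (2 * d) * Z \<omega>) = (exp (- d * Z \<omega>))\<^sup>2"
      by (simp add: power2_eq_square exp_add[symmetric])
    then show ?thesis by (simp add: Y_def power2_diff)
  qed
  have intY: "integrable M Y" unfolding Y_def using intd by auto
  have intY2: "integrable M (\<lambda>\<omega>. (Y \<omega>)\<^sup>2)" unfolding Y2 using intd by auto
  have "lap (- \<i> * of_real t) - lap (of_real d - \<i> * of_real t)
      = (LINT \<omega>|M. exp (- (- \<i> * of_real t) * of_real (Z \<omega>)) - exp (- (of_real d - \<i> * of_real t) * of_real (Z \<omega>)))"
    unfolding lap_def
    by (rule Bochner_Integration.integral_diff[symmetric]; rule integrable_lap) (use assms in auto)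
  also have "cmod \<dots> \<le> (LINT \<omega>|M. cmod (exp (- (- \<i> * of_real t) * of_real (Z \<omega>)) - exp (- (of_real d - \<i> * of_real t) * of_real (Z \<omega>))))"
    by (rule integral_norm_bound)
  also have "\<dots> = (LINT \<omega>|M. Y \<omega>)"
  proof (intro Bochner_Integration.integral_cong refl)
    fix \<omega>
    have "exp (- (- \<i> * of_real t) * of_real (Z \<omega>)) - exp (- (of_real d - \<i> * of_real t) * of_real (Z \<omega>))
        = exp (\<i> * of_real (t * Z \<omega>)) * of_real (1 - exp (- d * Z \<omega>))"
      by (simp add: ring_distribs exp_add exp_diff exp_of_real[symmetric] exp_minus divide_inverse mult_ac)
    then show "cmod (exp (- (- \<i> * of_real t) * of_real (Z \<omega>)) - exp (- (of_real d - \<i> * of_real t) * of_real (Z \<omega>))) = Y \<omega>"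
      by (simp only: norm_mult norm_exp_i_times norm_of_real Y_def mult_1_left)
  qed
  also have "\<dots> \<le> sqrt (LINT \<omega>|M. (Y \<omega>)\<^sup>2)"
    using variance_eq[OF intY intY2] variance_positive[of Y] by (intro real_le_rsqrt) simp
  also have "(LINT \<omega>|M. (Y \<omega>)\<^sup>2) = 1 - 2 * (LINT \<omega>|M. exp (- d * Z \<omega>)) + (LINT \<omega>|M. exp (- (2 * d) * Z \<omega>))"
    unfolding Y2 using intd by (simp add: prob_space)
  finally show ?thesis .
qed

end

text \<open>One-sided version of Curtiss' theorem: Montel's theorem carries the convergence of the Laplace
  transforms from the positive axis to the open right half plane, and \<open>lap_shift_bound\<close> from there
  to its boundary.\<close>

lemma laplace_convergence_imp_char_convergence:
  fixes Z :: "nat \<Rightarrow> 'w \<Rightarrow> real"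
  assumes M: "prob_space M"
    and Z: "\<And>n. Z n \<in> borel_measurable M" "\<And>n \<omega>. \<omega> \<in> space M \<Longrightarrow> c n \<le> Z n \<omega>"
    and lim: "\<And>u. 0 < u \<Longrightarrow> (\<lambda>n. LINT \<omega>|M. exp (- u * Z n \<omega>)) \<longlonglongrightarrow> exp (u\<^sup>2 / 2)"
  shows "(\<lambda>n. LINT \<omega>|M. exp (\<i> * of_real (t * Z n \<omega>))) \<longlonglongrightarrow> complex_of_real (exp (- t\<^sup>2 / 2))"
proof -
  interpret prob_space M by (rule M)
  interpret b: bounded_below_rv M "Z n" "c n" for n
    by unfold_locales (use Z in auto)
  define L where "L n = bounded_below_rv.lap M (Z n)" for n
  let ?S = "{z. 0 < Re z}"
  have S: "open ?S" "connected ?S"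
    by (auto simp: open_halfspace_Re_gt intro!: convex_connected convex_halfspace_Re_gt)
  have hol: "L n holomorphic_on ?S" for n
    unfolding L_def by (rule b.lap_holomorphic)
  have bnd: "\<exists>B. \<forall>h\<in>range L. \<forall>z\<in>K. cmod (h z) \<le> B" if K: "compact K" "K \<subseteq> ?S" for K
  proof (cases "K = {}")
    case False
    have cK: "compact (Re ` K)" using K by (intro compact_continuous_image continuous_intros)
    obtain a b where ab: "a \<in> Re ` K" "b \<in> Re ` K" "\<And>z. z \<in> K \<Longrightarrow> a \<le> Re z \<and> Re z \<le> b"
      using compact_attains_inf[OF cK] compact_attains_sup[OF cK] False by (metis imageI image_is_empty)
    have pos: "0 < a" "0 < b" using ab K by auto
    obtain A B where AB: "\<And>n. \<bar>LINT \<omega>|M. exp (- a * Z n \<omega>)\<bar> \<le> A" "\<And>n. \<bar>LINT \<omega>|M. exp (- b * Z n \<omega>)\<bar> \<le> B"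
      using convergent_imp_Bseq[OF convergentI[OF lim[OF pos(1)]]] convergent_imp_Bseq[OF convergentI[OF lim[OF pos(2)]]]
      unfolding Bseq_def real_norm_def by metis
    have "cmod (L n z) \<le> A + B" if "z \<in> K" for n z
      using b.norm_lap_le_between[of a z b n] ab(3)[OF that] pos AB[of n] unfolding L_def by linarith
    then show ?thesis by blast
  qed auto
  have conv: "(\<lambda>n. L n z) \<longlonglongrightarrow> exp (z\<^sup>2 / 2)" if z: "0 < Re z" for z
  proof (rule ccontr)
    assume "\<not> ?thesis"
    then obtain e where e: "0 < e" "\<not> eventually (\<lambda>n. dist (L n z) (exp (z\<^sup>2 / 2)) < e) sequentially"
      unfolding tendsto_iff by blast
    then obtain r :: "nat \<Rightarrow> nat" where r: "strict_mono r" "\<And>n. \<not> dist (L (r n) z) (exp (z\<^sup>2 / 2)) < e"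
      using not_eventually_sequentiallyD by blast
    obtain g q where g: "g holomorphic_on ?S" "strict_mono (q :: nat \<Rightarrow> nat)"
      "\<And>x. x \<in> ?S \<Longrightarrow> (\<lambda>n. L (r (q n)) x) \<longlonglongrightarrow> g x"
    proof (rule Montel[of ?S "range L" "\<lambda>n. L (r n)"])
      show "h holomorphic_on ?S" if "h \<in> range L" for h using that hol by auto
    qed (use S bnd in auto)
    \<comment> \<open>\<open>g\<close> agrees with the expected limit on the positive reals, which
      accumulate at 1. By the identity theorem it agrees at \<open>z\<close> too, against the choice
      of the subsequence \<open>r\<close>.\<close>
    have "g z - exp (z\<^sup>2 / 2) = 0"
    proof (rule analytic_continuation[of "\<lambda>z. g z - exp (z\<^sup>2 / 2)" ?S "complex_of_real ` {0<..}" 1])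
      show "(\<lambda>z. g z - exp (z\<^sup>2 / 2)) holomorphic_on ?S" by (intro holomorphic_intros g(1)) auto
      show "(1::complex) islimpt complex_of_real ` {0<..}"
        unfolding islimpt_sequential
      proof (intro exI[of _ "\<lambda>n. complex_of_real (1 + 1 / real (Suc n))"] conjI allI)
        show "(\<lambda>n. complex_of_real (1 + 1 / real (Suc n))) \<longlonglongrightarrow> 1"
          using tendsto_of_real[OF tendsto_add[OF tendsto_const LIMSEQ_inverse_real_of_nat], of 1, where 'a = complex]
          by (simp add: inverse_eq_divide)
        show "complex_of_real (1 + 1 / real (Suc n)) \<in> complex_of_real ` {0<..} - {1}" for n
        proof -
          have p: "0 < 1 / real (Suc n)" by simp
          then have "complex_of_real (1 + 1 / real (Suc n)) \<noteq> complex_of_real 1"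
            unfolding of_real_eq_iff by linarith
          then show ?thesis using p by (intro DiffI imageI) (auto simp del: of_nat_Suc intro: add_pos_pos)
        qed
      qed
      show "g x - exp (x\<^sup>2 / 2) = 0" if x: "x \<in> complex_of_real ` {0<..}" for x
      proof -
        obtain u where u: "x = of_real u" "0 < u" using x by auto
        have "(\<lambda>n. L n x) \<longlonglongrightarrow> of_real (exp (u\<^sup>2 / 2))"
          unfolding u(1) L_def b.lap_of_real by (intro tendsto_of_real lim u(2))
        then have "(\<lambda>n. L (r (q n)) x) \<longlonglongrightarrow> of_real (exp (u\<^sup>2 / 2))"
          using LIMSEQ_subseq_LIMSEQ[OF _ strict_mono_o[OF r(1) g(2)]] by (auto simp: o_def)
        then have "g x = of_real (exp (u\<^sup>2 / 2))"
          using g(3)[of x] u LIMSEQ_unique by auto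
        then show ?thesis using u by (simp add: exp_of_real[symmetric])
      qed
    qed (use S z in auto)
    then have "(\<lambda>n. L (r (q n)) z) \<longlonglongrightarrow> exp (z\<^sup>2 / 2)" using g(3)[of z] z by simp
    then have "eventually (\<lambda>n. dist (L (r (q n)) z) (exp (z\<^sup>2 / 2)) < e) sequentially"
      using e(1) unfolding tendsto_iff by blast
    then show False using r(2) by auto
  qed
  have char: "(LINT \<omega>|M. exp (\<i> * of_real (t * Z n \<omega>))) = L n (- \<i> * of_real t)" for n
    unfolding L_def b.lap_def by (simp add: mult_ac)
  \<comment> \<open>\<open>C d\<close> is the limit in n of the bound of
    \<open>lap_shift_bound\<close>. It vanishes at d = 0, so a small d is fixed before n tends to
    infinity.\<close>
  define C where "C d = sqrt (1 - 2 * exp (d\<^sup>2 / 2) + exp ((2 * d)\<^sup>2 / 2))" for d :: real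
  have "((\<lambda>d. C d + dist (exp ((of_real d - \<i> * of_real t)\<^sup>2 / 2)) (complex_of_real (exp (- t\<^sup>2 / 2))))
      \<longlongrightarrow> C 0 + dist (exp ((of_real 0 - \<i> * of_real t)\<^sup>2 / 2)) (complex_of_real (exp (- t\<^sup>2 / 2)))) (at_right 0)"
    unfolding C_def by (intro tendsto_intros) simp_all
  moreover have "exp ((of_real 0 - \<i> * of_real t)\<^sup>2 / 2) = complex_of_real (exp (- t\<^sup>2 / 2))"
    by (simp add: power_mult_distrib exp_of_real[symmetric])
  ultimately have small: "((\<lambda>d. C d + dist (exp ((of_real d - \<i> * of_real t)\<^sup>2 / 2)) (complex_of_real (exp (- t\<^sup>2 / 2)))) \<longlongrightarrow> 0) (at_right 0)"
    by (simp add: C_def)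
  show ?thesis
    unfolding char
  proof (rule metric_LIMSEQ_I)
    fix e :: real assume e: "0 < e"
    have "eventually (\<lambda>d. C d + dist (exp ((of_real d - \<i> * of_real t)\<^sup>2 / 2)) (complex_of_real (exp (- t\<^sup>2 / 2))) < e) (at_right 0)"
      using order_tendstoD(2)[OF small e] .
    then have "eventually (\<lambda>d. 0 < d \<and> C d + dist (exp ((of_real d - \<i> * of_real t)\<^sup>2 / 2)) (complex_of_real (exp (- t\<^sup>2 / 2))) < e) (at_right 0)"
      using eventually_at_right_less[of "0::real"] by eventually_elim auto
    then obtain d where d: "0 < d" "C d + dist (exp ((of_real d - \<i> * of_real t)\<^sup>2 / 2)) (complex_of_real (exp (- t\<^sup>2 / 2))) < e"
      using eventually_happens'[OF trivial_limit_at_right_real] by blast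
    let ?b = "\<lambda>n. sqrt (1 - 2 * (LINT \<omega>|M. exp (- d * Z n \<omega>)) + (LINT \<omega>|M. exp (- (2 * d) * Z n \<omega>)))
      + dist (L n (of_real d - \<i> * of_real t)) (complex_of_real (exp (- t\<^sup>2 / 2)))"
    have "?b \<longlonglongrightarrow> C d + dist (exp ((of_real d - \<i> * of_real t)\<^sup>2 / 2)) (complex_of_real (exp (- t\<^sup>2 / 2)))"
      unfolding C_def using d(1) by (intro tendsto_intros lim conv) auto
    then have "eventually (\<lambda>n. ?b n < e) sequentially"
      by (rule order_tendstoD(2)[OF _ d(2)])
    then obtain N where N: "\<And>n. N \<le> n \<Longrightarrow> ?b n < e" by (auto simp: eventually_sequentially)
    have "dist (L n (- \<i> * of_real t)) (complex_of_real (exp (- t\<^sup>2 / 2))) \<le> ?b n" for n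
      using b.lap_shift_bound[of d n t] d(1)
        dist_triangle[of "L n (- \<i> * of_real t)" "complex_of_real (exp (- t\<^sup>2 / 2))" "L n (of_real d - \<i> * of_real t)"]
      unfolding L_def dist_norm by linarith
    with N show "\<exists>N. \<forall>n\<ge>N. dist (L n (- \<i> * of_real t)) (complex_of_real (exp (- t\<^sup>2 / 2))) < e"
      by (meson le_less_trans)
  qed
qed

section \<open>The Hilbert space \<open>L\<^sup>2\<close>\<close>

lemma borel_measurable_cnj [measurable (raw)]:
  "f \<in> borel_measurable M \<Longrightarrow> (\<lambda>x. cnj (f x)) \<in> borel_measurable M"
  by (rule borel_measurable_continuous_on[OF continuous_on_cnj[OF continuous_on_id]])

lemma L2_measurable [measurable_dest]: "h \<in> L2 \<Longrightarrow> h \<in> borel_measurable borel"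
  by (simp add: L2_def)

lemma L2_integrable: "h \<in> L2 \<Longrightarrow> integrable lborel (\<lambda>x. (cmod (h x))\<^sup>2)"
  by (simp add: L2_def)

lemma L2_I: "h \<in> borel_measurable borel \<Longrightarrow> integrable lborel (\<lambda>x. (cmod (h x))\<^sup>2) \<Longrightarrow> h \<in> L2"
  by (simp add: L2_def)

lemma L2_I_bound:
  assumes [measurable]: "h \<in> borel_measurable borel" and "integrable lborel f"
    and "\<And>x. (cmod (h x))\<^sup>2 \<le> f x"
  shows "h \<in> L2"
proof (rule L2_I[OF assms(1)])
  show "integrable lborel (\<lambda>x. (cmod (h x))\<^sup>2)"
    by (rule Bochner_Integration.integrable_bound[OF assms(2)])
       (use assms(3) in \<open>auto intro!: AE_I2 intro: order_trans[OF _ abs_ge_self]\<close>)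
qed

lemma L2_zero [simp]: "(\<lambda>x. 0) \<in> L2"
  by (rule L2_I) auto

lemma L2_add [intro]:
  assumes g: "g \<in> L2" and h: "h \<in> L2"
  shows "(\<lambda>x. g x + h x) \<in> L2"
proof (rule L2_I_bound)
  show "(\<lambda>x. g x + h x) \<in> borel_measurable borel" using g h by measurable
  show "integrable lborel (\<lambda>x. 2 * (cmod (g x))\<^sup>2 + 2 * (cmod (h x))\<^sup>2)"
    using L2_integrable[OF g] L2_integrable[OF h] by auto
  fix x
  have "(cmod (g x + h x))\<^sup>2 \<le> (cmod (g x) + cmod (h x))\<^sup>2"
    by (intro power_mono norm_triangle_ineq) auto
  also have "\<dots> \<le> 2 * (cmod (g x))\<^sup>2 + 2 * (cmod (h x))\<^sup>2"
    using zero_le_power2[of "cmod (g x) - cmod (h x)"] by (simp add: power2_eq_square algebra_simps)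
  finally show "(cmod (g x + h x))\<^sup>2 \<le> 2 * (cmod (g x))\<^sup>2 + 2 * (cmod (h x))\<^sup>2" .
qed

lemma L2_cmult [intro]:
  assumes h: "h \<in> L2"
  shows "(\<lambda>x. c * h x) \<in> L2"
proof (rule L2_I)
  show "(\<lambda>x. c * h x) \<in> borel_measurable borel" using h by measurable
  show "integrable lborel (\<lambda>x. (cmod (c * h x))\<^sup>2)"
    using L2_integrable[OF h] by (simp add: norm_mult power_mult_distrib)
qed

lemma L2_diff [intro]:
  assumes g: "g \<in> L2" and h: "h \<in> L2"
  shows "(\<lambda>x. g x - h x) \<in> L2"
  using L2_add[OF g L2_cmult[OF h, of "-1"]] by simp

lemma L2_sum [intro]:
  assumes "\<And>i. i \<in> A \<Longrightarrow> h i \<in> L2"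
  shows "(\<lambda>x. \<Sum>i\<in>A. h i x) \<in> L2"
  using assms by (induction A rule: infinite_finite_induct) (auto intro!: L2_add)

lemma L2_AE_cong:
  assumes "h \<in> L2" "g \<in> borel_measurable borel" "AE x in lborel. g x = h x"
  shows "g \<in> L2"
proof (rule L2_I[OF assms(2)])
  have "integrable lborel (\<lambda>x. (cmod (g x))\<^sup>2) = integrable lborel (\<lambda>x. (cmod (h x))\<^sup>2)"
    by (rule integrable_cong_AE) (use assms in \<open>auto simp: L2_measurable\<close>)
  with L2_integrable[OF assms(1)] show "integrable lborel (\<lambda>x. (cmod (g x))\<^sup>2)" by simp
qed

lemma L2_inner_integrable:
  assumes g: "g \<in> L2" and h: "h \<in> L2"
  shows "integrable lborel (\<lambda>x. cnj (g x) * h x)"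
proof (rule Bochner_Integration.integrable_bound)
  show "integrable lborel (\<lambda>x. (cmod (g x))\<^sup>2 + (cmod (h x))\<^sup>2)"
    using L2_integrable[OF g] L2_integrable[OF h] by auto
  have [measurable]: "g \<in> borel_measurable borel" "h \<in> borel_measurable borel"
    using g h by (auto simp: L2_measurable)
  show "(\<lambda>x. cnj (g x) * h x) \<in> borel_measurable lborel" by measurable
  show "AE x in lborel. norm (cnj (g x) * h x) \<le> norm ((cmod (g x))\<^sup>2 + (cmod (h x))\<^sup>2)"
  proof (intro AE_I2)
    fix x
    have "2 * (cmod (g x) * cmod (h x)) \<le> (cmod (g x))\<^sup>2 + (cmod (h x))\<^sup>2"
      using zero_le_power2[of "cmod (g x) - cmod (h x)"] by (simp add: power2_eq_square algebra_simps)
    then show "norm (cnj (g x) * h x) \<le> norm ((cmod (g x))\<^sup>2 + (cmod (h x))\<^sup>2)"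
      by (simp add: norm_mult) (smt (verit) mult_nonneg_nonneg norm_ge_zero)
  qed
qed

lemma L2_inner_add_right:
  assumes "f \<in> L2" "g \<in> L2" "h \<in> L2"
  shows "L2_inner f (\<lambda>x. g x + h x) = L2_inner f g + L2_inner f h"
  unfolding L2_inner_def using L2_inner_integrable[OF assms(1,2)] L2_inner_integrable[OF assms(1,3)]
  by (simp add: distrib_left)

lemma L2_inner_diff_right:
  assumes "f \<in> L2" "g \<in> L2" "h \<in> L2"
  shows "L2_inner f (\<lambda>x. g x - h x) = L2_inner f g - L2_inner f h"
  unfolding L2_inner_def using L2_inner_integrable[OF assms(1,2)] L2_inner_integrable[OF assms(1,3)]
  by (simp add: right_diff_distrib)

lemma L2_inner_cmult_right [simp]: "L2_inner f (\<lambda>x. c * g x) = c * L2_inner f g"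
  unfolding L2_inner_def by (simp add: mult.left_commute[of _ c])

lemma L2_inner_commute: "L2_inner f g = cnj (L2_inner g f)"
  unfolding L2_inner_def by (subst Bochner_Integration.integral_cnj[symmetric]) (simp add: mult.commute)

lemma L2_inner_cmult_left [simp]: "L2_inner (\<lambda>x. c * g x) f = cnj c * L2_inner g f"
  by (subst (1 2) L2_inner_commute) simp

lemma L2_inner_diff_left:
  assumes "f \<in> L2" "g \<in> L2" "h \<in> L2"
  shows "L2_inner (\<lambda>x. g x - h x) f = L2_inner g f - L2_inner h f"
  by (subst (1 2 3) L2_inner_commute) (simp add: L2_inner_diff_right assms)

lemma L2_inner_zero [simp]: "L2_inner f (\<lambda>x. 0) = 0" "L2_inner (\<lambda>x. 0) f = 0"
  by (simp_all add: L2_inner_def)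

lemma L2_inner_sum_right:
  assumes "f \<in> L2" "\<And>i. i \<in> A \<Longrightarrow> h i \<in> L2"
  shows "L2_inner f (\<lambda>x. \<Sum>i\<in>A. h i x) = (\<Sum>i\<in>A. L2_inner f (h i))"
  using assms
  by (induction A rule: infinite_finite_induct) (auto simp: L2_inner_add_right L2_sum)

lemma L2_inner_sum_left:
  assumes "f \<in> L2" "\<And>i. i \<in> A \<Longrightarrow> h i \<in> L2"
  shows "L2_inner (\<lambda>x. \<Sum>i\<in>A. h i x) f = (\<Sum>i\<in>A. L2_inner (h i) f)"
  by (subst L2_inner_commute, subst L2_inner_sum_right[OF assms]) (auto simp: L2_inner_commute[of _ f])

lemma L2_inner_AE_cong:
  assumes "AE x in lborel. g x = g' x" "AE x in lborel. h x = h' x"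
    and [measurable]: "g \<in> borel_measurable borel" "g' \<in> borel_measurable borel"
      "h \<in> borel_measurable borel" "h' \<in> borel_measurable borel"
  shows "L2_inner g h = L2_inner g' h'"
  unfolding L2_inner_def
proof (rule integral_cong_AE)
  show "AE x in lborel. cnj (g x) * h x = cnj (g' x) * h' x"
    using assms(1,2) by eventually_elim simp
qed measurable

lemma L2_norm_nonneg [simp]: "0 \<le> L2_norm h"
  by (simp add: L2_norm_def)

lemma L2_norm_power2: "(L2_norm h)\<^sup>2 = (LINT x|lborel. (cmod (h x))\<^sup>2)"
  unfolding L2_norm_def by (subst real_sqrt_pow2) auto

lemma L2_inner_self: "L2_inner h h = of_real ((L2_norm h)\<^sup>2)"
  unfolding L2_norm_power2 L2_inner_def
  by (subst integral_complex_of_real[symmetric])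
     (simp add: complex_norm_square mult.commute del: of_real_power integral_complex_of_real)

lemma L2_norm_zero [simp]: "L2_norm (\<lambda>x. 0) = 0"
  by (simp add: L2_norm_def)

lemma L2_norm_cmult [simp]: "L2_norm (\<lambda>x. c * h x) = cmod c * L2_norm h"
  by (simp add: L2_norm_def norm_mult power_mult_distrib real_sqrt_mult)

lemma L2_norm_minus_commute: "L2_norm (\<lambda>x. g x - h x) = L2_norm (\<lambda>x. h x - g x)"
  by (simp add: L2_norm_def norm_minus_commute)

lemma L2_norm_AE_cong:
  assumes "AE x in lborel. g x = h x" "g \<in> borel_measurable borel" "h \<in> borel_measurable borel"
  shows "L2_norm g = L2_norm h"
proof -
  have "(LINT x|lborel. (cmod (g x))\<^sup>2) = (LINT x|lborel. (cmod (h x))\<^sup>2)"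
    by (rule integral_cong_AE) (use assms in auto)
  then show ?thesis by (simp add: L2_norm_def)
qed

lemma nn_integral_L2:
  assumes "h \<in> L2"
  shows "(\<integral>\<^sup>+x. ennreal ((cmod (h x))\<^sup>2) \<partial>lborel) = ennreal ((L2_norm h)\<^sup>2)"
  unfolding L2_norm_power2 by (rule nn_integral_eq_integral[OF L2_integrable[OF assms]]) auto

lemma L2_I_nn_integral:
  assumes "h \<in> borel_measurable borel" "(\<integral>\<^sup>+x. ennreal ((cmod (h x))\<^sup>2) \<partial>lborel) \<le> ennreal C" "0 \<le> C"
  shows "h \<in> L2" "(L2_norm h)\<^sup>2 \<le> C"
proof -
  show h: "h \<in> L2"
    using assms by (intro L2_I integrableI_bounded) (auto simp: order.strict_trans1)
  show "(L2_norm h)\<^sup>2 \<le> C"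
    using assms(2,3) unfolding nn_integral_L2[OF h] by simp
qed

lemma L2_norm_eq_0_iff:
  assumes "h \<in> L2"
  shows "L2_norm h = 0 \<longleftrightarrow> (AE x in lborel. h x = 0)"
proof -
  have "L2_norm h = 0 \<longleftrightarrow> (LINT x|lborel. (cmod (h x))\<^sup>2) = 0" by (simp add: L2_norm_def)
  also have "\<dots> \<longleftrightarrow> (AE x in lborel. (cmod (h x))\<^sup>2 = 0)"
    by (rule integral_nonneg_eq_0_iff_AE[OF L2_integrable[OF assms]]) auto
  finally show ?thesis by simp
qed

lemma L2_norm_diff_power2:
  assumes "g \<in> L2" "h \<in> L2"
  shows "(L2_norm (\<lambda>x. g x - h x))\<^sup>2 = (L2_norm g)\<^sup>2 - 2 * Re (L2_inner g h) + (L2_norm h)\<^sup>2"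
proof -
  have "complex_of_real ((L2_norm (\<lambda>x. g x - h x))\<^sup>2)
      = L2_inner g g - L2_inner g h - L2_inner h g + L2_inner h h"
    unfolding L2_inner_self[symmetric]
    by (simp add: L2_inner_diff_left L2_inner_diff_right assms L2_diff)
  also have "L2_inner h g = cnj (L2_inner g h)" by (rule L2_inner_commute)
  finally have "complex_of_real ((L2_norm (\<lambda>x. g x - h x))\<^sup>2)
      = of_real ((L2_norm g)\<^sup>2 - 2 * Re (L2_inner g h) + (L2_norm h)\<^sup>2)"
    by (simp add: L2_inner_self complex_eq_iff)
  then show ?thesis by (simp only: of_real_eq_iff)
qed

lemma L2_Cauchy_Schwarz:
  assumes g: "g \<in> L2" and h: "h \<in> L2"
  shows "cmod (L2_inner g h) \<le> L2_norm g * L2_norm h"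
\<comment> \<open>On functions \<open>L2_norm\<close> is only a seminorm: norm zero means zero
  almost everywhere, and the projection coefficient below would divide by it.\<close>
proof (cases "L2_norm g = 0")
  case True
  then have "AE x in lborel. g x = 0" using L2_norm_eq_0_iff[OF g] by simp
  then have "L2_inner g h = L2_inner (\<lambda>x. 0) h"
    using g h by (intro L2_inner_AE_cong) (auto simp: L2_measurable)
  then show ?thesis by simp
next
  case False
  define c where "c = L2_inner g h / of_real ((L2_norm g)\<^sup>2)"
  have "0 \<le> (L2_norm (\<lambda>x. h x - c * g x))\<^sup>2" by simp
  also have "\<dots> = (L2_norm h)\<^sup>2 - 2 * Re (c * L2_inner h g) + (cmod c * L2_norm g)\<^sup>2"
    using L2_norm_diff_power2[OF h L2_cmult[OF g, of c]] by simp
  also have "c * L2_inner h g = of_real ((cmod (L2_inner g h))\<^sup>2 / (L2_norm g)\<^sup>2)"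
    unfolding c_def L2_inner_commute[of h g]
    by (simp add: complex_norm_square del: of_real_power)
  also have "(cmod c * L2_norm g)\<^sup>2 = (cmod (L2_inner g h))\<^sup>2 / (L2_norm g)\<^sup>2"
  proof -
    have "cmod c = cmod (L2_inner g h) / (L2_norm g)\<^sup>2"
      unfolding c_def norm_divide norm_of_real by simp
    then have "cmod c * L2_norm g = cmod (L2_inner g h) / L2_norm g"
      using False by (simp add: power2_eq_square)
    then show ?thesis by (simp only: power_divide)
  qed
  finally have "(cmod (L2_inner g h))\<^sup>2 / (L2_norm g)\<^sup>2 \<le> (L2_norm h)\<^sup>2" by simp
  then have "(cmod (L2_inner g h))\<^sup>2 \<le> (L2_norm g * L2_norm h)\<^sup>2"
    using False by (simp add: divide_le_eq power_mult_distrib mult.commute)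
  then show ?thesis by (rule power2_le_imp_le) simp
qed

lemma L2_norm_triangle:
  assumes g: "g \<in> L2" and h: "h \<in> L2"
  shows "L2_norm (\<lambda>x. g x + h x) \<le> L2_norm g + L2_norm h"
proof (rule power2_le_imp_le)
  have "(L2_norm (\<lambda>x. g x - (- 1) * h x))\<^sup>2
      = (L2_norm g)\<^sup>2 - 2 * Re (L2_inner g (\<lambda>x. (- 1) * h x)) + (L2_norm (\<lambda>x. (- 1) * h x))\<^sup>2"
    by (rule L2_norm_diff_power2[OF g L2_cmult[OF h]])
  then have "(L2_norm (\<lambda>x. g x + h x))\<^sup>2 = (L2_norm g)\<^sup>2 + 2 * Re (L2_inner g h) + (L2_norm h)\<^sup>2"
    unfolding L2_inner_cmult_right L2_norm_cmult by simp
  moreover have "Re (L2_inner g h) \<le> L2_norm g * L2_norm h"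
    using L2_Cauchy_Schwarz[OF g h] complex_Re_le_cmod order_trans by blast
  ultimately show "(L2_norm (\<lambda>x. g x + h x))\<^sup>2 \<le> (L2_norm g + L2_norm h)\<^sup>2"
    by (simp add: power2_eq_square algebra_simps)
qed simp

lemma L2_norm_triangle_diff:
  assumes "f \<in> L2" "g \<in> L2" "h \<in> L2"
  shows "L2_norm (\<lambda>x. f x - h x) \<le> L2_norm (\<lambda>x. f x - g x) + L2_norm (\<lambda>x. g x - h x)"
  using L2_norm_triangle[of "\<lambda>x. f x - g x" "\<lambda>x. g x - h x"] assms by (simp add: L2_diff)

lemma L2_norm_diff_bound:
  assumes "g \<in> L2" "h \<in> L2"
  shows "\<bar>L2_norm g - L2_norm h\<bar> \<le> L2_norm (\<lambda>x. g x - h x)"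
  using L2_norm_triangle[of "\<lambda>x. g x - h x" h] L2_norm_triangle[of "\<lambda>x. h x - g x" g] assms
  by (simp add: L2_diff L2_norm_minus_commute[of h g])

lemma L2_norm_tendsto:
  assumes "\<And>n. h n \<in> L2" "g \<in> L2" "(\<lambda>n. L2_norm (\<lambda>x. h n x - g x)) \<longlonglongrightarrow> 0"
  shows "(\<lambda>n. L2_norm (h n)) \<longlonglongrightarrow> L2_norm g"
proof (rule LIM_zero_cancel)
  show "(\<lambda>n. L2_norm (h n) - L2_norm g) \<longlonglongrightarrow> 0"
    by (rule tendsto_rabs_zero_cancel, rule tendsto_sandwich[OF _ _ tendsto_const assms(3)])
       (use L2_norm_diff_bound[OF assms(1,2)] in auto)
qed

lemma L2_inner_tendsto_right:
  assumes "\<And>n. h n \<in> L2" "g \<in> L2" "f \<in> L2" "(\<lambda>n. L2_norm (\<lambda>x. h n x - g x)) \<longlonglongrightarrow> 0"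
  shows "(\<lambda>n. L2_inner f (h n)) \<longlonglongrightarrow> L2_inner f g"
proof (rule LIM_zero_cancel, rule Lim_null_comparison)
  show "eventually (\<lambda>n. norm (L2_inner f (h n) - L2_inner f g) \<le> L2_norm f * L2_norm (\<lambda>x. h n x - g x)) sequentially"
    using L2_Cauchy_Schwarz[OF assms(3) L2_diff[OF assms(1,2)]] assms(1-3)
    by (intro always_eventually allI) (simp add: L2_inner_diff_right)
  show "(\<lambda>n. L2_norm f * L2_norm (\<lambda>x. h n x - g x)) \<longlonglongrightarrow> 0"
    using tendsto_mult_right_zero[OF assms(4)] by simp
qed

text \<open>The squared increments along a fast subsequence are summed with weights \<open>4\<^sup>k\<close>, so that
  Minkowski's inequality is not needed for the pointwise convergence.\<close>

lemma L2_complete: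
  assumes h: "\<And>n. h n \<in> L2"
    and Cauchy: "\<And>e. 0 < e \<Longrightarrow> \<exists>N. \<forall>m\<ge>N. \<forall>n\<ge>N. L2_norm (\<lambda>x. h m x - h n x) < e"
  obtains g where "g \<in> L2" "(\<lambda>n. L2_norm (\<lambda>x. h n x - g x)) \<longlonglongrightarrow> 0"
proof -
  \<comment> \<open>The rate 1/8 leaves the summable 2^-k after multiplication by the weight 4^k,
    and the weight then forces pointwise increments of order 2^-k.\<close>
  have "\<exists>N. \<forall>m\<ge>N. \<forall>n\<ge>N. (L2_norm (\<lambda>x. h m x - h n x))\<^sup>2 \<le> (1 / 8) ^ k" for k :: nat
  proof -
    obtain N where N: "\<And>m n. N \<le> m \<Longrightarrow> N \<le> n \<Longrightarrow> L2_norm (\<lambda>x. h m x - h n x) < sqrt ((1 / 8) ^ k)"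
      using Cauchy[of "sqrt ((1 / 8) ^ k)"] by auto
    have "(L2_norm (\<lambda>x. h m x - h n x))\<^sup>2 \<le> (1 / 8) ^ k" if "N \<le> m" "N \<le> n" for m n
      using power_mono[OF less_imp_le[OF N[OF that]], of 2] by simp
    then show ?thesis by blast
  qed
  then obtain N where N: "\<And>k m n. N k \<le> m \<Longrightarrow> N k \<le> n \<Longrightarrow> (L2_norm (\<lambda>x. h m x - h n x))\<^sup>2 \<le> (1 / 8) ^ k"
    by metis
  \<comment> \<open>Partial sums of the thresholds exceed all earlier thresholds at once, so both
    \<open>r k\<close> and \<open>r (Suc k)\<close> lie beyond \<open>N k\<close>.\<close>
  define r where "r k = (\<Sum>i\<le>k. N i)" for k
  have r: "N k \<le> r k" for k unfolding r_def by (rule member_le_sum) auto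
  have rS: "N k \<le> r (Suc k)" for k using r[of k] by (simp add: r_def)
  have [measurable]: "h n \<in> borel_measurable borel" for n using h by (rule L2_measurable)
  define d where "d k x = cmod (h (r (Suc k)) x - h (r k) x)" for k x
  have [measurable]: "d k \<in> borel_measurable borel" for k unfolding d_def by measurable
  have "(\<integral>\<^sup>+x. (\<Sum>k. ennreal (4 ^ k * (d k x)\<^sup>2)) \<partial>lborel) = (\<Sum>k. \<integral>\<^sup>+x. ennreal (4 ^ k * (d k x)\<^sup>2) \<partial>lborel)"
    by (rule nn_integral_suminf) measurable
  also have "\<dots> \<le> (\<Sum>k. ennreal ((1 / 2) ^ k))"
  proof (rule suminf_le)
    fix k
    have "(\<integral>\<^sup>+x. ennreal (4 ^ k * (d k x)\<^sup>2) \<partial>lborel) = ennreal (4 ^ k) * (\<integral>\<^sup>+x. ennreal ((d k x)\<^sup>2) \<partial>lborel)"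
      by (simp add: ennreal_mult' nn_integral_cmult)
    also have "(\<integral>\<^sup>+x. ennreal ((d k x)\<^sup>2) \<partial>lborel) = ennreal ((L2_norm (\<lambda>x. h (r (Suc k)) x - h (r k) x))\<^sup>2)"
      unfolding d_def by (rule nn_integral_L2) (auto intro: h)
    also have "\<dots> \<le> ennreal ((1 / 8) ^ k)"
      by (rule ennreal_leI) (rule N[OF rS r])
    also have "ennreal (4 ^ k) * ennreal ((1 / 8) ^ k) = ennreal ((1 / 2) ^ k)"
      by (simp add: ennreal_mult[symmetric] power_mult_distrib[symmetric])
    finally show "(\<integral>\<^sup>+x. ennreal (4 ^ k * (d k x)\<^sup>2) \<partial>lborel) \<le> ennreal ((1 / 2) ^ k)"
      by (simp add: mult_left_mono)
  qed auto
  also have "\<dots> = ennreal (\<Sum>k. (1 / 2) ^ k)"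
    by (rule suminf_ennreal2) auto
  also have "\<dots> < \<infinity>" by simp
  finally have "(\<integral>\<^sup>+x. (\<Sum>k. ennreal (4 ^ k * (d k x)\<^sup>2)) \<partial>lborel) \<noteq> \<infinity>" by simp
  then have "AE x in lborel. (\<Sum>k. ennreal (4 ^ k * (d k x)\<^sup>2)) \<noteq> \<infinity>"
    by (rule nn_integral_noteq_infinite[rotated]) measurable
  then have conv: "AE x in lborel. convergent (\<lambda>k. h (r k) x)"
  proof eventually_elim
    fix x assume fin: "(\<Sum>k. ennreal (4 ^ k * (d k x)\<^sup>2)) \<noteq> \<infinity>"
    have "\<exists>C. s = ennreal C \<and> 0 \<le> C" if "s \<noteq> \<infinity>" for s
      using that by (cases s) auto
    from this[OF fin] obtain C where C: "(\<Sum>k. ennreal (4 ^ k * (d k x)\<^sup>2)) = ennreal C" "0 \<le> C"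
      by blast
    have "d k x \<le> sqrt C * (1 / 2) ^ k" for k
    proof (rule power2_le_imp_le)
      have le: "a k \<le> suminf a" for a :: "nat \<Rightarrow> ennreal"
        using sum_le_suminf[of a "{k}"] by simp
      have "ennreal (4 ^ k * (d k x)\<^sup>2) \<le> ennreal C"
        using le[of "\<lambda>k. ennreal (4 ^ k * (d k x)\<^sup>2)"] by (simp only: C(1))
      then have "4 ^ k * (d k x)\<^sup>2 \<le> C" using C(2) by simp
      moreover have "((1 / 2) ^ k)\<^sup>2 = (1 / 4 ^ k :: real)"
        by (simp add: power2_eq_square power_one_over flip: power_mult_distrib)
      ultimately show "(d k x)\<^sup>2 \<le> (sqrt C * (1 / 2) ^ k)\<^sup>2"
        unfolding power_mult_distrib real_sqrt_pow2[OF C(2)] by (simp add: field_simps)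
    qed (use C in auto)
    then have "summable (\<lambda>k. norm (h (r (Suc k)) x - h (r k) x))"
      by (intro summable_comparison_test[OF _ summable_mult[OF summable_geometric[of "1/2 :: real"], of "sqrt C"]])
         (auto simp: d_def)
    then have "summable (\<lambda>k. h (r (Suc k)) x - h (r k) x)" by (rule summable_norm_cancel)
    then have "convergent (\<lambda>n. \<Sum>k<n. h (r (Suc k)) x - h (r k) x)" by (simp add: summable_iff_convergent)
    then have "convergent (\<lambda>n. (\<Sum>k<n. h (r (Suc k)) x - h (r k) x) + h (r 0) x)"
      by (intro convergent_add convergent_const)
    then show "convergent (\<lambda>k. h (r k) x)" by (simp add: sum_lessThan_telescope[of "\<lambda>k. h (r k) x"])
  qed
  define g where "g x = (if convergent (\<lambda>k. h (r k) x) then lim (\<lambda>k. h (r k) x) else 0)" for x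
  have g_meas [measurable]: "g \<in> borel_measurable borel" unfolding g_def convergent_def[symmetric] Cauchy_convergent_iff[symmetric] by measurable
  have lim: "AE x in lborel. (\<lambda>k. h (r k) x) \<longlonglongrightarrow> g x"
    using conv by eventually_elim (simp add: g_def convergent_LIMSEQ_iff)
  \<comment> \<open>Fatou's lemma along the subsequence carries the Cauchy estimate over to the
    limit.\<close>
  have bound: "(\<integral>\<^sup>+x. ennreal ((cmod (h n x - g x))\<^sup>2) \<partial>lborel) \<le> ennreal ((1 / 8) ^ k)" if n: "N k \<le> n" for n k
  proof -
    have "(\<integral>\<^sup>+x. ennreal ((cmod (h n x - g x))\<^sup>2) \<partial>lborel)
        = (\<integral>\<^sup>+x. liminf (\<lambda>j. ennreal ((cmod (h n x - h (r j) x))\<^sup>2)) \<partial>lborel)"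
    proof (rule nn_integral_cong_AE)
      show "AE x in lborel. ennreal ((cmod (h n x - g x))\<^sup>2) = liminf (\<lambda>j. ennreal ((cmod (h n x - h (r j) x))\<^sup>2))"
        using lim
      proof eventually_elim
        fix x assume "(\<lambda>k. h (r k) x) \<longlonglongrightarrow> g x"
        then have "(\<lambda>j. ennreal ((cmod (h n x - h (r j) x))\<^sup>2)) \<longlonglongrightarrow> ennreal ((cmod (h n x - g x))\<^sup>2)"
          by (intro tendsto_intros)
        then show "ennreal ((cmod (h n x - g x))\<^sup>2) = liminf (\<lambda>j. ennreal ((cmod (h n x - h (r j) x))\<^sup>2))"
          by (rule lim_imp_Liminf[OF trivial_limit_sequentially, symmetric])
      qed
    qed
    also have "\<dots> \<le> liminf (\<lambda>j. \<integral>\<^sup>+x. ennreal ((cmod (h n x - h (r j) x))\<^sup>2) \<partial>lborel)"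
      by (rule nn_integral_liminf) measurable
    also have "\<dots> \<le> liminf (\<lambda>j. ennreal ((1 / 8) ^ k))"
    proof (rule Liminf_mono)
      show "eventually (\<lambda>j. (\<integral>\<^sup>+x. ennreal ((cmod (h n x - h (r j) x))\<^sup>2) \<partial>lborel) \<le> ennreal ((1 / 8) ^ k)) sequentially"
      proof (rule eventually_sequentiallyI[of k])
        fix j assume "k \<le> j"
        then have "N k \<le> r j" unfolding r_def by (intro member_le_sum) auto
        then show "(\<integral>\<^sup>+x. ennreal ((cmod (h n x - h (r j) x))\<^sup>2) \<partial>lborel) \<le> ennreal ((1 / 8) ^ k)"
          using N[OF n, of "r j"] by (subst nn_integral_L2) (auto intro: h ennreal_leI)
      qed
    qed
    also have "\<dots> = ennreal ((1 / 8) ^ k)" by (simp add: Liminf_const)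
    finally show ?thesis .
  qed
  have diff: "(\<lambda>x. h n x - g x) \<in> L2" if "N k \<le> n" for n k
    by (rule L2_I_nn_integral(1)[OF _ bound[OF that]]) auto
  have g: "g \<in> L2"
    using L2_diff[OF h[of "N 0"] diff[of 0 "N 0"]] by simp
  moreover have "(\<lambda>n. L2_norm (\<lambda>x. h n x - g x)) \<longlonglongrightarrow> 0"
  proof (rule metric_LIMSEQ_I)
    fix e :: real assume e: "0 < e"
    obtain k where k: "(1 / 8) ^ k < e\<^sup>2"
      using real_arch_pow_inv[of "e\<^sup>2" "1/8"] e by auto
    have "dist (L2_norm (\<lambda>x. h n x - g x)) 0 < e" if "N k \<le> n" for n
    proof -
      have "(L2_norm (\<lambda>x. h n x - g x))\<^sup>2 < e\<^sup>2"
        using L2_I_nn_integral(2)[OF _ bound[OF that]] k by (simp add: order.strict_trans1)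
      then have "L2_norm (\<lambda>x. h n x - g x) < e" using e power2_less_imp_less[of _ e] by simp
      then show ?thesis by simp
    qed
    then show "\<exists>N. \<forall>n\<ge>N. dist (L2_norm (\<lambda>x. h n x - g x)) 0 < e" by blast
  qed
  ultimately show ?thesis using that by blast
qed

section \<open>Orthonormal systems, expansions and Gram-Schmidt\<close>

definition L2_orthonormal :: "(nat \<Rightarrow> 'a::euclidean_space \<Rightarrow> complex) \<Rightarrow> bool" where
  "L2_orthonormal e \<longleftrightarrow> (\<forall>i. e i \<in> L2) \<and> (\<forall>i j. L2_inner (e i) (e j) = (if i = j then 1 else 0))"

definition L2_proj :: "(nat \<Rightarrow> 'a::euclidean_space \<Rightarrow> complex) \<Rightarrow> nat \<Rightarrow> ('a \<Rightarrow> complex) \<Rightarrow> 'a \<Rightarrow> complex" where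
  "L2_proj e n h x = (\<Sum>i<n. L2_inner (e i) h * e i x)"

text \<open>Orthonormality is asked of the first n vectors only, because Gram-Schmidt applies this
  to a family that is still under construction.\<close>

lemma L2_proj_residual:
  assumes e: "\<And>i. i < n \<Longrightarrow> e i \<in> L2"
    and on: "\<And>i j. i < n \<Longrightarrow> j < n \<Longrightarrow> L2_inner (e i) (e j) = (if i = j then 1 else 0)"
    and h: "h \<in> L2"
  shows "L2_proj e n h \<in> L2"
    and "i < n \<Longrightarrow> L2_inner (e i) (\<lambda>x. h x - L2_proj e n h x) = 0"
    and "(L2_norm (\<lambda>x. h x - L2_proj e n h x))\<^sup>2 = (L2_norm h)\<^sup>2 - (\<Sum>i<n. (cmod (L2_inner (e i) h))\<^sup>2)"
    and "(L2_norm (L2_proj e n h))\<^sup>2 = (\<Sum>i<n. (cmod (L2_inner (e i) h))\<^sup>2)"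
proof -
  show P: "L2_proj e n h \<in> L2"
    unfolding L2_proj_def[abs_def] using e by (intro L2_sum L2_cmult) auto
  have eP: "L2_inner (e i) (L2_proj e n h) = L2_inner (e i) h" if "i < n" for i
  proof -
    have "L2_inner (e i) (L2_proj e n h) = (\<Sum>j<n. L2_inner (e j) h * L2_inner (e i) (e j))"
      unfolding L2_proj_def[abs_def] using e that by (subst L2_inner_sum_right) (auto intro: L2_cmult)
    also have "\<dots> = (\<Sum>j<n. if j = i then L2_inner (e i) h else 0)"
      using on that by (intro sum.cong) auto
    finally show ?thesis using that by simp
  qed
  then show "L2_inner (e i) (\<lambda>x. h x - L2_proj e n h x) = 0" if "i < n"
    using that e h P by (simp add: L2_inner_diff_right)
  have Pg: "L2_inner (L2_proj e n h) g = (\<Sum>i<n. cnj (L2_inner (e i) h) * L2_inner (e i) g)" if "g \<in> L2" for g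
    unfolding L2_proj_def[abs_def] using e that by (subst L2_inner_sum_left) (auto intro: L2_cmult)
  have sq: "(\<Sum>i<n. cnj (L2_inner (e i) h) * L2_inner (e i) h) = of_real (\<Sum>i<n. (cmod (L2_inner (e i) h))\<^sup>2)"
    by (simp add: complex_norm_square mult.commute del: of_real_power)
  have "complex_of_real ((L2_norm (L2_proj e n h))\<^sup>2) = of_real (\<Sum>i<n. (cmod (L2_inner (e i) h))\<^sup>2)"
    unfolding L2_inner_self[symmetric] Pg[OF P] sq[symmetric] by (intro sum.cong refl) (simp add: eP)
  then show nP: "(L2_norm (L2_proj e n h))\<^sup>2 = (\<Sum>i<n. (cmod (L2_inner (e i) h))\<^sup>2)"
    by (simp only: of_real_eq_iff)
  have "L2_inner h (L2_proj e n h) = cnj (L2_inner (L2_proj e n h) h)" by (rule L2_inner_commute)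
  then have "Re (L2_inner h (L2_proj e n h)) = (\<Sum>i<n. (cmod (L2_inner (e i) h))\<^sup>2)"
    unfolding Pg[OF h] sq by simp
  then show "(L2_norm (\<lambda>x. h x - L2_proj e n h x))\<^sup>2 = (L2_norm h)\<^sup>2 - (\<Sum>i<n. (cmod (L2_inner (e i) h))\<^sup>2)"
    using L2_norm_diff_power2[OF h P] nP by simp
qed

lemma L2_Bessel:
  fixes n :: nat
  assumes "\<And>i. i < n \<Longrightarrow> e i \<in> L2"
    and "\<And>i j. i < n \<Longrightarrow> j < n \<Longrightarrow> L2_inner (e i) (e j) = (if i = j then 1 else 0)" and "h \<in> L2"
  shows "(\<Sum>i<n. (cmod (L2_inner (e i) h))\<^sup>2) \<le> (L2_norm h)\<^sup>2"
  using L2_proj_residual(3)[where n = n and e = e and h = h] assms zero_le_power2[of "L2_norm (\<lambda>x. h x - L2_proj e n h x)"] by simp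

text \<open>Bessel's inequality makes the partial sums Cauchy. The difference between h and their
  limit is orthogonal to every basis vector and vanishes by totality.\<close>

lemma L2_proj_tendsto:
  assumes e: "L2_orthonormal_basis e" and h: "h \<in> L2"
  shows "(\<lambda>n. L2_norm (\<lambda>x. L2_proj e n h x - h x)) \<longlonglongrightarrow> 0"
proof -
  have eL: "e i \<in> L2" and on: "L2_inner (e i) (e j) = (if i = j then 1 else 0)" for i j
    using e by (auto simp: L2_orthonormal_basis_def)
  have P: "L2_proj e n f \<in> L2" if "f \<in> L2" for n f
    by (rule L2_proj_residual(1)) (use eL on that in auto)
  let ?c = "\<lambda>i. (cmod (L2_inner (e i) h))\<^sup>2"
  have bessel: "(\<Sum>i<n. ?c i) \<le> (L2_norm h)\<^sup>2" for n
    by (rule L2_Bessel) (use eL on h in auto)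
  have dist: "(L2_norm (\<lambda>x. L2_proj e m h x - L2_proj e n h x))\<^sup>2 = (\<Sum>i<m. ?c i) - (\<Sum>i<n. ?c i)" if "n \<le> m" for m n
  proof -
    have "L2_proj e n (L2_proj e m h) x = L2_proj e n h x" for x
    proof -
      have "L2_inner (e i) (L2_proj e m h) = L2_inner (e i) h" if "i < n" for i
        using L2_proj_residual(2)[of m e h i] eL on h that \<open>n \<le> m\<close> P[OF h, of m]
        by (simp add: L2_inner_diff_right)
      then show ?thesis unfolding L2_proj_def[of _ _ "L2_proj e m h"] by (simp add: L2_proj_def)
    qed
    then have "(L2_norm (\<lambda>x. L2_proj e m h x - L2_proj e n h x))\<^sup>2
        = (L2_norm (\<lambda>x. L2_proj e m h x - L2_proj e n (L2_proj e m h) x))\<^sup>2" by simp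
    also have "\<dots> = (L2_norm (L2_proj e m h))\<^sup>2 - (\<Sum>i<n. (cmod (L2_inner (e i) (L2_proj e m h)))\<^sup>2)"
      by (rule L2_proj_residual(3)) (use eL on P h in auto)
    also have "(L2_norm (L2_proj e m h))\<^sup>2 = (\<Sum>i<m. ?c i)"
      by (rule L2_proj_residual(4)) (use eL on h in auto)
    also have "(\<Sum>i<n. (cmod (L2_inner (e i) (L2_proj e m h)))\<^sup>2) = (\<Sum>i<n. ?c i)"
    proof (intro sum.cong refl)
      fix i assume "i \<in> {..<n}"
      then show "(cmod (L2_inner (e i) (L2_proj e m h)))\<^sup>2 = ?c i"
        using L2_proj_residual(2)[of m e h i] eL on h that P[OF h, of m]
        by (simp add: L2_inner_diff_right)
    qed
    finally show ?thesis .
  qed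
  have "summable ?c" by (rule summableI_nonneg_bounded[of _ "(L2_norm h)\<^sup>2"]) (use bessel in auto)
  then have "Cauchy (\<lambda>n. \<Sum>i<n. ?c i)" by (simp add: summable_iff_convergent convergent_Cauchy)
  have "\<exists>N. \<forall>m\<ge>N. \<forall>n\<ge>N. L2_norm (\<lambda>x. L2_proj e m h x - L2_proj e n h x) < d" if d: "0 < d" for d
  proof -
    obtain N where N: "\<And>m n. N \<le> m \<Longrightarrow> N \<le> n \<Longrightarrow> \<bar>(\<Sum>i<m. ?c i) - (\<Sum>i<n. ?c i)\<bar> < d\<^sup>2"
      using CauchyD[OF \<open>Cauchy _\<close>, of "d\<^sup>2"] d by auto
    have "L2_norm (\<lambda>x. L2_proj e m h x - L2_proj e n h x) < d" if "N \<le> m" "N \<le> n" for m n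
    proof (rule power2_less_imp_less)
      show "(L2_norm (\<lambda>x. L2_proj e m h x - L2_proj e n h x))\<^sup>2 < d\<^sup>2"
      proof (cases "n \<le> m")
        case True then show ?thesis using dist[OF True] N[OF that] by simp
      next
        case False
        then show ?thesis using dist[of m n] N[OF that] by (subst L2_norm_minus_commute) simp
      qed
    qed (use d in simp)
    then show ?thesis by blast
  qed
  then obtain g where g: "g \<in> L2" "(\<lambda>n. L2_norm (\<lambda>x. L2_proj e n h x - g x)) \<longlonglongrightarrow> 0"
    using L2_complete[of "\<lambda>n. L2_proj e n h"] P[OF h] by blast
  have "L2_inner (e i) (\<lambda>x. h x - g x) = 0" for i
  proof -
    have "(\<lambda>n. L2_inner (e i) (L2_proj e n h)) \<longlonglongrightarrow> L2_inner (e i) g"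
      by (rule L2_inner_tendsto_right[OF P[OF h] g(1) eL g(2)])
    moreover have "(\<lambda>n. L2_inner (e i) (L2_proj e n h)) \<longlonglongrightarrow> L2_inner (e i) h"
    proof (rule tendsto_eventually, rule eventually_sequentiallyI[of "Suc i"])
      fix n assume "Suc i \<le> n"
      then show "L2_inner (e i) (L2_proj e n h) = L2_inner (e i) h"
        using L2_proj_residual(2)[of n e h i] eL on h P[OF h, of n] by (simp add: L2_inner_diff_right)
    qed
    ultimately have "L2_inner (e i) g = L2_inner (e i) h"
      by (rule LIMSEQ_unique)
    then show ?thesis using eL h g by (simp add: L2_inner_diff_right)
  qed
  then have "AE x in lborel. h x - g x = 0"
    using e L2_diff[OF h g(1)] unfolding L2_orthonormal_basis_def by blast
  then have ae: "AE x in lborel. L2_proj e n h x - g x = L2_proj e n h x - h x" for n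
    by eventually_elim simp
  have "L2_norm (\<lambda>x. L2_proj e n h x - g x) = L2_norm (\<lambda>x. L2_proj e n h x - h x)" for n
    by (rule L2_norm_AE_cong[OF ae]) (use P[OF h] h g in \<open>auto intro!: L2_measurable L2_diff\<close>)
  then show ?thesis using g(2) by simp
qed

lemma L2_Parseval:
  assumes e: "L2_orthonormal_basis e" and h: "h \<in> L2"
  shows "(\<lambda>i. (cmod (L2_inner (e i) h))\<^sup>2) sums (L2_norm h)\<^sup>2"
proof -
  have eL: "e i \<in> L2" and on: "L2_inner (e i) (e j) = (if i = j then 1 else 0)" for i j
    using e by (auto simp: L2_orthonormal_basis_def)
  have P: "L2_proj e n h \<in> L2" for n
    by (rule L2_proj_residual(1)) (use eL on h in auto)
  have "(\<lambda>n. (L2_norm (L2_proj e n h))\<^sup>2) \<longlonglongrightarrow> (L2_norm h)\<^sup>2"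
    by (intro tendsto_power L2_norm_tendsto[OF P h L2_proj_tendsto[OF e h]])
  moreover have "(L2_norm (L2_proj e n h))\<^sup>2 = (\<Sum>i<n. (cmod (L2_inner (e i) h))\<^sup>2)" for n
    by (rule L2_proj_residual(4)) (use eL on h in auto)
  ultimately show ?thesis by (simp add: sums_def)
qed

lemma L2_Parseval_inner:
  assumes e: "L2_orthonormal_basis e" and h: "h \<in> L2" and g: "g \<in> L2"
  shows "(\<lambda>n. \<Sum>i<n. cnj (L2_inner (e i) g) * L2_inner (e i) h) \<longlonglongrightarrow> L2_inner g h"
proof -
  have eL: "e i \<in> L2" and on: "L2_inner (e i) (e j) = (if i = j then 1 else 0)" for i j
    using e by (auto simp: L2_orthonormal_basis_def)
  have P: "L2_proj e n h \<in> L2" for n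
    by (rule L2_proj_residual(1)) (use eL on h in auto)
  have "(\<lambda>n. L2_inner g (L2_proj e n h)) \<longlonglongrightarrow> L2_inner g h"
    by (rule L2_inner_tendsto_right[OF P h g L2_proj_tendsto[OF e h]])
  moreover have "L2_inner g (L2_proj e n h) = (\<Sum>i<n. cnj (L2_inner (e i) g) * L2_inner (e i) h)" for n
    unfolding L2_proj_def[abs_def] using eL g
    by (subst L2_inner_sum_right) (auto intro!: L2_cmult sum.cong simp: L2_inner_commute[of g])
  ultimately show ?thesis by simp
qed

text \<open>Gram--Schmidt; at the indices where the residual of \<open>b n\<close> vanishes, the orthonormal sequence
  \<open>u\<close> provides a further vector, by counting dimensions with Bessel's inequality.\<close>

lemma L2_Gram_Schmidt:
  fixes V :: "('a::euclidean_space \<Rightarrow> complex) set" and b u :: "nat \<Rightarrow> 'a \<Rightarrow> complex"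
  assumes V: "V \<subseteq> L2" "\<And>g h. g \<in> V \<Longrightarrow> h \<in> V \<Longrightarrow> (\<lambda>x. g x + h x) \<in> V" "\<And>c h. h \<in> V \<Longrightarrow> (\<lambda>x. c * h x) \<in> V"
    and b: "\<And>n. b n \<in> V" and total: "\<And>h. h \<in> L2 \<Longrightarrow> (\<And>n. L2_inner (b n) h = 0) \<Longrightarrow> AE x in lborel. h x = 0"
    and u: "L2_orthonormal u" "\<And>n. u n \<in> V"
  obtains e where "L2_orthonormal_basis e" "\<And>n. e n \<in> V"
proof -
  \<comment> \<open>The last clause says that \<open>b n\<close> lies in the span of the vectors up
    to index n. It is expressed through orthogonality, so that no coefficients have to be carried
    along.\<close>
  let ?P = "\<lambda>f n r. r \<in> V \<and> L2_norm r = 1 \<and> (\<forall>i<n. L2_inner (f i) r = 0) \<and>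
     (\<forall>h\<in>L2. (\<forall>i<n. L2_inner (f i) h = 0) \<longrightarrow> L2_inner r h = 0 \<longrightarrow> L2_inner (b n) h = 0)"
  have "\<exists>e. \<forall>n. ?P e n (e n)"
  proof (rule dependent_wellorder_choice)
    fix f :: "nat \<Rightarrow> 'a \<Rightarrow> complex" and n
    assume IH: "\<And>i. i < n \<Longrightarrow> ?P f i (f i)"
    have fV: "f i \<in> V" if "i < n" for i using IH[OF that] by blast
    have fL: "f i \<in> L2" if "i < n" for i using fV[OF that] V by blast
    have on: "L2_inner (f i) (f j) = (if i = j then 1 else 0)" if "i < n" "j < n" for i j
    proof (cases i j rule: linorder_cases)
      case less then show ?thesis using IH[OF that(2)] by auto
    next
      case equal then show ?thesis using IH[OF that(2)] by (auto simp: L2_inner_self)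
    next
      case greater then show ?thesis using IH[OF that(1)] L2_inner_commute[of "f i" "f j"] by auto
    qed
    have projV: "L2_proj f n h \<in> V" if "h \<in> V" for h
    proof -
      have "(\<lambda>x. \<Sum>i<m. L2_inner (f i) h * f i x) \<in> V" if "m \<le> n" for m
        using that
      proof (induction m)
        case 0
        have "(\<lambda>x. 0 * h x) \<in> V" using V(3) \<open>h \<in> V\<close> by blast
        then show ?case by simp
      qed (auto intro!: V fV)
      then show ?thesis unfolding L2_proj_def[abs_def] by blast
    qed
    define res where "res h = (\<lambda>x. h x - L2_proj f n h x)" for h
    have resV: "res h \<in> V" if "h \<in> V" for h
      using V(2)[OF that V(3)[OF projV[OF that], of "-1"]] by (simp add: res_def)
    have res_orth: "L2_inner (f i) (res h) = 0" if "h \<in> V" "i < n" for h i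
      unfolding res_def by (rule L2_proj_residual(2)) (use fL on that V in auto)
    have normalized: "\<exists>r. r \<in> V \<and> L2_norm r = 1 \<and> (\<forall>i<n. L2_inner (f i) r = 0) \<and> (\<forall>h. L2_inner r h = 0 \<longrightarrow> L2_inner (res v) h = 0)"
      if v: "v \<in> V" "L2_norm (res v) \<noteq> 0" for v
      using resV[OF v(1)] res_orth[OF v(1)] v(2) V(3)
      by (intro exI[of _ "\<lambda>x. of_real (inverse (L2_norm (res v))) * res v x"]) (auto simp del: of_real_inverse)
    show "\<exists>r. ?P f n r"
    proof (cases "L2_norm (res (b n)) = 0")
      case False
      then obtain r where r: "r \<in> V" "L2_norm r = 1" "\<forall>i<n. L2_inner (f i) r = 0" "\<forall>h. L2_inner r h = 0 \<longrightarrow> L2_inner (res (b n)) h = 0"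
        using normalized[OF b] by blast
      have "L2_inner (b n) h = 0" if h: "h \<in> L2" "\<forall>i<n. L2_inner (f i) h = 0" "L2_inner r h = 0" for h
      proof -
        have "L2_inner (L2_proj f n (b n)) h = 0"
          unfolding L2_proj_def[abs_def] using fL h by (subst L2_inner_sum_left) (auto intro: L2_cmult)
        moreover have "L2_inner (res (b n)) h = 0" using r h by blast
        ultimately show ?thesis
          using h(1) b[of n] projV[OF b[of n]] V(1) unfolding res_def by (subst (asm) L2_inner_diff_left) auto
      qed
      then show ?thesis using r by blast
    next
      case True
      have uL: "u j \<in> L2" and uon: "L2_inner (u i) (u j) = (if i = j then 1 else 0)" for i j
        using u(1) by (auto simp: L2_orthonormal_def)
      have "\<exists>j\<le>n. L2_norm (res (u j)) \<noteq> 0"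
      proof (rule ccontr)
        assume contr: "\<not> ?thesis"
        have unorm: "(L2_norm (u j))\<^sup>2 = 1" for j
          using uon[of j j] unfolding L2_inner_self by (simp del: of_real_power)
        have "(\<Sum>i<n. (cmod (L2_inner (f i) (u j)))\<^sup>2) = 1" if "j < Suc n" for j
          using L2_proj_residual(3)[where n = n and e = f and h = "u j", OF fL on uL] contr that unorm[of j]
          unfolding res_def by (auto simp: less_Suc_eq_le)
        then have "real (Suc n) = (\<Sum>j<Suc n. \<Sum>i<n. (cmod (L2_inner (f i) (u j)))\<^sup>2)"
          by simp
        also have "\<dots> = (\<Sum>i<n. \<Sum>j<Suc n. (cmod (L2_inner (u j) (f i)))\<^sup>2)"
          by (subst sum.swap) (simp add: L2_inner_commute[of "f _" "u _"] del: sum.lessThan_Suc)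
        also have "\<dots> \<le> (\<Sum>i<n. (L2_norm (f i))\<^sup>2)"
          by (intro sum_mono L2_Bessel) (use uL uon fL in auto)
        also have "\<dots> = (\<Sum>i<n. 1)" by (intro sum.cong) (use IH in auto)
        finally show False by simp
      qed
      then obtain j where "L2_norm (res (u j)) \<noteq> 0" by blast
      then obtain r where r: "r \<in> V" "L2_norm r = 1" "\<forall>i<n. L2_inner (f i) r = 0"
        using normalized[OF u(2)] by blast
      have "L2_inner (b n) h = 0" if h: "h \<in> L2" "\<forall>i<n. L2_inner (f i) h = 0" for h
      proof -
        have "L2_inner (L2_proj f n (b n)) h = 0"
          unfolding L2_proj_def[abs_def] using fL h by (subst L2_inner_sum_left) (auto intro: L2_cmult)
        moreover have "cmod (L2_inner (res (b n)) h) \<le> 0"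
          using L2_Cauchy_Schwarz[of "res (b n)" h] True resV[OF b] V(1) h(1) by auto
        ultimately show ?thesis
          using h(1) b[of n] projV[OF b[of n]] V(1) unfolding res_def
          by (subst (asm) L2_inner_diff_left) auto
      qed
      then show ?thesis using r by blast
    qed
  qed auto
  then obtain e where e: "\<And>n. ?P e n (e n)" by blast
  have eV: "e n \<in> V" for n using e[of n] by blast
  then have eL: "e n \<in> L2" for n using V by blast
  have on: "L2_inner (e i) (e j) = (if i = j then 1 else 0)" for i j
  proof (cases i j rule: linorder_cases)
    case less then show ?thesis using e[of j] by auto
  next
    case equal then show ?thesis using e[of j] by (auto simp: L2_inner_self)
  next
    case greater then show ?thesis using e[of i] L2_inner_commute[of "e i" "e j"] by auto
  qed
  have "AE x in lborel. h x = 0" if "h \<in> L2" "\<And>i. L2_inner (e i) h = 0" for h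
    by (rule total[OF that(1)]) (use e that in blast)
  then have "L2_orthonormal_basis e" unfolding L2_orthonormal_basis_def using eL on by blast
  with that eV show ?thesis by blast
qed

section \<open>Gaussian Fourier integrals and a basis of box functions\<close>

lemma nn_integral_lborel_affine:
  fixes f :: "'a::euclidean_space \<Rightarrow> ennreal"
  assumes [measurable]: "f \<in> borel_measurable borel" and c: "c \<noteq> 0"
  shows "(\<integral>\<^sup>+x. f x \<partial>lborel) = ennreal (\<bar>c\<bar> ^ DIM('a)) * (\<integral>\<^sup>+x. f (t + c *\<^sub>R x) \<partial>lborel)"
  by (subst lborel_affine[OF c, of t])
     (simp add: nn_integral_density nn_integral_distr nn_integral_cmult)

lemma integrable_lborel_affine:
  fixes f :: "'a::euclidean_space \<Rightarrow> 'b::{banach, second_countable_topology}"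
  assumes f: "integrable lborel f" and c: "c \<noteq> 0"
  shows "integrable lborel (\<lambda>x. f (t + c *\<^sub>R x))"
proof -
  have [measurable]: "f \<in> borel_measurable borel" using borel_measurable_integrable[OF f] by simp
  have "(\<integral>\<^sup>+x. ennreal (norm (f x)) \<partial>lborel) < \<infinity>" using f by (simp add: integrable_iff_bounded)
  then have "(\<integral>\<^sup>+x. ennreal (norm (f (t + c *\<^sub>R x))) \<partial>lborel) < \<infinity>"
    using c by (subst (asm) nn_integral_lborel_affine[OF _ c, of _ t]) (auto simp: ennreal_mult_less_top)
  then show ?thesis by (simp add: integrable_iff_bounded)
qed

lemma integral_lborel_affine:
  fixes f :: "'a::euclidean_space \<Rightarrow> 'b::{banach, second_countable_topology}"
  assumes [measurable]: "f \<in> borel_measurable borel" and c: "c \<noteq> 0"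
  shows "(LINT x|lborel. f x) = \<bar>c\<bar> ^ DIM('a) *\<^sub>R (LINT x|lborel. f (t + c *\<^sub>R x))"
  by (subst lborel_affine[OF c, of t])
     (simp add: integral_density integral_distr)

section \<open>Boxes with rational corners and a basis built from them\<close>

text \<open>Corners are stored coordinatewise: the index set \<open>rational_corners\<close> is
  countable, and intersections of boxes come from \<open>max\<close> and \<open>min\<close> in each
  coordinate.\<close>

definition rational_box :: "('a::euclidean_space \<Rightarrow> real \<times> real) \<Rightarrow> 'a set" where
  "rational_box f = box (\<Sum>i\<in>Basis. fst (f i) *\<^sub>R i) (\<Sum>i\<in>Basis. snd (f i) *\<^sub>R i)"

abbreviation "rational_corners \<equiv> (Basis :: 'a::euclidean_space set) \<rightarrow>\<^sub>E (\<rat> \<times> \<rat>)"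

lemma mem_rational_box: "x \<in> rational_box f \<longleftrightarrow> (\<forall>i\<in>Basis. fst (f i) < x \<bullet> i \<and> x \<bullet> i < snd (f i))"
  by (simp add: rational_box_def mem_box)

lemma countable_rational_corners: "countable (rational_corners :: ('a::euclidean_space \<Rightarrow> _) set)"
  by (intro countable_PiE) (auto simp: countable_rat)

lemma borel_eq_rational_box:
  "(borel :: 'a::euclidean_space measure) = sigma UNIV (rational_box ` rational_corners)"
proof (rule borel_eq_countable_basis)
  show "countable (rational_box ` (rational_corners :: ('a \<Rightarrow> _) set))"
    by (intro countable_image countable_rational_corners)
  show "topological_basis (rational_box ` (rational_corners :: ('a \<Rightarrow> _) set))"
    unfolding topological_basis_def
  proof (intro conjI allI impI ballI)
    fix M :: "'a set" assume "open M"
    then show "\<exists>B'\<subseteq>rational_box ` rational_corners. \<Union>B' = M"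
      by (intro exI[of _ "rational_box ` {f \<in> rational_corners. rational_box f \<subseteq> M}"])
         (auto simp: rational_box_def dest!: open_UNION_box)
  qed (auto simp: rational_box_def)
qed

lemma enn2real_inject:
  fixes a b :: ennreal
  assumes "enn2real a = enn2real b" "a \<noteq> \<infinity>" "b \<noteq> \<infinity>"
  shows "a = b"
proof -
  have "ennreal (enn2real a) = a" "ennreal (enn2real b) = b"
    using assms(2,3) by (simp_all add: ennreal_enn2real_if)
  with assms(1) show ?thesis by metis
qed

text \<open>\<open>ennreal\<close> cuts negative values off at 0, so \<open>ennreal (g x)\<close>
  and \<open>ennreal (- g x)\<close> are the positive and negative parts of g. As densities they
  agree on the boxes, an intersection-stable generator, and hence almost everywhere; but at each
  point one of the two parts is 0.\<close>

lemma AE_zero_if_rational_box_integrals_zero: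
  fixes g :: "'a::euclidean_space \<Rightarrow> real"
  assumes [measurable]: "g \<in> borel_measurable borel"
    and int: "\<And>f. f \<in> rational_corners \<Longrightarrow> integrable lborel (\<lambda>x. indicator (rational_box f) x * g x)"
    and zero: "\<And>f. f \<in> rational_corners \<Longrightarrow> (LINT x|lborel. indicator (rational_box f) x * g x) = 0"
  shows "AE x in lborel. g x = 0"
proof -
  have [measurable]: "rational_box f \<in> sets borel" for f :: "'a \<Rightarrow> real \<times> real"
    by (simp add: rational_box_def)
  let ?A = "\<lambda>n::nat. rational_box (\<lambda>i\<in>Basis. (- real n, real n)) :: 'a set"
  have "density lborel (\<lambda>x. ennreal (g x)) = density lborel (\<lambda>x. ennreal (- g x))"
  proof (rule measure_eqI_generator_eq[where E = "rational_box ` rational_corners" and \<Omega> = UNIV and A = ?A])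
    show "Int_stable (rational_box ` (rational_corners :: ('a \<Rightarrow> _) set))"
    proof (rule Int_stableI_image)
      fix f f' :: "'a \<Rightarrow> real \<times> real" assume f: "f \<in> rational_corners" "f' \<in> rational_corners"
      let ?h = "\<lambda>i\<in>Basis. (max (fst (f i)) (fst (f' i)), min (snd (f i)) (snd (f' i)))"
      show "\<exists>h\<in>rational_corners. rational_box f \<inter> rational_box f' = rational_box h"
      proof (rule bexI[of _ ?h])
        show "?h \<in> rational_corners"
        proof (rule restrict_PiE_iff[THEN iffD2], intro ballI)
          fix i :: 'a assume "i \<in> Basis"
          then have "f i \<in> \<rat> \<times> \<rat>" "f' i \<in> \<rat> \<times> \<rat>" using f by (auto dest: PiE_mem)
          then show "(max (fst (f i)) (fst (f' i)), min (snd (f i)) (snd (f' i))) \<in> \<rat> \<times> \<rat>"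
            by (auto simp: max_def min_def mem_Times_iff)
        qed
        show "rational_box f \<inter> rational_box f' = rational_box ?h"
        proof (rule Set.set_eqI)
          fix x
          have "(fst (f i) < x \<bullet> i \<and> x \<bullet> i < snd (f i)) \<and> (fst (f' i) < x \<bullet> i \<and> x \<bullet> i < snd (f' i))
              \<longleftrightarrow> fst (?h i) < x \<bullet> i \<and> x \<bullet> i < snd (?h i)" if "i \<in> Basis" for i
            using that by auto
          then show "x \<in> rational_box f \<inter> rational_box f' \<longleftrightarrow> x \<in> rational_box ?h"
            unfolding Int_iff mem_rational_box by blast
        qed
      qed
    qed
    have A: "(\<lambda>i\<in>Basis. (- real n, real n)) \<in> (rational_corners :: ('a \<Rightarrow> _) set)" for n
      by auto
    then show "range ?A \<subseteq> rational_box ` rational_corners" by blast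
    have eq: "emeasure (density lborel (\<lambda>x. ennreal (g x))) (rational_box f) = emeasure (density lborel (\<lambda>x. ennreal (- g x))) (rational_box f)
        \<and> emeasure (density lborel (\<lambda>x. ennreal (g x))) (rational_box f) \<noteq> \<infinity>"
      if f: "f \<in> rational_corners" for f :: "'a \<Rightarrow> real \<times> real"
    proof -
      let ?g = "\<lambda>x. indicator (rational_box f) x * g x"
      have p: "emeasure (density lborel (\<lambda>x. ennreal (g x))) (rational_box f) = (\<integral>\<^sup>+x. ennreal (?g x) \<partial>lborel)"
        by (simp add: emeasure_density, intro nn_integral_cong, simp add: indicator_def)
      have m: "emeasure (density lborel (\<lambda>x. ennreal (- g x))) (rational_box f) = (\<integral>\<^sup>+x. ennreal (- ?g x) \<partial>lborel)"
        by (simp add: emeasure_density, intro nn_integral_cong, simp add: indicator_def)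
      have fin: "(\<integral>\<^sup>+x. ennreal (?g x) \<partial>lborel) \<noteq> \<infinity>" "(\<integral>\<^sup>+x. ennreal (- ?g x) \<partial>lborel) \<noteq> \<infinity>"
        using int[OF f] by (auto simp: real_integrable_def)
      have "enn2real (\<integral>\<^sup>+x. ennreal (?g x) \<partial>lborel) = enn2real (\<integral>\<^sup>+x. ennreal (- ?g x) \<partial>lborel)"
        using zero[OF f] real_lebesgue_integral_def[OF int[OF f]] by simp
      then have "(\<integral>\<^sup>+x. ennreal (?g x) \<partial>lborel) = (\<integral>\<^sup>+x. ennreal (- ?g x) \<partial>lborel)"
        by (rule enn2real_inject) (use fin in auto)
      then show ?thesis using p m fin by simp
    qed
    then show "\<And>X. X \<in> rational_box ` rational_corners \<Longrightarrow>
        emeasure (density lborel (\<lambda>x. ennreal (g x))) X = emeasure (density lborel (\<lambda>x. ennreal (- g x))) X"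
      by blast
    show "emeasure (density lborel (\<lambda>x. ennreal (g x))) (?A n) \<noteq> \<infinity>" for n
      using eq[OF A[of n]] by blast
    show "(\<Union>n. ?A n) = UNIV"
    proof -
      have "x \<in> (\<Union>n. ?A n)" for x
      proof -
        obtain n :: nat where n: "norm x < real n" using reals_Archimedean2 by blast
        have "- real n < x \<bullet> i \<and> x \<bullet> i < real n" if "i \<in> Basis" for i
          using Basis_le_norm[OF that, of x] n by (simp add: abs_le_iff)
        then show ?thesis by (auto simp: mem_rational_box)
      qed
      then show ?thesis by blast
    qed
    show "sets (density lborel (\<lambda>x. ennreal (g x))) = sigma_sets UNIV (rational_box ` rational_corners)"
      "sets (density lborel (\<lambda>x. ennreal (- g x))) = sigma_sets UNIV (rational_box ` rational_corners)"
      using arg_cong[OF borel_eq_rational_box[where 'a = 'a], of sets] by simp_all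
  qed auto
  then have "AE x in lborel. ennreal (g x) = ennreal (- g x)"
    by (subst (asm) sigma_finite_measure.density_unique_iff[OF sigma_finite_lborel]) auto
  then show ?thesis
  proof eventually_elim
    fix x assume "ennreal (g x) = ennreal (- g x)"
    then show "g x = 0"
      by (cases "0 \<le> g x") (auto simp: ennreal_neg ennreal_eq_zero_iff ennreal_eq_0_iff)
  qed
qed

text \<open>The space on which the Fourier transform is shown to be isometric by hand; it contains the
  indicators of boxes, hence an orthonormal basis.\<close>

definition regular_functions :: "('a::euclidean_space \<Rightarrow> complex) set" where
  "regular_functions = {h \<in> borel_measurable borel. (\<exists>B. \<forall>x. cmod (h x) \<le> B)
     \<and> (\<exists>R. \<forall>x. R < norm x \<longrightarrow> h x = 0) \<and> (AE x in lborel. isCont h x)}"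

lemma integrable_indicator_cball: "integrable lborel (\<lambda>x::'a::euclidean_space. c * indicator (cball a R) x :: real)"
  using emeasure_compact_finite[of "cball a R"] by (auto simp: integrable_indicator_iff)

lemma bounded_support_integrable:
  fixes h :: "'a::euclidean_space \<Rightarrow> complex"
  assumes [measurable]: "h \<in> borel_measurable borel" and "\<And>x. cmod (h x) \<le> B" "\<And>x. R < norm x \<Longrightarrow> h x = 0"
  shows "h \<in> L2" "integrable lborel h"
proof -
  have B: "0 \<le> B" using order_trans[OF norm_ge_zero assms(2)[of 0]] .
  show "h \<in> L2"
  proof (rule L2_I_bound[OF assms(1) integrable_indicator_cball[of "B\<^sup>2" 0 R]])
    show "(cmod (h x))\<^sup>2 \<le> B\<^sup>2 * indicator (cball 0 R) x" for x
      using power_mono[OF assms(2)[of x], of 2] assms(3)[of x] by (auto split: split_indicator)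
  qed
  show "integrable lborel h"
  proof (rule Bochner_Integration.integrable_bound[OF integrable_indicator_cball[of B 0 R]])
    show "AE x in lborel. cmod (h x) \<le> norm (B * indicator (cball 0 R) x :: real)"
      using assms(2,3) B by (intro AE_I2) (auto split: split_indicator)
  qed simp
qed

lemma regular_functions_L2: "h \<in> regular_functions \<Longrightarrow> h \<in> L2"
  and regular_functions_integrable: "h \<in> regular_functions \<Longrightarrow> integrable lborel h"
  unfolding regular_functions_def using bounded_support_integrable by blast+

lemma regular_functions_add:
  assumes "g \<in> regular_functions" "h \<in> regular_functions"
  shows "(\<lambda>x. g x + h x) \<in> regular_functions"
proof -
  obtain B B' R R' where *: "\<And>x. cmod (g x) \<le> B" "\<And>x. cmod (h x) \<le> B'"
    "\<And>x. R < norm x \<Longrightarrow> g x = 0" "\<And>x. R' < norm x \<Longrightarrow> h x = 0"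
    using assms unfolding regular_functions_def by blast
  have "cmod (g x + h x) \<le> B + B'" for x
    using norm_triangle_ineq[of "g x" "h x"] *(1,2)[of x] by linarith
  moreover have "g x + h x = 0" if "max R R' < norm x" for x using that * by simp
  moreover have "AE x in lborel. isCont (\<lambda>x. g x + h x) x"
  proof -
    have "AE x in lborel. isCont g x" "AE x in lborel. isCont h x" using assms by (auto simp: regular_functions_def)
    then show ?thesis by eventually_elim (intro continuous_intros)
  qed
  moreover have "(\<lambda>x. g x + h x) \<in> borel_measurable borel"
    using assms by (auto simp: regular_functions_def)
  ultimately show ?thesis unfolding regular_functions_def by blast
qed

lemma regular_functions_cmult:
  assumes "h \<in> regular_functions"
  shows "(\<lambda>x. c * h x) \<in> regular_functions"
proof -
  obtain B R where *: "\<And>x. cmod (h x) \<le> B" "\<And>x. R < norm x \<Longrightarrow> h x = 0"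
    using assms unfolding regular_functions_def by blast
  have "cmod (c * h x) \<le> cmod c * B" for x using *(1) by (simp add: norm_mult mult_left_mono)
  moreover have "c * h x = 0" if "R < norm x" for x using that * by simp
  moreover have "AE x in lborel. isCont h x" using assms by (auto simp: regular_functions_def)
  then have "AE x in lborel. isCont (\<lambda>x. c * h x) x" by eventually_elim (intro continuous_intros)
  moreover have "(\<lambda>x. c * h x) \<in> borel_measurable borel" using assms by (auto simp: regular_functions_def)
  ultimately show ?thesis unfolding regular_functions_def by blast
qed

text \<open>The discontinuities lie on the frontier, a null set because the box is convex.\<close>

lemma indicator_box_regular: "(indicator (box a b) :: 'a::euclidean_space \<Rightarrow> complex) \<in> regular_functions"
proof -
  have "emeasure lborel (frontier (box a b)) = 0"
    using negligible_convex_frontier[of "box a b"]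
    by (simp add: negligible_iff_null_sets null_sets_completion_iff null_setsD1 convex_box)
  then have "frontier (box a b) \<in> null_sets lborel"
    by (intro null_setsI) auto
  then have "AE x in lborel. x \<notin> frontier (box a b)" by (rule AE_not_in)
  then have "AE x in lborel. isCont (indicator (box a b) :: 'a \<Rightarrow> complex) x"
  proof eventually_elim
    fix x assume x: "x \<notin> frontier (box a b)"
    have "isCont (\<lambda>x. of_real (indicator (box a b) x) :: complex) x"
      using x by (intro continuous_intros) (auto simp: isCont_indicator)
    moreover have "(\<lambda>x. of_real (indicator (box a b) x)) = (indicator (box a b) :: 'a \<Rightarrow> complex)"
      by (auto simp: fun_eq_iff split: split_indicator)
    ultimately show "isCont (indicator (box a b) :: 'a \<Rightarrow> complex) x"
      by (simp only:)
  qed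
  moreover obtain R where "box a b \<subseteq> ball 0 R" using bounded_box[of a b] bounded_subset_ballD by blast
  then have "\<forall>x. R < norm x \<longrightarrow> indicator (box a b) x = (0::complex)" by (auto split: split_indicator)
  moreover have "\<forall>x. cmod (indicator (box a b) x) \<le> 1" by (auto split: split_indicator)
  moreover have "(indicator (box a b) :: 'a \<Rightarrow> complex) \<in> borel_measurable borel" by simp
  ultimately show ?thesis unfolding regular_functions_def by blast
qed

lemma L2_orthonormal_basis_regular:
  obtains e :: "nat \<Rightarrow> 'a::euclidean_space \<Rightarrow> complex"
  where "L2_orthonormal_basis e" "\<And>n. e n \<in> regular_functions"
proof -
  let ?C = "rational_corners :: ('a \<Rightarrow> real \<times> real) set"
  define b where "b n = (indicator (rational_box (from_nat_into ?C n)) :: 'a \<Rightarrow> complex)" for n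
  \<comment> \<open>Unit cubes along the diagonal are disjoint and of volume 1, hence
    orthonormal.\<close>
  define u where "u n = (indicator (box (real n *\<^sub>R One) (real (Suc n) *\<^sub>R One)) :: 'a \<Rightarrow> complex)" for n
  have C: "?C \<noteq> {}" by (auto simp: PiE_eq_empty_iff) 
  show ?thesis
  proof (rule L2_Gram_Schmidt[of regular_functions b u])
    show "b n \<in> regular_functions" "u n \<in> regular_functions" for n
      unfolding b_def u_def rational_box_def by (rule indicator_box_regular)+
    show "L2_orthonormal u"
      unfolding L2_orthonormal_def
    proof (intro conjI allI)
      show "u i \<in> L2" for i unfolding u_def by (intro regular_functions_L2 indicator_box_regular)
      fix i j
      show "L2_inner (u i) (u j) = (if i = j then 1 else 0)"
      proof (cases "i = j")
        case True
        have "L2_inner (u i) (u i) = (LINT x|lborel. complex_of_real (indicator (box (real i *\<^sub>R One) (real (Suc i) *\<^sub>R One :: 'a)) x))"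
          unfolding L2_inner_def u_def by (intro Bochner_Integration.integral_cong) (auto split: split_indicator)
        also have "\<dots> = of_real (measure lborel (box (real i *\<^sub>R One) (real (Suc i) *\<^sub>R One :: 'a)))"
          by (simp only: integral_complex_of_real) simp
        also have "measure lborel (box (real i *\<^sub>R One) (real (Suc i) *\<^sub>R One :: 'a)) = 1"
          by (subst measure_lborel_box) (simp_all add: inner_simps algebra_simps)
        finally show ?thesis using True by simp
      next
        case False
        obtain k :: 'a where k: "k \<in> Basis" using nonempty_Basis by blast
        have "cnj (u i x) * u j x = 0" for x
        proof (rule ccontr)
          assume "cnj (u i x) * u j x \<noteq> 0"
          then have "x \<in> box (real i *\<^sub>R One) (real (Suc i) *\<^sub>R One)" "x \<in> box (real j *\<^sub>R One) (real (Suc j) *\<^sub>R One)"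
            unfolding u_def by (auto split: split_indicator_asm)
          then have "real i < x \<bullet> k" "x \<bullet> k < real (Suc i)" "real j < x \<bullet> k" "x \<bullet> k < real (Suc j)"
            using k by (auto simp: mem_box inner_simps)
          then have "real i < real (Suc j)" "real j < real (Suc i)" by linarith+
          then show False using False by simp
        qed
        then show ?thesis using False by (simp only: L2_inner_def) simp
      qed
    qed
    fix h :: "'a \<Rightarrow> complex" assume h: "h \<in> L2" and bh: "\<And>n. L2_inner (b n) h = 0"
    have [measurable]: "h \<in> borel_measurable borel" using h by (rule L2_measurable)
    have ind: "(indicator (rational_box f) :: 'a \<Rightarrow> complex) \<in> L2" for f
      unfolding rational_box_def by (intro regular_functions_L2 indicator_box_regular)
    have i0: "L2_inner (indicator (rational_box f)) h = (LINT x|lborel. indicator (rational_box f) x * h x)"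
      "integrable lborel (\<lambda>x. indicator (rational_box f) x * h x)" for f
      using L2_inner_integrable[OF ind h, of f] unfolding L2_inner_def
      by (auto intro!: Bochner_Integration.integral_cong elim!: Bochner_Integration.integrable_cong[THEN iffD1, rotated 2] split: split_indicator)
    have z: "(LINT x|lborel. indicator (rational_box f) x * h x) = 0" if f: "f \<in> ?C" for f
    proof -
      obtain n where "f = from_nat_into ?C n"
        using from_nat_into_surj[OF countable_rational_corners f] by metis
      then show ?thesis using bh[of n] i0(1)[of f] by (simp add: b_def)
    qed
    have re: "AE x in lborel. Re (h x) = 0"
    proof (rule AE_zero_if_rational_box_integrals_zero)
      fix f assume f: "f \<in> ?C"
      have eq: "indicator (rational_box f) x * Re (h x) = Re (indicator (rational_box f) x * h x)" for x
        by (auto split: split_indicator)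
      show "integrable lborel (\<lambda>x. indicator (rational_box f) x * Re (h x))"
        unfolding eq using i0(2) by (rule integrable_Re)
      show "(LINT x|lborel. indicator (rational_box f) x * Re (h x)) = 0"
        unfolding eq integral_Re[OF i0(2)] z[OF f] by simp
    qed measurable
    have im: "AE x in lborel. Im (h x) = 0"
    proof (rule AE_zero_if_rational_box_integrals_zero)
      fix f assume f: "f \<in> ?C"
      have eq: "indicator (rational_box f) x * Im (h x) = Im (indicator (rational_box f) x * h x)" for x
        by (auto split: split_indicator)
      show "integrable lborel (\<lambda>x. indicator (rational_box f) x * Im (h x))"
        unfolding eq using i0(2) by (rule integrable_Im)
      show "(LINT x|lborel. indicator (rational_box f) x * Im (h x)) = 0"
        unfolding eq integral_Im[OF i0(2)] z[OF f] by simp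
    qed measurable
    show "AE x in lborel. h x = 0" using re im by eventually_elim (simp add: complex_eq_iff)
  qed (use that in \<open>auto intro: regular_functions_L2 regular_functions_add regular_functions_cmult\<close>)
qed

section \<open>Gaussian integrals\<close>

lemma
  fixes f :: "'a::euclidean_space \<Rightarrow> real \<Rightarrow> 'b::{real_normed_field, banach, second_countable_topology}"
  assumes int: "\<And>b. b \<in> Basis \<Longrightarrow> integrable lborel (f b)"
  shows integral_lborel_prod: "(LINT x|lborel. (\<Prod>b\<in>Basis. f b (x \<bullet> b))) = (\<Prod>b\<in>Basis. LINT x|lborel. f b x)"
    and integrable_lborel_prod: "integrable lborel (\<lambda>x::'a. \<Prod>b\<in>Basis. f b (x \<bullet> b))"
proof -
  interpret product_sigma_finite "\<lambda>_::'a. lborel :: real measure" by unfold_locales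
  have [measurable]: "f b \<in> borel_measurable borel" if "b \<in> Basis" for b
    using borel_measurable_integrable[OF int[OF that]] by simp
  have m: "(\<lambda>x::'a. \<Prod>b\<in>Basis. f b (x \<bullet> b)) \<in> borel_measurable borel" by measurable
  have eq: "(\<Prod>b\<in>Basis. f b ((\<Sum>b\<in>Basis. x b *\<^sub>R b) \<bullet> b)) = (\<Prod>b\<in>Basis. f b (x b))" for x
    by (intro prod.cong refl) (simp add: inner_sum_left_Basis)
  have T: "(\<lambda>x. \<Sum>b\<in>Basis. x b *\<^sub>R b) \<in> (\<Pi>\<^sub>M b\<in>(Basis::'a set). (lborel :: real measure)) \<rightarrow>\<^sub>M (borel :: 'a measure)"
    by measurable
  show "(LINT x|lborel. (\<Prod>b\<in>Basis. f b (x \<bullet> b))) = (\<Prod>b\<in>Basis. LINT x|lborel. f b x)"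
    unfolding lborel_eq[where 'a = 'a] by (subst integral_distr[OF T m], simp only: eq, rule product_integral_prod) (use int in auto)
  show "integrable lborel (\<lambda>x::'a. \<Prod>b\<in>Basis. f b (x \<bullet> b))"
    unfolding lborel_eq[where 'a = 'a] by (subst integrable_distr_eq[OF T m], simp only: eq, rule product_integrable_prod) (use int in auto)
qed

lemma gaussian_fourier_real:
  fixes a t :: real
  assumes a: "0 < a"
  shows "integrable lborel (\<lambda>x. exp (- a * x\<^sup>2))"
    and "(CLINT x|lborel. of_real (exp (- a * x\<^sup>2)) * exp (\<i> * of_real (t * x)))
      = of_real (sqrt (pi / a) * exp (- t\<^sup>2 / (4 * a)))"
proof -
  \<comment> \<open>On this scale the Gaussian becomes, up to a constant, the standard normal
    density, whose characteristic function is known.\<close>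
  define c where "c = 1 / sqrt (2 * a)"
  have c: "0 < c" "c\<^sup>2 = 1 / (2 * a)" using a by (auto simp: c_def power_divide)
  have "integrable lborel (\<lambda>x. std_normal_density x * sqrt (2 * pi))" by (intro integrable_mult_left) simp
  then have "integrable lborel (\<lambda>x::real. exp (- x\<^sup>2 / 2))" by (simp add: std_normal_density_def)
  from lborel_integrable_real_affine[OF this, of "1 / c" 0]
  show "integrable lborel (\<lambda>x. exp (- a * x\<^sup>2))" using c a by (simp add: power_divide mult.commute)
  have "(CLINT x|lborel. of_real (exp (- a * x\<^sup>2)) * exp (\<i> * of_real (t * x)))
      = \<bar>c\<bar> *\<^sub>R (CLINT x|lborel. of_real (exp (- a * (0 + c * x)\<^sup>2)) * exp (\<i> * of_real (t * (0 + c * x))))"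
    by (rule lborel_integral_real_affine) (use c in auto)
  also have "(\<lambda>x. of_real (exp (- a * (0 + c * x)\<^sup>2)) * exp (\<i> * of_real (t * (0 + c * x))))
      = (\<lambda>x. of_real (sqrt (2 * pi)) * (std_normal_density x *\<^sub>R exp (\<i> * of_real ((t * c) * x))))"
    using c a by (auto simp: std_normal_density_def fun_eq_iff power_mult_distrib scaleR_conv_of_real mult_ac)
  also have "(CLINT x|lborel. of_real (sqrt (2 * pi)) * (std_normal_density x *\<^sub>R exp (\<i> * of_real ((t * c) * x))))
      = of_real (sqrt (2 * pi)) * char std_normal_distribution (t * c)"
    unfolding char_def integral_mult_right_zero by (subst integral_density) auto
  also have "\<bar>c\<bar> *\<^sub>R \<dots> = of_real (sqrt (pi / a) * exp (- t\<^sup>2 / (4 * a)))"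
  proof -
    have "c * sqrt (2 * pi) = sqrt (pi / a)"
      using a by (simp add: c_def real_sqrt_divide[symmetric] real_sqrt_mult)
    moreover have "(t * c)\<^sup>2 / 2 = t\<^sup>2 / (4 * a)" using c by (simp add: power_mult_distrib)
    ultimately show ?thesis
      unfolding char_std_normal_distribution scaleR_conv_of_real
      using c(1) by (simp add: mult.assoc[symmetric] flip: of_real_mult)
  qed
  finally show "(CLINT x|lborel. of_real (exp (- a * x\<^sup>2)) * exp (\<i> * of_real (t * x)))
      = of_real (sqrt (pi / a) * exp (- t\<^sup>2 / (4 * a)))" .
qed

lemma norm_power2_Basis: "(norm (x::'a::euclidean_space))\<^sup>2 = (\<Sum>b\<in>Basis. (x \<bullet> b)\<^sup>2)"
  unfolding power2_norm_eq_inner by (subst euclidean_inner) (simp add: power2_eq_square)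

lemma gaussian_fourier:
  fixes z :: "'a::euclidean_space"
  assumes a: "0 < a"
  shows "integrable lborel (\<lambda>p::'a. exp (- a * (norm p)\<^sup>2))"
    and "(CLINT p|lborel. of_real (exp (- a * (norm p)\<^sup>2)) * exp (\<i> * of_real (p \<bullet> z)))
      = of_real (sqrt (pi / a) ^ DIM('a) * exp (- (norm z)\<^sup>2 / (4 * a)))"
proof -
  have ex: "exp (- a * (norm p)\<^sup>2) = (\<Prod>b\<in>Basis. exp (- a * (p \<bullet> b)\<^sup>2))" for p :: 'a
    unfolding norm_power2_Basis by (simp add: sum_distrib_left exp_sum sum_negf[symmetric])
  show "integrable lborel (\<lambda>p::'a. exp (- a * (norm p)\<^sup>2))"
    unfolding ex by (rule integrable_lborel_prod) (rule gaussian_fourier_real(1)[OF a])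
  have ex2: "exp (\<i> * of_real (p \<bullet> z)) = (\<Prod>b\<in>Basis. exp (\<i> * of_real ((z \<bullet> b) * (p \<bullet> b))))" for p
    by (subst euclidean_inner) (simp add: exp_sum sum_distrib_left mult_ac)
  have int: "integrable lborel (\<lambda>x. of_real (exp (- a * x\<^sup>2)) * exp (\<i> * of_real (t * x)))" for t
    by (rule Bochner_Integration.integrable_bound[OF gaussian_fourier_real(1)[OF a]]) (auto simp: norm_mult)
  have "(CLINT p|lborel. of_real (exp (- a * (norm p)\<^sup>2)) * exp (\<i> * of_real (p \<bullet> z)))
     = (CLINT p|lborel. (\<Prod>b\<in>Basis. of_real (exp (- a * (p \<bullet> b)\<^sup>2)) * exp (\<i> * of_real ((z \<bullet> b) * (p \<bullet> b)))))"
    unfolding ex ex2 by (simp add: prod.distrib)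
  also have "\<dots> = (\<Prod>b\<in>(Basis::'a set). CLINT x|lborel. of_real (exp (- a * x\<^sup>2)) * exp (\<i> * of_real ((z \<bullet> b) * x)))"
    by (rule integral_lborel_prod) (rule int)
  also have "\<dots> = (\<Prod>b\<in>(Basis::'a set). of_real (sqrt (pi / a) * exp (- (z \<bullet> b)\<^sup>2 / (4 * a))))"
    by (intro prod.cong refl gaussian_fourier_real(2)[OF a])
  also have "\<dots> = of_real (sqrt (pi / a) ^ DIM('a) * exp (- (norm z)\<^sup>2 / (4 * a)))"
    unfolding norm_power2_Basis
    by (simp only: of_real_prod[symmetric] prod.distrib prod_constant exp_sum[symmetric] finite_Basis sum_divide_distrib[symmetric] sum_negf)
  finally show "(CLINT p|lborel. of_real (exp (- a * (norm p)\<^sup>2)) * exp (\<i> * of_real (p \<bullet> z)))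
      = of_real (sqrt (pi / a) ^ DIM('a) * exp (- (norm z)\<^sup>2 / (4 * a)))" .
qed

lemma gaussian_integral:
  assumes a: "0 < a"
  shows "(LINT p|lborel. exp (- a * (norm (p::'a::euclidean_space))\<^sup>2)) = sqrt (pi / a) ^ DIM('a)"
proof -
  have "complex_of_real (LINT p|lborel. exp (- a * (norm (p::'a))\<^sup>2)) = of_real (sqrt (pi / a) ^ DIM('a))"
    using gaussian_fourier(2)[OF a, of "0::'a"] by (simp flip: integral_complex_of_real)
  then show ?thesis by (simp only: of_real_eq_iff)
qed

section \<open>Fourier transform of integrable functions and multipliers\<close>

text \<open>Fubini's theorem with C |u(x)| |v(y)| as majorant. The exchanges of Fourier integrals
  below are the case of a kernel of modulus 1.\<close>

lemma lborel_kernel_swap: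
  fixes u v :: "'a::euclidean_space \<Rightarrow> complex"
  assumes u: "integrable lborel u" and v: "integrable lborel v"
    and k [measurable]: "case_prod k \<in> borel_measurable (borel \<Otimes>\<^sub>M borel)"
    and C: "\<And>x y. cmod (k x y) \<le> C"
  shows "(LINT x|lborel. u x * (LINT y|lborel. k x y * v y)) = (LINT y|lborel. v y * (LINT x|lborel. k x y * u x))"
proof -
  have [measurable]: "u \<in> borel_measurable borel" "v \<in> borel_measurable borel"
    using u v by (auto dest: borel_measurable_integrable)
  have m: "(\<lambda>(x, y). u x * (k x y * v y)) \<in> borel_measurable (lborel \<Otimes>\<^sub>M lborel)"
    by (simp add: split_beta' cong: measurable_cong_sets)
  have C0: "0 \<le> C" using order_trans[OF norm_ge_zero C] .
  have int_y: "integrable lborel (\<lambda>y. k x y * v y)" for x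
  proof (rule Bochner_Integration.integrable_bound)
    show "integrable lborel (\<lambda>y. C * cmod (v y))" using v by auto
    show "AE y in lborel. norm (k x y * v y) \<le> norm (C * cmod (v y))"
      using C C0 by (intro AE_I2) (auto simp: norm_mult intro!: mult_right_mono)
  qed measurable
  have int: "integrable (lborel \<Otimes>\<^sub>M lborel) (\<lambda>(x, y). u x * (k x y * v y))"
  proof (rule lborel_pair.Fubini_integrable[OF m])
    show "AE x in lborel. integrable lborel (\<lambda>y. case (x, y) of (x, y) \<Rightarrow> u x * (k x y * v y))"
      using int_y by simp
    show "integrable lborel (\<lambda>x. LINT y|lborel. norm (case (x, y) of (x, y) \<Rightarrow> u x * (k x y * v y)))"
    proof (rule Bochner_Integration.integrable_bound)
      show "integrable lborel (\<lambda>x. cmod (u x) * (C * (LINT y|lborel. cmod (v y))))" using u by auto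
      show "(\<lambda>x. LINT y|lborel. norm (case (x, y) of (x, y) \<Rightarrow> u x * (k x y * v y))) \<in> borel_measurable lborel"
        by (simp add: split_beta' cong: measurable_cong_sets)
      show "AE x in lborel. norm (LINT y|lborel. norm (case (x, y) of (x, y) \<Rightarrow> u x * (k x y * v y)))
          \<le> norm (cmod (u x) * (C * (LINT y|lborel. cmod (v y))))"
      proof (intro AE_I2)
        fix x
        have "(LINT y|lborel. norm (k x y * v y)) \<le> (LINT y|lborel. C * cmod (v y))"
          using v integrable_norm[OF int_y[of x]] C by (intro integral_mono) (auto simp: norm_mult intro!: mult_right_mono)
        then show "norm (LINT y|lborel. norm (case (x, y) of (x, y) \<Rightarrow> u x * (k x y * v y)))
          \<le> norm (cmod (u x) * (C * (LINT y|lborel. cmod (v y))))"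
          using C0 by (simp add: norm_mult abs_mult mult_left_mono)
      qed
    qed
  qed
  have "(LINT x|lborel. u x * (LINT y|lborel. k x y * v y)) = (LINT x|lborel. LINT y|lborel. u x * (k x y * v y))"
    by simp
  also have "\<dots> = (LINT y|lborel. LINT x|lborel. u x * (k x y * v y))"
    by (rule lborel_pair.Fubini_integral[symmetric, OF int])
  also have "\<dots> = (LINT y|lborel. v y * (LINT x|lborel. k x y * u x))"
    by (intro Bochner_Integration.integral_cong refl)
       (simp add: mult_ac flip: integral_mult_right_zero)
  finally show ?thesis .
qed

lemma fourier_L1_measurable [measurable]:
  assumes [measurable]: "h \<in> borel_measurable borel"
  shows "fourier_L1 h \<in> borel_measurable borel"
  unfolding fourier_L1_def[abs_def] by measurable

lemma integrable_fourier_kernel: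
  fixes h :: "'a::euclidean_space \<Rightarrow> complex"
  assumes h: "integrable lborel h"
  shows "integrable lborel (\<lambda>x. exp (- \<i> * of_real (p \<bullet> x)) * h x)"
    "integrable lborel (\<lambda>x. exp (\<i> * of_real (p \<bullet> x)) * h x)"
proof -
  have [measurable]: "h \<in> borel_measurable borel" using h by (auto dest: borel_measurable_integrable)
  show "integrable lborel (\<lambda>x. exp (- \<i> * of_real (p \<bullet> x)) * h x)"
    "integrable lborel (\<lambda>x. exp (\<i> * of_real (p \<bullet> x)) * h x)"
    by (rule Bochner_Integration.integrable_bound[OF h]; simp add: norm_mult norm_exp_eq_Re)+
qed

lemma norm_fourier_L1_le:
  fixes h :: "'a::euclidean_space \<Rightarrow> complex"
  shows "cmod (fourier_L1 h p) \<le> (2 * pi) powr (- real DIM('a) / 2) * (LINT x|lborel. cmod (h x))"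
proof -
  have "cmod (LINT x|lborel. exp (- \<i> * of_real (p \<bullet> x)) * h x) \<le> (LINT x|lborel. cmod (exp (- \<i> * of_real (p \<bullet> x)) * h x))"
    by (rule integral_norm_bound)
  also have "\<dots> = (LINT x|lborel. cmod (h x))" by (simp add: norm_mult norm_exp_eq_Re)
  finally show ?thesis unfolding fourier_L1_def norm_mult norm_of_real by (simp add: mult_left_mono)
qed

lemma fourier_L1_diff:
  assumes "integrable lborel g" "integrable lborel h"
  shows "fourier_L1 (\<lambda>x. g x - h x) p = fourier_L1 g p - fourier_L1 h p"
  unfolding fourier_L1_def using integrable_fourier_kernel(1)[OF assms(1), of p] integrable_fourier_kernel(1)[OF assms(2), of p]
  by (simp add: right_diff_distrib)

lemma fourier_L1_cmult: "fourier_L1 (\<lambda>x. c * h x) p = c * fourier_L1 h p"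
  unfolding fourier_L1_def by (simp add: mult.left_commute[of _ c])

text \<open>Convolution kernel of the Fourier multiplier \<open>w\<close>; its constant is the
  square of the one in \<open>fourier_L1\<close>.\<close>

definition inverse_fourier_weight :: "('a::euclidean_space \<Rightarrow> real) \<Rightarrow> 'a \<Rightarrow> complex" where
  "inverse_fourier_weight w z = (LINT p|lborel. of_real (w p) * exp (\<i> * of_real (p \<bullet> z))) / of_real ((2 * pi) ^ DIM('a))"

lemma fourier_const_power2: "complex_of_real ((2 * pi) powr (- real n / 2)) * of_real ((2 * pi) powr (- real n / 2)) = 1 / of_real ((2 * pi) ^ n)"
proof -
  have "(2 * pi) powr (- real n / 2) * (2 * pi) powr (- real n / 2) = 1 / (2 * pi) ^ n"
  proof -
    have "b powr (- real n / 2) * b powr (- real n / 2) = 1 / b ^ n" if "0 < b" for b :: real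
      using that by (subst powr_add[symmetric]) (simp add: powr_minus_divide powr_realpow)
    then show ?thesis using pi_gt_zero by simp
  qed
  from arg_cong[OF this, of complex_of_real] show ?thesis
    by (simp only: of_real_mult of_real_1 of_real_divide)
qed

text \<open>A multiplier in momentum space is a convolution in position space. With a Gaussian
  weight this leads to Plancherel's theorem, with \<open>occupation\<close> to the kernel of
  \<open>K\<close>.\<close>

lemma fourier_weighted_inner:
  fixes g h :: "'a::euclidean_space \<Rightarrow> complex"
  assumes w: "integrable lborel w" and g: "integrable lborel g" and h: "integrable lborel h"
  shows "(LINT p|lborel. of_real (w p) * (cnj (fourier_L1 g p) * fourier_L1 h p))
    = (LINT x|lborel. cnj (g x) * (LINT y|lborel. inverse_fourier_weight w (x - y) * h y))"
proof -
  have [measurable]: "w \<in> borel_measurable borel" "g \<in> borel_measurable borel" "h \<in> borel_measurable borel"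
    using w g h by (auto dest: borel_measurable_integrable)
  define c where "c = complex_of_real ((2 * pi) powr (- real DIM('a) / 2))"
  have c2: "c * c = 1 / of_real ((2 * pi) ^ DIM('a))" unfolding c_def by (rule fourier_const_power2)
  define H where "H p = (LINT y|lborel. exp (- \<i> * of_real (p \<bullet> y)) * h y)" for p :: 'a
  have [measurable]: "H \<in> borel_measurable borel" unfolding H_def[abs_def] by measurable
  have H_bound: "cmod (H p) \<le> (LINT y|lborel. cmod (h y))" for p
    using integral_norm_bound[of lborel "\<lambda>y. exp (- \<i> * of_real (p \<bullet> y)) * h y"]
    by (simp add: H_def norm_mult norm_exp_eq_Re)
  have wH: "integrable lborel (\<lambda>p. of_real (w p) * H p)"
  proof (rule Bochner_Integration.integrable_bound)
    show "integrable lborel (\<lambda>p. w p * (LINT y|lborel. cmod (h y)))" using w by auto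
    show "AE p in lborel. norm (of_real (w p) * H p) \<le> norm (w p * (LINT y|lborel. cmod (h y)))"
      using H_bound by (intro AE_I2) (auto simp: norm_mult abs_mult intro!: mult_left_mono order_trans[OF H_bound])
  qed measurable
  have gc: "integrable lborel (\<lambda>x. cnj (g x))" using g by simp
  have fg: "cnj (fourier_L1 g p) = c * (LINT x|lborel. exp (\<i> * of_real (p \<bullet> x)) * cnj (g x))" for p
    unfolding fourier_L1_def c_def complex_cnj_mult
    by (simp flip: Bochner_Integration.integral_cnj add: exp_cnj)
  have "(LINT p|lborel. of_real (w p) * (cnj (fourier_L1 g p) * fourier_L1 h p))
      = (LINT p|lborel. (c * c) * ((of_real (w p) * H p) * (LINT x|lborel. exp (\<i> * of_real (p \<bullet> x)) * cnj (g x))))"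
    by (intro Bochner_Integration.integral_cong refl) (simp only: fg, simp add: fourier_L1_def c_def H_def mult_ac)
  also have "\<dots> = (c * c) * (LINT p|lborel. (of_real (w p) * H p) * (LINT x|lborel. exp (\<i> * of_real (p \<bullet> x)) * cnj (g x)))"
    by (rule integral_mult_right_zero)
  also have "(LINT p|lborel. (of_real (w p) * H p) * (LINT x|lborel. exp (\<i> * of_real (p \<bullet> x)) * cnj (g x)))
      = (LINT x|lborel. cnj (g x) * (LINT p|lborel. exp (\<i> * of_real (p \<bullet> x)) * (of_real (w p) * H p)))"
    by (rule lborel_kernel_swap[OF wH gc, of _ 1]) (auto simp: norm_exp_eq_Re)
  also have "(c * c) * \<dots> = (LINT x|lborel. cnj (g x) * ((c * c) * (LINT p|lborel. exp (\<i> * of_real (p \<bullet> x)) * (of_real (w p) * H p))))"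
    by (simp add: mult.left_commute[of _ "c * c"] flip: integral_mult_right_zero)
  also have "\<dots> = (LINT x|lborel. cnj (g x) * (LINT y|lborel. inverse_fourier_weight w (x - y) * h y))"
  proof (intro Bochner_Integration.integral_cong refl arg_cong2[of _ _ _ _ "(*)"])
    fix x
    have we: "integrable lborel (\<lambda>p. of_real (w p) * exp (\<i> * of_real (p \<bullet> x)))"
      using integrable_fourier_kernel(2)[OF integrable_of_real[OF w], of x] by (simp add: mult.commute inner_commute)
    have "(LINT p|lborel. exp (\<i> * of_real (p \<bullet> x)) * (of_real (w p) * H p))
        = (LINT p|lborel. (of_real (w p) * exp (\<i> * of_real (p \<bullet> x))) * (LINT y|lborel. exp (- \<i> * of_real (p \<bullet> y)) * h y))"
      by (simp add: H_def mult_ac)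
    also have "\<dots> = (LINT y|lborel. h y * (LINT p|lborel. exp (- \<i> * of_real (p \<bullet> y)) * (of_real (w p) * exp (\<i> * of_real (p \<bullet> x)))))"
      by (rule lborel_kernel_swap[OF we h, of _ 1]) (auto simp: norm_exp_eq_Re)
    also have "\<dots> = (LINT y|lborel. h y * (LINT p|lborel. of_real (w p) * exp (\<i> * of_real (p \<bullet> (x - y)))))"
    proof -
      have "exp (- \<i> * of_real (p \<bullet> y)) * (of_real (w p) * exp (\<i> * of_real (p \<bullet> x))) = of_real (w p) * exp (\<i> * of_real (p \<bullet> (x - y)))" for p y
        by (simp add: inner_diff_right right_diff_distrib exp_diff exp_minus divide_inverse mult_ac)
      then show ?thesis by (simp only:)
    qed
    finally show "(c * c) * (LINT p|lborel. exp (\<i> * of_real (p \<bullet> x)) * (of_real (w p) * H p))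
        = (LINT y|lborel. inverse_fourier_weight w (x - y) * h y)"
      by (simp add: c2 inverse_fourier_weight_def mult_ac flip: integral_mult_right_zero)
  qed
  finally show ?thesis .
qed

section \<open>The Plancherel theorem\<close>

definition heat_kernel :: "real \<Rightarrow> 'a::euclidean_space \<Rightarrow> real" where
  "heat_kernel a z = (1 / sqrt (4 * pi * a)) ^ DIM('a) * exp (- (norm z)\<^sup>2 / (4 * a))"

lemma heat_kernel_nonneg [simp]: "0 < a \<Longrightarrow> 0 \<le> heat_kernel a z"
  by (simp add: heat_kernel_def)

lemma heat_kernel_measurable [measurable]: "heat_kernel a \<in> borel_measurable borel"
  unfolding heat_kernel_def[abs_def] by measurable

lemma inverse_fourier_weight_gaussian:
  assumes a: "0 < a"
  shows "inverse_fourier_weight (\<lambda>p. exp (- a * (norm p)\<^sup>2)) (z::'a::euclidean_space) = of_real (heat_kernel a z)"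
proof -
  have "sqrt (pi / a) / (2 * pi) = 1 / sqrt (4 * pi * a)"
  proof -
    have "sqrt (pi / a) * sqrt (4 * pi * a) = sqrt ((2 * pi)\<^sup>2)"
      unfolding real_sqrt_mult[symmetric] using a by (simp add: power2_eq_square)
    also have "\<dots> = 2 * pi" using pi_gt_zero by (subst real_sqrt_abs) simp
    finally show ?thesis using a pi_gt_zero by (simp add: field_simps del: real_sqrt_mult)
  qed
  then have "sqrt (pi / a) ^ DIM('a) / (2 * pi) ^ DIM('a) = (1 / sqrt (4 * pi * a)) ^ DIM('a)"
    by (simp only: power_divide[symmetric])
  then have "sqrt (pi / a) ^ DIM('a) * exp (- (norm z)\<^sup>2 / (4 * a)) / (2 * pi) ^ DIM('a) = heat_kernel a z"
    unfolding heat_kernel_def by (metis times_divide_eq_left)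
  then show ?thesis
    unfolding inverse_fourier_weight_def gaussian_fourier(2)[OF a] by (metis of_real_divide)
qed

lemma heat_kernel_integral:
  assumes a: "0 < a"
  shows "integrable lborel (heat_kernel a :: 'a::euclidean_space \<Rightarrow> real)"
    and "(LINT z|lborel. heat_kernel a (z::'a)) = 1"
proof -
  have a': "0 < 1 / (4 * a)" using a by simp
  have eq: "heat_kernel a = (\<lambda>z::'a. (1 / sqrt (4 * pi * a)) ^ DIM('a) * exp (- (1 / (4 * a)) * (norm z)\<^sup>2))"
    by (simp add: heat_kernel_def fun_eq_iff)
  show "integrable lborel (heat_kernel a :: 'a \<Rightarrow> real)"
    unfolding eq by (intro integrable_mult_right gaussian_fourier(1)[OF a'])
  have "(LINT z|lborel. heat_kernel a (z::'a)) = (1 / sqrt (4 * pi * a)) ^ DIM('a) * sqrt (pi / (1 / (4 * a))) ^ DIM('a)"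
    unfolding eq integral_mult_right_zero gaussian_integral[OF a'] ..
  also have "pi / (1 / (4 * a)) = 4 * pi * a" by simp
  also have "(1 / sqrt (4 * pi * a)) ^ DIM('a) * sqrt (4 * pi * a) ^ DIM('a) = 1"
    using a pi_gt_zero by (simp add: power_mult_distrib[symmetric] del: real_sqrt_mult)
  finally show "(LINT z|lborel. heat_kernel a (z::'a)) = 1" .
qed

lemma nn_integral_heat_kernel:
  assumes a: "0 < a"
  shows "(\<integral>\<^sup>+y. ennreal (heat_kernel a (x - y :: 'a::euclidean_space)) \<partial>lborel) = 1"
    and "(\<integral>\<^sup>+x. ennreal (heat_kernel a (x - y :: 'a)) \<partial>lborel) = 1"
proof -
  have 0: "(\<integral>\<^sup>+z. ennreal (heat_kernel a (z::'a)) \<partial>lborel) = 1"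
    using heat_kernel_integral[OF a, where 'a = 'a] a by (subst nn_integral_eq_integral) auto
  show "(\<integral>\<^sup>+y. ennreal (heat_kernel a (x - y :: 'a)) \<partial>lborel) = 1"
    using 0 by (subst (asm) nn_integral_lborel_affine[of _ "-1" x]) auto
  show "(\<integral>\<^sup>+x. ennreal (heat_kernel a (x - y :: 'a)) \<partial>lborel) = 1"
    using 0 by (subst (asm) nn_integral_lborel_affine[of _ 1 "- y"]) auto
qed

lemma heat_kernel_scale:
  assumes "0 < a"
  shows "sqrt a ^ DIM('a) * heat_kernel a (sqrt a *\<^sub>R z :: 'a::euclidean_space) = heat_kernel 1 z"
proof -
  have "sqrt a * (1 / sqrt (4 * pi * a)) = 1 / sqrt (4 * pi * 1)"
    using assms by (simp add: real_sqrt_mult)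
  then have "sqrt a ^ DIM('a) * (1 / sqrt (4 * pi * a)) ^ DIM('a) = (1 / sqrt (4 * pi * 1)) ^ DIM('a)"
    by (simp only: power_mult_distrib[symmetric])
  moreover have "(norm (sqrt a *\<^sub>R z))\<^sup>2 / (4 * a) = (norm z)\<^sup>2 / (4 * 1)"
    using assms by (simp add: power_mult_distrib)
  ultimately show ?thesis unfolding heat_kernel_def by (simp only: mult.assoc[symmetric] minus_divide_left[symmetric])
qed

text \<open>For a function that is not integrable the left side is 0 by convention.\<close>

lemma norm_integral_le_nn_integral:
  fixes f :: "'b \<Rightarrow> complex"
  shows "ennreal (cmod (LINT x|M. f x)) \<le> (\<integral>\<^sup>+x. ennreal (cmod (f x)) \<partial>M)"
proof (cases "integrable M f")
  case True then show ?thesis by (rule integral_norm_bound_ennreal)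
next
  case False then show ?thesis by (simp add: not_integrable_integral_eq)
qed

lemma integral_norm_bound_integral_lborel:
  fixes f :: "'a::euclidean_space \<Rightarrow> complex"
  assumes g: "integrable lborel g" and le: "\<And>x. cmod (f x) \<le> g x" and [measurable]: "f \<in> borel_measurable borel"
  shows "cmod (LINT x|lborel. f x) \<le> (LINT x|lborel. g x)"
proof -
  have f: "integrable lborel f"
    by (rule Bochner_Integration.integrable_bound[OF g])
       (use le in \<open>auto intro!: AE_I2 intro: order_trans[OF _ abs_ge_self]\<close>)
  have "cmod (LINT x|lborel. f x) \<le> (LINT x|lborel. cmod (f x))" by (rule integral_norm_bound)
  also have "\<dots> \<le> (LINT x|lborel. g x)" using f g le by (intro integral_mono) auto
  finally show ?thesis .
qed

text \<open>Schur's test: |h(x)| |h(y)| is at most (|h(x)|^2 + |h(y)|^2) / 2, and the kernel has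
  total mass 1 in each variable.\<close>

lemma heat_kernel_form_bound:
  fixes h :: "'a::euclidean_space \<Rightarrow> complex"
  assumes h: "h \<in> L2" and a: "0 < a"
  shows "cmod (LINT x|lborel. cnj (h x) * (LINT y|lborel. of_real (heat_kernel a (x - y)) * h y)) \<le> (L2_norm h)\<^sup>2"
proof -
  have [measurable]: "h \<in> borel_measurable borel" using h by (rule L2_measurable)
  let ?g = "\<lambda>x y. ennreal (heat_kernel a (x - y :: 'a))"
  have "ennreal (cmod (LINT x|lborel. cnj (h x) * (LINT y|lborel. of_real (heat_kernel a (x - y)) * h y)))
      \<le> (\<integral>\<^sup>+x. ennreal (cmod (cnj (h x) * (LINT y|lborel. of_real (heat_kernel a (x - y)) * h y))) \<partial>lborel)"
    by (rule norm_integral_le_nn_integral)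
  also have "\<dots> \<le> (\<integral>\<^sup>+x. (\<integral>\<^sup>+y. ennreal (1/2 * (cmod (h x))\<^sup>2) * ?g x y + ennreal (1/2 * (cmod (h y))\<^sup>2) * ?g x y \<partial>lborel) \<partial>lborel)"
  proof (rule nn_integral_mono)
    fix x :: 'a
    have "ennreal (cmod (cnj (h x) * (LINT y|lborel. of_real (heat_kernel a (x - y)) * h y)))
        = ennreal (cmod (h x)) * ennreal (cmod (LINT y|lborel. of_real (heat_kernel a (x - y)) * h y))"
      by (simp add: norm_mult ennreal_mult)
    also have "\<dots> \<le> ennreal (cmod (h x)) * (\<integral>\<^sup>+y. ennreal (cmod (of_real (heat_kernel a (x - y)) * h y)) \<partial>lborel)"
      by (intro mult_left_mono norm_integral_le_nn_integral) auto
    also have "\<dots> = (\<integral>\<^sup>+y. ennreal (cmod (h x)) * ennreal (cmod (of_real (heat_kernel a (x - y)) * h y)) \<partial>lborel)"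
      by (rule nn_integral_cmult[symmetric]) measurable
    also have "\<dots> \<le> (\<integral>\<^sup>+y. ennreal (1/2 * (cmod (h x))\<^sup>2) * ?g x y + ennreal (1/2 * (cmod (h y))\<^sup>2) * ?g x y \<partial>lborel)"
    proof (rule nn_integral_mono)
      fix y :: 'a
      have amgm: "cmod (h x) * cmod (h y) \<le> 1/2 * (cmod (h x))\<^sup>2 + 1/2 * (cmod (h y))\<^sup>2"
        using zero_le_power2[of "cmod (h x) - cmod (h y)"] by (simp add: power2_eq_square algebra_simps)
      then have "cmod (h x) * (heat_kernel a (x - y) * cmod (h y))
          \<le> (1/2 * (cmod (h x))\<^sup>2) * heat_kernel a (x - y) + (1/2 * (cmod (h y))\<^sup>2) * heat_kernel a (x - y)"
        using mult_right_mono[OF amgm heat_kernel_nonneg[OF a, of "x - y"]] by (simp only: distrib_right distrib_left mult_ac)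
      then show "ennreal (cmod (h x)) * ennreal (cmod (of_real (heat_kernel a (x - y)) * h y))
          \<le> ennreal (1/2 * (cmod (h x))\<^sup>2) * ?g x y + ennreal (1/2 * (cmod (h y))\<^sup>2) * ?g x y"
        using a by (simp add: norm_mult ennreal_mult[symmetric] ennreal_plus[symmetric] ennreal_leI del: ennreal_plus)
    qed
    finally show "ennreal (cmod (cnj (h x) * (LINT y|lborel. of_real (heat_kernel a (x - y)) * h y)))
        \<le> (\<integral>\<^sup>+y. ennreal (1/2 * (cmod (h x))\<^sup>2) * ?g x y + ennreal (1/2 * (cmod (h y))\<^sup>2) * ?g x y \<partial>lborel)" .
  qed
  also have "\<dots> = (\<integral>\<^sup>+x. (\<integral>\<^sup>+y. ennreal (1/2 * (cmod (h x))\<^sup>2) * ?g x y \<partial>lborel) \<partial>lborel)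
      + (\<integral>\<^sup>+x. (\<integral>\<^sup>+y. ennreal (1/2 * (cmod (h y))\<^sup>2) * ?g x y \<partial>lborel) \<partial>lborel)"
    by (subst nn_integral_add, measurable, subst nn_integral_add, measurable)
  also have "(\<integral>\<^sup>+x. (\<integral>\<^sup>+y. ennreal (1/2 * (cmod (h y))\<^sup>2) * ?g x y \<partial>lborel) \<partial>lborel)
      = (\<integral>\<^sup>+y. (\<integral>\<^sup>+x. ennreal (1/2 * (cmod (h y))\<^sup>2) * ?g x y \<partial>lborel) \<partial>lborel)"
    by (rule lborel_pair.Fubini') (simp add: split_beta')
  also have "\<dots> = (\<integral>\<^sup>+x. ennreal (1/2 * (cmod (h x))\<^sup>2) \<partial>lborel)"
    by (subst nn_integral_cmult) (simp_all add: nn_integral_heat_kernel[OF a])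
  also have "(\<integral>\<^sup>+x. (\<integral>\<^sup>+y. ennreal (1/2 * (cmod (h x))\<^sup>2) * ?g x y \<partial>lborel) \<partial>lborel) = (\<integral>\<^sup>+x. ennreal (1/2 * (cmod (h x))\<^sup>2) \<partial>lborel)"
    by (subst nn_integral_cmult) (simp_all add: nn_integral_heat_kernel[OF a])
  also have "(\<integral>\<^sup>+x. ennreal (1/2 * (cmod (h x))\<^sup>2) \<partial>lborel) + (\<integral>\<^sup>+x. ennreal (1/2 * (cmod (h x))\<^sup>2) \<partial>lborel)
      = (\<integral>\<^sup>+x. ennreal (1/2 * (cmod (h x))\<^sup>2) + ennreal (1/2 * (cmod (h x))\<^sup>2) \<partial>lborel)"
    by (rule nn_integral_add[symmetric]) measurable
  also have "\<dots> = (\<integral>\<^sup>+x. ennreal ((cmod (h x))\<^sup>2) \<partial>lborel)"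
    by (intro nn_integral_cong, subst ennreal_plus[symmetric]) auto
  also have "\<dots> = ennreal ((L2_norm h)\<^sup>2)" by (rule nn_integral_L2[OF h])
  finally show ?thesis by simp
qed

lemma fourier_L1_regularized:
  fixes h :: "'a::euclidean_space \<Rightarrow> complex"
  assumes h: "integrable lborel h" and a: "0 < a"
  shows "complex_of_real (LINT p|lborel. exp (- a * (norm p)\<^sup>2) * (cmod (fourier_L1 h p))\<^sup>2)
    = (LINT x|lborel. cnj (h x) * (LINT y|lborel. of_real (heat_kernel a (x - y)) * h y))"
proof -
  have "(LINT x|lborel. cnj (h x) * (LINT y|lborel. of_real (heat_kernel a (x - y)) * h y))
      = (LINT p|lborel. of_real (exp (- a * (norm p)\<^sup>2)) * (cnj (fourier_L1 h p) * fourier_L1 h p))"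
    unfolding inverse_fourier_weight_gaussian[OF a, symmetric]
    by (rule fourier_weighted_inner[OF gaussian_fourier(1)[OF a] h h, symmetric])
  also have "\<dots> = (LINT p|lborel. complex_of_real (exp (- a * (norm p)\<^sup>2) * (cmod (fourier_L1 h p))\<^sup>2))"
    by (intro Bochner_Integration.integral_cong refl)
       (simp only: of_real_mult of_real_power[symmetric] complex_norm_square mult.commute)
  finally show ?thesis by (simp only: integral_complex_of_real)
qed

lemma integrable_gaussian_fourier_L1:
  fixes h :: "'a::euclidean_space \<Rightarrow> complex"
  assumes h: "integrable lborel h" and a: "0 < a"
  shows "integrable lborel (\<lambda>p. exp (- a * (norm p)\<^sup>2) * (cmod (fourier_L1 h p))\<^sup>2)"
proof (rule Bochner_Integration.integrable_bound)
  have [measurable]: "h \<in> borel_measurable borel" using h by (auto dest: borel_measurable_integrable)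
  define C where "C = (2 * pi) powr (- real DIM('a) / 2) * (LINT x|lborel. cmod (h x))"
  show "integrable lborel (\<lambda>p::'a. exp (- a * (norm p)\<^sup>2) * C\<^sup>2)"
    by (intro integrable_mult_left gaussian_fourier(1)[OF a])
  show "(\<lambda>p. exp (- a * (norm p)\<^sup>2) * (cmod (fourier_L1 h p))\<^sup>2) \<in> borel_measurable lborel" by measurable
  show "AE p in lborel. norm (exp (- a * (norm p)\<^sup>2) * (cmod (fourier_L1 h p))\<^sup>2) \<le> norm (exp (- a * (norm p)\<^sup>2) * C\<^sup>2)"
    using norm_fourier_L1_le[of h] by (intro AE_I2) (auto simp: abs_mult C_def intro!: mult_left_mono power_mono)
qed

text \<open>A Gaussian cutoff in momentum turns the squared norm of the transform into the quadratic
  form of a heat kernel, which is at most the squared norm of h. Fatou's lemma removes the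
  cutoff.\<close>

lemma fourier_L1_contraction:
  fixes h :: "'a::euclidean_space \<Rightarrow> complex"
  assumes h: "integrable lborel h" and h2: "h \<in> L2"
  shows "fourier_L1 h \<in> L2" "L2_norm (fourier_L1 h) \<le> L2_norm h"
proof -
  have [measurable]: "h \<in> borel_measurable borel" using h by (auto dest: borel_measurable_integrable)
  let ?w = "\<lambda>n p. exp (- (1 / real (Suc n)) * (norm (p::'a))\<^sup>2) * (cmod (fourier_L1 h p))\<^sup>2"
  have le: "(\<integral>\<^sup>+p. ennreal (?w n p) \<partial>lborel) \<le> ennreal ((L2_norm h)\<^sup>2)" for n
  proof -
    have a: "0 < 1 / real (Suc n)" by simp
    have "(LINT p|lborel. ?w n p) = cmod (complex_of_real (LINT p|lborel. ?w n p))"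
      by (simp del: of_nat_Suc) 
    also have "\<dots> \<le> (L2_norm h)\<^sup>2"
      unfolding fourier_L1_regularized[OF h a] by (rule heat_kernel_form_bound[OF h2 a])
    finally have "(LINT p|lborel. ?w n p) \<le> (L2_norm h)\<^sup>2" .
    moreover have "(\<integral>\<^sup>+p. ennreal (?w n p) \<partial>lborel) = ennreal (LINT p|lborel. ?w n p)"
      by (rule nn_integral_eq_integral[OF integrable_gaussian_fourier_L1[OF h a]]) auto
    ultimately show ?thesis by (simp only: ennreal_leI)
  qed
  have lim: "(\<lambda>n. ?w n p) \<longlonglongrightarrow> (cmod (fourier_L1 h p))\<^sup>2" for p
  proof -
    have "(\<lambda>n. exp (- (1 / real (Suc n)) * (norm p)\<^sup>2) * (cmod (fourier_L1 h p))\<^sup>2)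
        \<longlonglongrightarrow> exp (- 0 * (norm p)\<^sup>2) * (cmod (fourier_L1 h p))\<^sup>2"
      using LIMSEQ_inverse_real_of_nat by (intro tendsto_intros) (simp only: inverse_eq_divide)
    then show ?thesis by simp
  qed
  have "(\<integral>\<^sup>+p. ennreal ((cmod (fourier_L1 h p))\<^sup>2) \<partial>lborel) = (\<integral>\<^sup>+p. liminf (\<lambda>n. ennreal (?w n p)) \<partial>lborel)"
    by (intro nn_integral_cong lim_imp_Liminf[symmetric] tendsto_ennrealI lim) auto
  also have "\<dots> \<le> liminf (\<lambda>n. \<integral>\<^sup>+p. ennreal (?w n p) \<partial>lborel)"
    by (rule nn_integral_liminf) measurable
  also have "\<dots> \<le> liminf (\<lambda>n. ennreal ((L2_norm h)\<^sup>2))"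
    by (intro Liminf_mono always_eventually allI le)
  finally have "(\<integral>\<^sup>+p. ennreal ((cmod (fourier_L1 h p))\<^sup>2) \<partial>lborel) \<le> ennreal ((L2_norm h)\<^sup>2)"
    by (simp add: Liminf_const)
  from L2_I_nn_integral[OF _ this] show "fourier_L1 h \<in> L2" "L2_norm (fourier_L1 h) \<le> L2_norm h"
    by (auto intro: power2_le_imp_le)
qed

text \<open>Once the transform is known to be in \<open>L2\<close>, the cutoff is removed by
  dominated convergence and equality is kept. On the other side the heat kernels return h at its
  points of continuity, that is almost everywhere.\<close>

lemma fourier_L1_isometry_regular:
  fixes h :: "'a::euclidean_space \<Rightarrow> complex"
  assumes h: "h \<in> regular_functions"
  shows "L2_norm (fourier_L1 h) = L2_norm h"
proof -
  have [measurable]: "h \<in> borel_measurable borel" using h by (auto simp: regular_functions_def)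
  have h1: "integrable lborel h" and h2: "h \<in> L2"
    using h by (auto intro: regular_functions_integrable regular_functions_L2)
  obtain B where B: "\<And>x. cmod (h x) \<le> B" using h by (auto simp: regular_functions_def)
  have F2: "fourier_L1 h \<in> L2" by (rule fourier_L1_contraction[OF h1 h2])
  define a where "a n = 1 / real (Suc n)" for n
  have a: "0 < a n" for n by (simp add: a_def)
  have a0: "a \<longlonglongrightarrow> 0" unfolding a_def using LIMSEQ_inverse_real_of_nat by (simp only: inverse_eq_divide)
  have "(\<lambda>n. LINT p|lborel. exp (- a n * (norm (p::'a))\<^sup>2) * (cmod (fourier_L1 h p))\<^sup>2) \<longlonglongrightarrow> (LINT p|lborel. (cmod (fourier_L1 h p))\<^sup>2)"
  proof (rule integral_dominated_convergence)
    show "integrable lborel (\<lambda>p. (cmod (fourier_L1 h p))\<^sup>2)" by (rule L2_integrable[OF F2])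
    show "AE p in lborel. (\<lambda>n. exp (- a n * (norm p)\<^sup>2) * (cmod (fourier_L1 h p))\<^sup>2) \<longlonglongrightarrow> (cmod (fourier_L1 h p))\<^sup>2"
    proof (intro AE_I2)
      fix p :: 'a
      have "(\<lambda>n. exp (- a n * (norm p)\<^sup>2) * (cmod (fourier_L1 h p))\<^sup>2) \<longlonglongrightarrow> exp (- 0 * (norm p)\<^sup>2) * (cmod (fourier_L1 h p))\<^sup>2"
        by (intro tendsto_intros a0)
      then show "(\<lambda>n. exp (- a n * (norm p)\<^sup>2) * (cmod (fourier_L1 h p))\<^sup>2) \<longlonglongrightarrow> (cmod (fourier_L1 h p))\<^sup>2" by simp
    qed
    show "AE p in lborel. norm (exp (- a n * (norm p)\<^sup>2) * (cmod (fourier_L1 h p))\<^sup>2) \<le> (cmod (fourier_L1 h p))\<^sup>2" for n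
    proof (intro AE_I2)
      fix p :: 'a
      have "exp (- a n * (norm p)\<^sup>2) \<le> 1" using a[of n] by simp
      then show "norm (exp (- a n * (norm p)\<^sup>2) * (cmod (fourier_L1 h p))\<^sup>2) \<le> (cmod (fourier_L1 h p))\<^sup>2"
        by (simp add: mult_left_le_one_le)
    qed
  qed measurable
  then have lim1: "(\<lambda>n. complex_of_real (LINT p|lborel. exp (- a n * (norm (p::'a))\<^sup>2) * (cmod (fourier_L1 h p))\<^sup>2))
      \<longlonglongrightarrow> of_real ((L2_norm (fourier_L1 h))\<^sup>2)"
    unfolding L2_norm_power2 by (rule tendsto_of_real)
  define u where "u n x = (LINT y|lborel. of_real (heat_kernel (a n) (x - y)) * h y)" for n x
  \<comment> \<open>The substitution y = x - sqrt a z moves the dependence on n from the kernel into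
    the argument of h, so that one integrable majorant serves all n.\<close>
  have u_alt: "u n x = (LINT z|lborel. of_real (heat_kernel 1 z) * h (x - sqrt (a n) *\<^sub>R z))" for n x
  proof -
    have "u n x = \<bar>- sqrt (a n)\<bar> ^ DIM('a) *\<^sub>R (LINT z|lborel. of_real (heat_kernel (a n) (x - (x + (- sqrt (a n)) *\<^sub>R z))) * h (x + (- sqrt (a n)) *\<^sub>R z))"
      unfolding u_def by (rule integral_lborel_affine) (use a[of n] in auto)
    also have "\<dots> = (LINT z|lborel. of_real (sqrt (a n) ^ DIM('a) * heat_kernel (a n) (sqrt (a n) *\<^sub>R z)) * h (x - sqrt (a n) *\<^sub>R z))"
      using a[of n] by (simp add: scaleR_conv_of_real mult.assoc flip: integral_mult_right_zero)
    finally show ?thesis unfolding heat_kernel_scale[OF a] .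
  qed
  have u_meas [measurable]: "u n \<in> borel_measurable borel" for n
    unfolding u_def[abs_def] by measurable
  have int_g: "integrable lborel (\<lambda>z::'a. heat_kernel 1 z * B)" by (intro integrable_mult_left heat_kernel_integral) simp
  have dom: "cmod (of_real (heat_kernel 1 z) * h y) \<le> heat_kernel 1 z * B" for z y :: 'a
    using B[of y] by (simp add: norm_mult mult_left_mono)
  have u_bound: "cmod (u n x) \<le> B" for n x
  proof -
    have "cmod (u n x) \<le> (LINT z|lborel. heat_kernel 1 (z::'a) * B)"
      unfolding u_alt
    proof (rule integral_norm_bound_integral_lborel[OF int_g])
      show "cmod (of_real (heat_kernel 1 z) * h (x - sqrt (a n) *\<^sub>R z)) \<le> heat_kernel 1 z * B" for z
        by (rule dom)
    qed measurable
    also have "\<dots> = B" using heat_kernel_integral(2)[of 1, where 'a = 'a] by simp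
    finally show ?thesis .
  qed
  have u_lim: "(\<lambda>n. u n x) \<longlonglongrightarrow> h x" if "isCont h x" for x
  proof -
    have "(\<lambda>n. u n x) \<longlonglongrightarrow> (LINT z|lborel. of_real (heat_kernel 1 (z::'a)) * h x)"
      unfolding u_alt
    proof (rule integral_dominated_convergence[OF _ _ int_g])
      show "AE z in lborel. (\<lambda>n. of_real (heat_kernel 1 z) * h (x - sqrt (a n) *\<^sub>R z)) \<longlonglongrightarrow> of_real (heat_kernel 1 z) * h x"
      proof (intro AE_I2 tendsto_intros)
        fix z :: 'a
        have "(\<lambda>n. x - sqrt (a n) *\<^sub>R z) \<longlonglongrightarrow> x - sqrt 0 *\<^sub>R z" by (intro tendsto_intros a0)
        then show "(\<lambda>n. h (x - sqrt (a n) *\<^sub>R z)) \<longlonglongrightarrow> h x"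
          using isCont_tendsto_compose[OF that] by simp
      qed
      show "AE z in lborel. norm (of_real (heat_kernel 1 z) * h (x - sqrt (a n) *\<^sub>R z)) \<le> heat_kernel 1 z * B" for n
        by (intro AE_I2 dom)
    qed measurable
    also have "(LINT z|lborel. of_real (heat_kernel 1 (z::'a)) * h x) = h x"
      using heat_kernel_integral(2)[of 1, where 'a = 'a] by simp
    finally show ?thesis .
  qed
  have "(\<lambda>n. LINT x|lborel. cnj (h x) * u n x) \<longlonglongrightarrow> (LINT x|lborel. cnj (h x) * h x)"
  proof (rule integral_dominated_convergence)
    show "integrable lborel (\<lambda>x. cmod (h x) * B)" using h1 by auto
    have "AE x in lborel. isCont h x" using h by (auto simp: regular_functions_def)
    then show "AE x in lborel. (\<lambda>n. cnj (h x) * u n x) \<longlonglongrightarrow> cnj (h x) * h x"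
      by eventually_elim (intro tendsto_intros u_lim)
    show "AE x in lborel. norm (cnj (h x) * u n x) \<le> cmod (h x) * B" for n
      using u_bound by (intro AE_I2) (simp add: norm_mult mult_left_mono)
  qed measurable
  then have "(\<lambda>n. LINT x|lborel. cnj (h x) * u n x) \<longlonglongrightarrow> of_real ((L2_norm h)\<^sup>2)"
    unfolding L2_inner_self[symmetric] L2_inner_def .
  then have "of_real ((L2_norm (fourier_L1 h))\<^sup>2) = complex_of_real ((L2_norm h)\<^sup>2)"
    using lim1 unfolding fourier_L1_regularized[OF h1 a] u_def by (rule LIMSEQ_unique[rotated])
  then have "(L2_norm (fourier_L1 h))\<^sup>2 = (L2_norm h)\<^sup>2" by (simp only: of_real_eq_iff)
  then show ?thesis by (simp add: power2_eq_iff_nonneg)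
qed

text \<open>Partial sums of the expansion in a basis of regular functions are regular and converge
  to h. The contraction property transfers this convergence to the transforms.\<close>

lemma fourier_L1_isometry:
  fixes h :: "'a::euclidean_space \<Rightarrow> complex"
  assumes h: "integrable lborel h" and h2: "h \<in> L2"
  shows "L2_norm (fourier_L1 h) = L2_norm h"
proof -
  obtain e :: "nat \<Rightarrow> 'a \<Rightarrow> complex" where e: "L2_orthonormal_basis e" "\<And>n. e n \<in> regular_functions"
    using L2_orthonormal_basis_regular by blast
  let ?S = "\<lambda>n. L2_proj e n h"
  have S: "?S n \<in> regular_functions" for n
  proof (induction n)
    case 0
    show ?case using regular_functions_cmult[OF e(2)[of 0], of 0] by (simp add: L2_proj_def[abs_def])
  next
    case (Suc n)
    have "(\<lambda>x. L2_proj e n h x + L2_inner (e n) h * e n x) \<in> regular_functions"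
      by (rule regular_functions_add[OF Suc regular_functions_cmult[OF e(2)]])
    then show ?case by (simp add: L2_proj_def[abs_def])
  qed
  have S1: "integrable lborel (?S n)" and S2: "?S n \<in> L2" for n
    using S by (auto intro: regular_functions_integrable regular_functions_L2)
  have lim: "(\<lambda>n. L2_norm (\<lambda>x. ?S n x - h x)) \<longlonglongrightarrow> 0" by (rule L2_proj_tendsto[OF e(1) h2])
  have F: "fourier_L1 (?S n) \<in> L2" "fourier_L1 h \<in> L2" for n
    using fourier_L1_contraction(1) S1 S2 h h2 by blast+
  have "(\<lambda>n. L2_norm (\<lambda>p. fourier_L1 (?S n) p - fourier_L1 h p)) \<longlonglongrightarrow> 0"
  proof (rule tendsto_sandwich[OF _ _ tendsto_const lim])
    show "eventually (\<lambda>n. L2_norm (\<lambda>p. fourier_L1 (?S n) p - fourier_L1 h p) \<le> L2_norm (\<lambda>x. ?S n x - h x)) sequentially"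
      using fourier_L1_contraction(2)[of "\<lambda>x. ?S _ x - h x"] S1 S2 h h2
      by (intro always_eventually allI) (simp add: L2_diff fourier_L1_diff[symmetric])
  qed auto
  from L2_norm_tendsto[OF F this]
  have "(\<lambda>n. L2_norm (?S n)) \<longlonglongrightarrow> L2_norm (fourier_L1 h)"
    using fourier_L1_isometry_regular[OF S] by simp
  then show ?thesis using LIMSEQ_unique L2_norm_tendsto[OF S2 h2 lim] by blast
qed

lemma L2_Re_inner:
  assumes "g \<in> L2" "h \<in> L2"
  shows "Re (L2_inner g h) = ((L2_norm g)\<^sup>2 + (L2_norm h)\<^sup>2 - (L2_norm (\<lambda>x. g x - h x))\<^sup>2) / 2"
  using L2_norm_diff_power2[OF assms] by simp

text \<open>Polarization gives the real part; the imaginary part is the real part with h replaced by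
  -i h.\<close>

lemma fourier_L1_inner:
  fixes g h :: "'a::euclidean_space \<Rightarrow> complex"
  assumes g: "integrable lborel g" "g \<in> L2" and h: "integrable lborel h" "h \<in> L2"
  shows "L2_inner (fourier_L1 g) (fourier_L1 h) = L2_inner g h"
proof -
  have re: "Re (L2_inner (fourier_L1 g) (fourier_L1 h)) = Re (L2_inner g h)"
    if h: "integrable lborel h" "h \<in> L2" for h
    using fourier_L1_isometry[of "\<lambda>x. g x - h x"] fourier_L1_isometry[OF g] fourier_L1_isometry[OF h] g h
      fourier_L1_contraction(1)[OF g] fourier_L1_contraction(1)[OF h]
    by (simp add: L2_Re_inner L2_diff fourier_L1_diff[symmetric])
  have "Re (L2_inner (fourier_L1 g) (fourier_L1 (\<lambda>x. (- \<i>) * h x))) = Re (L2_inner g (\<lambda>x. (- \<i>) * h x))"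
    by (rule re[OF integrable_mult_right[OF h(1)] L2_cmult[OF h(2)]])
  moreover have "fourier_L1 (\<lambda>x. (- \<i>) * h x) = (\<lambda>p. (- \<i>) * fourier_L1 h p)"
    by (intro ext fourier_L1_cmult)
  ultimately have "Im (L2_inner (fourier_L1 g) (fourier_L1 h)) = Im (L2_inner g h)"
    by (simp only: L2_inner_cmult_right) simp
  with re[OF h] show ?thesis by (simp add: complex_eq_iff)
qed

section \<open>Extension of the transform to square-integrable functions\<close>

text \<open>Literally the cutoff in the definition of \<open>fourier_L2\<close>.\<close>

definition truncation :: "nat \<Rightarrow> ('a::euclidean_space \<Rightarrow> complex) \<Rightarrow> 'a \<Rightarrow> complex" where
  "truncation n h x = indicator (ball 0 (real n)) x * h x"

lemma bounded_support_L2_integrable: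
  fixes h :: "'a::euclidean_space \<Rightarrow> complex"
  assumes h: "h \<in> L2" and R: "\<And>x. R < norm x \<Longrightarrow> h x = 0"
  shows "integrable lborel h"
proof (rule Bochner_Integration.integrable_bound)
  show "integrable lborel (\<lambda>x::'a. 1 * indicator (cball 0 R) x + (cmod (h x))\<^sup>2)"
    by (intro Bochner_Integration.integrable_add integrable_indicator_cball L2_integrable[OF h])
  show "h \<in> borel_measurable lborel" using h by (simp add: L2_measurable)
  show "AE x in lborel. norm (h x) \<le> norm (1 * indicator (cball 0 R) x + (cmod (h x))\<^sup>2)"
  proof (intro AE_I2)
    fix x
    have "2 * cmod (h x) \<le> 1 + (cmod (h x))\<^sup>2"
      using zero_le_power2[of "cmod (h x) - 1"] by (simp add: power2_eq_square algebra_simps)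
    then have "cmod (h x) \<le> 1 + (cmod (h x))\<^sup>2"
      using norm_ge_zero[of "h x"] by linarith
    then show "norm (h x) \<le> norm (1 * indicator (cball 0 R) x + (cmod (h x))\<^sup>2)"
      using R[of x] by (auto split: split_indicator)
  qed
qed

lemma truncation_L2:
  assumes h: "h \<in> L2"
  shows "truncation n h \<in> L2" "integrable lborel (truncation n h)"
proof -
  have [measurable]: "h \<in> borel_measurable borel" using h by (rule L2_measurable)
  show t: "truncation n h \<in> L2"
  proof (rule L2_I_bound[OF _ L2_integrable[OF h]])
    show "truncation n h \<in> borel_measurable borel"
      unfolding truncation_def[abs_def] by (intro borel_measurable_times borel_measurable_indicator) auto
  qed (auto simp: truncation_def split: split_indicator)
  show "integrable lborel (truncation n h)"
    by (rule bounded_support_L2_integrable[OF t, of "real n"]) (auto simp: truncation_def)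
qed

lemma truncation_tendsto:
  assumes h: "h \<in> L2"
  shows "(\<lambda>n. L2_norm (\<lambda>x. truncation n h x - h x)) \<longlonglongrightarrow> 0"
proof -
  have [measurable]: "h \<in> borel_measurable borel" "truncation n h \<in> borel_measurable borel" for n
    using h truncation_L2(1)[OF h] by (auto simp: L2_measurable)
  have "(\<lambda>n. LINT x|lborel. (cmod (truncation n h x - h x))\<^sup>2) \<longlonglongrightarrow> (LINT (x::'a)|lborel. 0)"
  proof (rule integral_dominated_convergence[OF _ _ L2_integrable[OF h]])
    show "AE x in lborel. (\<lambda>n. (cmod (truncation n h x - h x))\<^sup>2) \<longlonglongrightarrow> 0"
    proof (intro AE_I2 tendsto_eventually)
      fix x :: 'a
      obtain N :: nat where N: "norm x < real N" using reals_Archimedean2 by blast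
      show "eventually (\<lambda>n. (cmod (truncation n h x - h x))\<^sup>2 = 0) sequentially"
        by (rule eventually_sequentiallyI[of N]) (use N in \<open>auto simp: truncation_def split: split_indicator\<close>)
    qed
    show "AE x in lborel. norm ((cmod (truncation n h x - h x))\<^sup>2) \<le> (cmod (h x))\<^sup>2" for n
      by (intro AE_I2) (auto simp: truncation_def split: split_indicator)
  qed measurable
  then have "(\<lambda>n. sqrt (LINT x|lborel. (cmod (truncation n h x - h x))\<^sup>2)) \<longlonglongrightarrow> sqrt 0"
    by (intro tendsto_intros) simp
  then show ?thesis by (simp add: L2_norm_def)
qed

text \<open>The transforms of the truncations are Cauchy because the truncations are, so
  \<open>fourier_L2\<close> chooses from a nonempty set.\<close>

lemma fourier_L2:
  fixes h :: "'a::euclidean_space \<Rightarrow> complex"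
  assumes h: "h \<in> L2"
  shows "fourier_L2 h \<in> L2"
    and "(\<lambda>n. L2_norm (\<lambda>p. fourier_L1 (truncation n h) p - fourier_L2 h p)) \<longlonglongrightarrow> 0"
proof -
  note t = truncation_L2[OF h]
  have F: "fourier_L1 (truncation n h) \<in> L2" for n by (rule fourier_L1_contraction(1)[OF t(2) t(1)])
  have F_diff: "L2_norm (\<lambda>p. fourier_L1 (truncation m h) p - fourier_L1 (truncation n h) p) = L2_norm (\<lambda>x. truncation m h x - truncation n h x)" for m n
    using fourier_L1_isometry[of "\<lambda>x. truncation m h x - truncation n h x"] t by (simp add: L2_diff fourier_L1_diff[symmetric])
  have "\<exists>N. \<forall>m\<ge>N. \<forall>n\<ge>N. L2_norm (\<lambda>p. fourier_L1 (truncation m h) p - fourier_L1 (truncation n h) p) < d" if d: "0 < d" for d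
  proof -
    obtain N where N: "\<And>n. N \<le> n \<Longrightarrow> L2_norm (\<lambda>x. truncation n h x - h x) < d / 2"
      using order_tendstoD(2)[OF truncation_tendsto[OF h], of "d / 2"] d by (auto simp: eventually_sequentially)
    have "L2_norm (\<lambda>x. truncation m h x - truncation n h x) < d" if "N \<le> m" "N \<le> n" for m n
      using L2_norm_triangle_diff[OF t(1)[of m] h t(1)[of n]] N[OF that(1)] N[OF that(2)]
        L2_norm_minus_commute[of h "truncation n h"] by linarith
    then show ?thesis unfolding F_diff by blast
  qed
  then obtain g where g: "g \<in> L2" "(\<lambda>n. L2_norm (\<lambda>p. fourier_L1 (truncation n h) p - g p)) \<longlonglongrightarrow> 0"
    using L2_complete[of "\<lambda>n. fourier_L1 (truncation n h)"] F by blast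
  have conv: "(\<lambda>n. \<integral>\<^sup>+p. ennreal ((cmod (fourier_L1 (\<lambda>x. indicator (ball 0 (real n)) x * h x) p - g p))\<^sup>2) \<partial>lborel) \<longlonglongrightarrow> 0
      \<longleftrightarrow> (\<lambda>n. L2_norm (\<lambda>p. fourier_L1 (truncation n h) p - g p)) \<longlonglongrightarrow> 0" if g: "g \<in> L2" for g
  proof -
    have eq: "(\<integral>\<^sup>+p. ennreal ((cmod (fourier_L1 (\<lambda>x. indicator (ball 0 (real n)) x * h x) p - g p))\<^sup>2) \<partial>lborel)
        = ennreal ((L2_norm (\<lambda>p. fourier_L1 (truncation n h) p - g p))\<^sup>2)" for n
      unfolding truncation_def[symmetric] by (rule nn_integral_L2[OF L2_diff[OF F g]])
    have "(\<lambda>n. ennreal ((L2_norm (\<lambda>p. fourier_L1 (truncation n h) p - g p))\<^sup>2)) \<longlonglongrightarrow> ennreal 0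
        \<longleftrightarrow> (\<lambda>n. (L2_norm (\<lambda>p. fourier_L1 (truncation n h) p - g p))\<^sup>2) \<longlonglongrightarrow> 0"
      by (rule tendsto_ennreal_iff) auto
    also have "\<dots> \<longleftrightarrow> (\<lambda>n. L2_norm (\<lambda>p. fourier_L1 (truncation n h) p - g p)) \<longlonglongrightarrow> 0"
    proof
      assume "(\<lambda>n. (L2_norm (\<lambda>p. fourier_L1 (truncation n h) p - g p))\<^sup>2) \<longlonglongrightarrow> 0"
      from tendsto_real_sqrt[OF this] show "(\<lambda>n. L2_norm (\<lambda>p. fourier_L1 (truncation n h) p - g p)) \<longlonglongrightarrow> 0"
        by simp
    next
      assume "(\<lambda>n. L2_norm (\<lambda>p. fourier_L1 (truncation n h) p - g p)) \<longlonglongrightarrow> 0"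
      from tendsto_power[OF this, of 2] show "(\<lambda>n. (L2_norm (\<lambda>p. fourier_L1 (truncation n h) p - g p))\<^sup>2) \<longlonglongrightarrow> 0"
        by simp
    qed
    finally show ?thesis unfolding eq by simp
  qed
  have "\<exists>g. g \<in> L2 \<and> (\<lambda>n. \<integral>\<^sup>+p. ennreal ((cmod (fourier_L1 (\<lambda>x. indicator (ball 0 (real n)) x * h x) p - g p))\<^sup>2) \<partial>lborel) \<longlonglongrightarrow> 0"
    using g conv by blast
  from someI_ex[OF this] show "fourier_L2 h \<in> L2" "(\<lambda>n. L2_norm (\<lambda>p. fourier_L1 (truncation n h) p - fourier_L2 h p)) \<longlonglongrightarrow> 0"
    using conv unfolding fourier_L2_def by blast+
qed

lemma L2_inner_tendsto:
  assumes g: "\<And>n. g n \<in> L2" "g' \<in> L2" "(\<lambda>n. L2_norm (\<lambda>x. g n x - g' x)) \<longlonglongrightarrow> 0"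
    and h: "\<And>n. h n \<in> L2" "h' \<in> L2" "(\<lambda>n. L2_norm (\<lambda>x. h n x - h' x)) \<longlonglongrightarrow> 0"
  shows "(\<lambda>n. L2_inner (g n) (h n)) \<longlonglongrightarrow> L2_inner g' h'"
proof -
  have "(\<lambda>n. L2_inner (\<lambda>x. g n x - g' x) (h n)) \<longlonglongrightarrow> 0"
  proof (rule Lim_null_comparison)
    show "eventually (\<lambda>n. norm (L2_inner (\<lambda>x. g n x - g' x) (h n)) \<le> L2_norm (\<lambda>x. g n x - g' x) * L2_norm (h n)) sequentially"
      using L2_Cauchy_Schwarz[OF L2_diff[OF g(1,2)] h(1)] by (intro always_eventually) blast
    show "(\<lambda>n. L2_norm (\<lambda>x. g n x - g' x) * L2_norm (h n)) \<longlonglongrightarrow> 0"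
      using tendsto_mult[OF g(3) L2_norm_tendsto[OF h]] by simp
  qed
  from tendsto_add[OF this L2_inner_tendsto_right[OF h(1,2) g(2) h(3)]] show ?thesis
    using g h by (simp add: L2_inner_diff_left)
qed

lemma fourier_L2_inner:
  assumes g: "g \<in> L2" and h: "h \<in> L2"
  shows "L2_inner (fourier_L2 g) (fourier_L2 h) = L2_inner g h"
proof (rule LIMSEQ_unique)
  have F: "fourier_L1 (truncation n f) \<in> L2" if "f \<in> L2" for n and f :: "'a \<Rightarrow> complex"
    by (rule fourier_L1_contraction(1)) (rule truncation_L2[OF that])+
  show "(\<lambda>n. L2_inner (fourier_L1 (truncation n g)) (fourier_L1 (truncation n h))) \<longlonglongrightarrow> L2_inner (fourier_L2 g) (fourier_L2 h)"
    by (intro L2_inner_tendsto F fourier_L2 g h)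
  show "(\<lambda>n. L2_inner (fourier_L1 (truncation n g)) (fourier_L1 (truncation n h))) \<longlonglongrightarrow> L2_inner g h"
    unfolding fourier_L1_inner[OF truncation_L2(2,1)[OF g] truncation_L2(2,1)[OF h]]
    by (intro L2_inner_tendsto truncation_L2 truncation_tendsto g h)
qed

lemma fourier_L2_norm:
  assumes "h \<in> L2"
  shows "L2_norm (fourier_L2 h) = L2_norm h"
proof -
  have "(L2_norm (fourier_L2 h))\<^sup>2 = (L2_norm h)\<^sup>2"
    using fourier_L2_inner[OF assms assms] unfolding L2_inner_self by (simp only: of_real_eq_iff)
  then show ?thesis by (simp add: power2_eq_iff_nonneg)
qed

text \<open>The truncations are eventually equal to h. The functions to which functions of the
  Laplacian are applied below are cut off by \<open>s\<close> or by f, so their transform is given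
  by the integral.\<close>

lemma fourier_L2_bounded_support:
  fixes h :: "'a::euclidean_space \<Rightarrow> complex"
  assumes h: "h \<in> L2" and R: "\<And>x. R < norm x \<Longrightarrow> h x = 0"
  shows "AE p in lborel. fourier_L2 h p = fourier_L1 h p"
proof -
  have h1: "integrable lborel h" by (rule bounded_support_L2_integrable[OF h R])
  have F: "fourier_L1 h \<in> L2" by (rule fourier_L1_contraction(1)[OF h1 h])
  obtain N :: nat where N: "R < real N" using reals_Archimedean2 by blast
  have "truncation n h = h" if "N \<le> n" for n
  proof
    fix x show "truncation n h x = h x"
      using R[of x] N that by (cases "norm x < real n") (auto simp: truncation_def)
  qed
  then have "eventually (\<lambda>n. L2_norm (\<lambda>p. fourier_L1 (truncation n h) p - fourier_L2 h p) = L2_norm (\<lambda>p. fourier_L1 h p - fourier_L2 h p)) sequentially"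
    by (intro eventually_sequentiallyI[of N]) simp
  from tendsto_eventually[OF this] have "L2_norm (\<lambda>p. fourier_L1 h p - fourier_L2 h p) = 0"
    using fourier_L2(2)[OF h] LIMSEQ_unique by blast
  then have "AE p in lborel. fourier_L1 h p - fourier_L2 h p = 0"
    using L2_norm_eq_0_iff[OF L2_diff[OF F fourier_L2(1)[OF h]]] by simp
  then show ?thesis by eventually_elim simp
qed

lemma L2_reflect:
  fixes h :: "'a::euclidean_space \<Rightarrow> complex"
  assumes h: "h \<in> L2"
  shows "(\<lambda>x. h (- x)) \<in> L2" "L2_norm (\<lambda>x. h (- x)) = L2_norm h"
proof -
  have [measurable]: "h \<in> borel_measurable borel" using h by (rule L2_measurable)
  have "integrable lborel (\<lambda>x. (cmod (h (0 + (-1) *\<^sub>R x)))\<^sup>2)"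
    by (rule integrable_lborel_affine[OF L2_integrable[OF h]]) simp
  then show "(\<lambda>x. h (- x)) \<in> L2" by (intro L2_I) auto
  have "(LINT x|lborel. (cmod (h x))\<^sup>2) = \<bar>- 1\<bar> ^ DIM('a) *\<^sub>R (LINT x|lborel. (cmod (h (0 + (-1) *\<^sub>R x)))\<^sup>2)"
    by (rule integral_lborel_affine) auto
  then show "L2_norm (\<lambda>x. h (- x)) = L2_norm h" by (simp add: L2_norm_def)
qed

text \<open>Conjugating the kernel exp (- i p x) gives that of the reflected transform.\<close>

lemma fourier_L1_adjoint:
  fixes g h :: "'a::euclidean_space \<Rightarrow> complex"
  assumes g: "integrable lborel g" and h: "integrable lborel h"
  shows "L2_inner (fourier_L1 g) h = L2_inner g (\<lambda>x. fourier_L1 h (- x))"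
proof -
  define c where "c = complex_of_real ((2 * pi) powr (- real DIM('a) / 2))"
  have gc: "integrable lborel (\<lambda>x. cnj (g x))" using g by simp
  have "L2_inner (fourier_L1 g) h = (LINT p|lborel. c * (h p * (LINT x|lborel. exp (\<i> * of_real (p \<bullet> x)) * cnj (g x))))"
    unfolding L2_inner_def
  proof (intro Bochner_Integration.integral_cong refl)
    fix p
    have "cnj (fourier_L1 g p) = c * (LINT x|lborel. exp (\<i> * of_real (p \<bullet> x)) * cnj (g x))"
      unfolding fourier_L1_def c_def complex_cnj_mult
      by (simp flip: Bochner_Integration.integral_cnj add: exp_cnj)
    then show "cnj (fourier_L1 g p) * h p = c * (h p * (LINT x|lborel. exp (\<i> * of_real (p \<bullet> x)) * cnj (g x)))"
      by simp
  qed
  also have "\<dots> = c * (LINT x|lborel. cnj (g x) * (LINT p|lborel. exp (\<i> * of_real (p \<bullet> x)) * h p))"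
    by (subst lborel_kernel_swap[OF h gc, of "\<lambda>(p::'a) x. exp (\<i> * of_real (p \<bullet> x))" 1, symmetric])
       (auto simp: norm_exp_eq_Re)
  also have "\<dots> = (LINT x|lborel. cnj (g x) * (c * (LINT p|lborel. exp (\<i> * of_real (p \<bullet> x)) * h p)))"
    by (simp add: mult.left_commute[of _ c] flip: integral_mult_right_zero)
  also have "\<dots> = L2_inner g (\<lambda>x. fourier_L1 h (- x))"
    unfolding L2_inner_def fourier_L1_def c_def by (simp add: inner_commute)
  finally show ?thesis .
qed

lemma fourier_L2_adjoint:
  fixes g h :: "'a::euclidean_space \<Rightarrow> complex"
  assumes g: "g \<in> L2" and h: "h \<in> L2"
  shows "L2_inner (fourier_L2 g) h = L2_inner g (\<lambda>x. fourier_L2 h (- x))"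
proof (rule LIMSEQ_unique)
  have F: "fourier_L1 (truncation n f) \<in> L2" if "f \<in> L2" for n and f :: "'a \<Rightarrow> complex"
    by (rule fourier_L1_contraction(1)) (rule truncation_L2[OF that])+
  show "(\<lambda>n. L2_inner (fourier_L1 (truncation n g)) (truncation n h)) \<longlonglongrightarrow> L2_inner (fourier_L2 g) h"
    by (intro L2_inner_tendsto F fourier_L2 truncation_L2 truncation_tendsto g h)
  have "L2_norm (\<lambda>x. fourier_L1 (truncation n h) (- x) - fourier_L2 h (- x)) = L2_norm (\<lambda>x. fourier_L1 (truncation n h) x - fourier_L2 h x)" for n
    by (rule L2_reflect(2)[OF L2_diff[OF F[OF h] fourier_L2(1)[OF h]]])
  then have lim: "(\<lambda>n. L2_norm (\<lambda>x. fourier_L1 (truncation n h) (- x) - fourier_L2 h (- x))) \<longlonglongrightarrow> 0"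
    using fourier_L2(2)[OF h] by simp
  show "(\<lambda>n. L2_inner (fourier_L1 (truncation n g)) (truncation n h)) \<longlonglongrightarrow> L2_inner g (\<lambda>x. fourier_L2 h (- x))"
    unfolding fourier_L1_adjoint[OF truncation_L2(2)[OF g] truncation_L2(2)[OF h]]
    by (intro L2_inner_tendsto truncation_L2 truncation_tendsto L2_reflect(1) F fourier_L2 g h lim)
qed

text \<open>The transform and its reflection are both isometric and adjoint to each other, so each inverts
  the other; no inversion formula is required.\<close>

lemma fourier_L2_surj:
  fixes g :: "'a::euclidean_space \<Rightarrow> complex"
  assumes g: "g \<in> L2"
  obtains f where "f \<in> L2" "AE p in lborel. fourier_L2 f p = g p"
proof -
  define f where "f = (\<lambda>x. fourier_L2 g (- x))"
  have f: "f \<in> L2" "L2_norm f = L2_norm g"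
    unfolding f_def using L2_reflect[OF fourier_L2(1)[OF g]] fourier_L2_norm[OF g] by auto
  have "L2_inner (fourier_L2 f) g = L2_inner f f"
    unfolding fourier_L2_adjoint[OF f(1) g] by (simp add: f_def)
  then have "(L2_norm (\<lambda>p. fourier_L2 f p - g p))\<^sup>2 = 0"
    using L2_norm_diff_power2[OF fourier_L2(1)[OF f(1)] g] fourier_L2_norm[OF f(1)] f(2)
    by (simp add: L2_inner_self)
  then have "AE p in lborel. fourier_L2 f p - g p = 0"
    using L2_norm_eq_0_iff[OF L2_diff[OF fourier_L2(1)[OF f(1)] g]] by simp
  then have "AE p in lborel. fourier_L2 f p = g p" by eventually_elim simp
  with f(1) that show ?thesis by blast
qed

text \<open>The choice is made from a nonempty set because the transform is onto.\<close>

lemma fun_laplacian: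
  fixes h :: "'a::euclidean_space \<Rightarrow> complex"
  assumes "(\<lambda>p. of_real (\<phi> (- (norm p)\<^sup>2)) * fourier_L2 h p) \<in> L2"
  shows "fun_laplacian \<phi> h \<in> L2"
    and "AE p in lborel. fourier_L2 (fun_laplacian \<phi> h) p = of_real (\<phi> (- (norm p)\<^sup>2)) * fourier_L2 h p"
proof -
  obtain f where "f \<in> L2" "AE p in lborel. fourier_L2 f p = of_real (\<phi> (- (norm p)\<^sup>2)) * fourier_L2 h p"
    using fourier_L2_surj[OF assms] by blast
  then have "\<exists>g. g \<in> L2 \<and> (AE p in lborel. fourier_L2 g p = of_real (\<phi> (- (norm p)\<^sup>2)) * fourier_L2 h p)" by blast
  from someI_ex[OF this] show "fun_laplacian \<phi> h \<in> L2"
    "AE p in lborel. fourier_L2 (fun_laplacian \<phi> h) p = of_real (\<phi> (- (norm p)\<^sup>2)) * fourier_L2 h p"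
    unfolding fun_laplacian_def by blast+
qed

section \<open>The kernel of \<open>G(1-G)\<^sup>-\<^sup>1\<close>\<close>

text \<open>Symbol of G(1-G)^-1, the Bose-Einstein distribution. At p = 0 division by zero gives the
  value 0.\<close>

definition occupation :: "real \<Rightarrow> 'a::euclidean_space \<Rightarrow> real" where
  "occupation \<beta> p = 1 / (exp (\<beta> * (norm p)\<^sup>2) - 1)"

text \<open>G(1-G)^-1 is the sum of the powers G^n over n >= 1, and G^n is the heat semigroup at
  time \<beta> n.\<close>

definition bose_kernel :: "real \<Rightarrow> 'a::euclidean_space \<Rightarrow> real" where
  "bose_kernel \<beta> z = (\<Sum>n. heat_kernel (\<beta> * real (Suc n)) z)"

lemma occupation_measurable [measurable]: "occupation \<beta> \<in> borel_measurable borel"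
  unfolding occupation_def[abs_def] by measurable

lemma heat_kernel_le_0: "0 < a \<Longrightarrow> heat_kernel a (z::'a::euclidean_space) \<le> heat_kernel a (0::'a)"
  unfolding heat_kernel_def by (intro mult_left_mono) auto

lemma heat_kernel_at_infinity:
  assumes "0 < a"
  shows "(heat_kernel a \<longlongrightarrow> 0) (at_infinity :: 'a::euclidean_space filter)"
proof -
  have "filterlim (\<lambda>z::'a. (1 / (4 * a)) * (norm z)\<^sup>2) at_top at_infinity"
    using assms by (intro filterlim_tendsto_pos_mult_at_top[OF tendsto_const] filterlim_pow_at_top filterlim_norm_at_top) auto
  then have "((\<lambda>z::'a. exp (- ((1 / (4 * a)) * (norm z)\<^sup>2))) \<longlongrightarrow> 0) at_infinity"
    by (intro filterlim_compose[OF exp_at_bot] filterlim_compose[OF filterlim_uminus_at_bot_at_top])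
  then have "((\<lambda>z::'a. (1 / sqrt (4 * pi * a)) ^ DIM('a) * exp (- ((1 / (4 * a)) * (norm z)\<^sup>2))) \<longlongrightarrow> (1 / sqrt (4 * pi * a)) ^ DIM('a) * 0) at_infinity"
    by (intro tendsto_intros)
  then show ?thesis by (simp add: heat_kernel_def[abs_def])
qed

locale bose =
  fixes \<beta> :: real and dimension :: "'a::euclidean_space itself"
  assumes beta_pos: "0 < \<beta>" and dim_gt_2: "2 < DIM('a)"
begin

abbreviation A :: "'a \<Rightarrow> real" where "A \<equiv> bose_kernel \<beta>"
abbreviation occ :: "'a \<Rightarrow> real" where "occ \<equiv> occupation \<beta>"
abbreviation rho_c :: real where "rho_c \<equiv> critical_density dimension \<beta>"
abbreviation temp :: "nat \<Rightarrow> real" where "temp n \<equiv> \<beta> * real (Suc n)"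

lemma temp_pos: "0 < temp n" using beta_pos by simp

lemma occ_nonneg: "0 \<le> occ p"
  using beta_pos by (simp add: occupation_def)

text \<open>Here d > 2 enters: the values at the origin are a multiple of n^(-d/2).\<close>

lemma summable_heat_kernel_0: "summable (\<lambda>n. heat_kernel (temp n) (0::'a))"
proof -
  have "summable (\<lambda>n. of_nat n powr (- real DIM('a) / 2) :: real)"
    unfolding summable_real_powr_iff using dim_gt_2 by simp
  then have "summable (\<lambda>n. real (Suc n) powr (- real DIM('a) / 2))" by (subst summable_Suc_iff)
  then have "summable (\<lambda>n. (1 / sqrt (4 * pi * \<beta>)) ^ DIM('a) * real (Suc n) powr (- real DIM('a) / 2))"
    by (rule summable_mult)
  moreover have "heat_kernel (temp n) (0::'a) = (1 / sqrt (4 * pi * \<beta>)) ^ DIM('a) * real (Suc n) powr (- real DIM('a) / 2)" for n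
  proof -
    have "real (Suc n) powr (- real DIM('a) / 2) = (real (Suc n) powr (- 1 / 2)) powr real DIM('a)"
      by (simp only: powr_powr) simp
    also have "\<dots> = (1 / sqrt (real (Suc n))) ^ DIM('a)"
      by (subst powr_realpow) (simp_all add: powr_minus_divide powr_half_sqrt)
    finally have "real (Suc n) powr (- real DIM('a) / 2) = (1 / sqrt (real (Suc n))) ^ DIM('a)" .
    moreover have "(1 / sqrt (4 * pi * (\<beta> * m))) ^ DIM('a) = (1 / sqrt (4 * pi * \<beta>)) ^ DIM('a) * (1 / sqrt m) ^ DIM('a)" for m
      by (simp add: power_mult_distrib[symmetric] real_sqrt_mult mult.assoc)
    ultimately show ?thesis
      unfolding heat_kernel_def by (simp only: norm_zero) simp
  qed
  ultimately show ?thesis by simp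
qed

lemma norm_heat_kernel_le: "norm (heat_kernel (temp n) (z::'a)) \<le> heat_kernel (temp n) (0::'a)"
  using heat_kernel_le_0[OF temp_pos, of n z] heat_kernel_nonneg[OF temp_pos, of n z] by simp

lemma summable_heat_kernel: "summable (\<lambda>n. heat_kernel (temp n) (z::'a))"
  by (rule summable_comparison_test'[OF summable_heat_kernel_0 norm_heat_kernel_le])

lemma A_nonneg: "0 \<le> A z"
  unfolding bose_kernel_def by (rule suminf_nonneg[OF summable_heat_kernel]) (rule heat_kernel_nonneg[OF temp_pos])

lemma A_le: "A z \<le> A 0"
  unfolding bose_kernel_def
  by (intro suminf_le summable_heat_kernel heat_kernel_le_0 temp_pos)

lemma A_measurable [measurable]: "A \<in> borel_measurable borel"
  unfolding bose_kernel_def[abs_def] by measurable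

text \<open>The values at the origin are summable majorants, so the limit may be taken term by
  term.\<close>

lemma A_at_infinity: "(A \<longlongrightarrow> 0) at_infinity"
proof -
  have "((\<lambda>z::'a. suminf (\<lambda>n. heat_kernel (temp n) z)) \<longlongrightarrow> suminf (\<lambda>n. 0)) at_infinity"
  proof (rule tannerys_theorem[THEN conjunct2, THEN conjunct2])
    show "((\<lambda>z::'a. heat_kernel (temp n) z) \<longlongrightarrow> 0) at_infinity" for n
      by (rule heat_kernel_at_infinity[OF temp_pos])
    show "eventually (\<lambda>(n, z::'a). norm (heat_kernel (temp n) z) \<le> heat_kernel (temp n) (0::'a)) (at_top \<times>\<^sub>F at_infinity)"
      using norm_heat_kernel_le by (intro always_eventually) auto
  qed (rule summable_heat_kernel_0 | simp add: trivial_limit_at_infinity)+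
  then show ?thesis by (simp add: bose_kernel_def[abs_def])
qed

lemma gaussian_sums_occ:
  assumes "(p::'a) \<noteq> 0"
  shows "(\<lambda>n. exp (- temp n * (norm p)\<^sup>2)) sums occ p"
proof -
  define x where "x = \<beta> * (norm p)\<^sup>2"
  have x: "0 < x" using assms beta_pos by (simp add: x_def)
  have "(\<lambda>n. exp (- x) * exp (- x) ^ n) sums (exp (- x) * (1 / (1 - exp (- x))))"
    using x by (intro sums_mult geometric_sums) simp
  moreover have "exp (- x) * (1 / (1 - exp (- x))) = occ p"
  proof -
    have "exp x - 1 \<noteq> 0" "1 - exp (- x) \<noteq> 0" using x by auto
    then show ?thesis unfolding occupation_def x_def[symmetric] by (simp add: field_simps exp_minus)
  qed
  moreover have "exp (- x) * exp (- x) ^ n = exp (- temp n * (norm p)\<^sup>2)" for n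
    by (simp add: x_def exp_of_nat_mult[symmetric] exp_add[symmetric] algebra_simps)
  ultimately show ?thesis by simp
qed

lemma gaussian_series_integrals: "summable (\<lambda>n. LINT p|lborel. exp (- temp n * (norm (p::'a))\<^sup>2))"
proof -
  have "(LINT p|lborel. exp (- temp n * (norm (p::'a))\<^sup>2)) = (2 * pi) ^ DIM('a) * heat_kernel (temp n) (0::'a)" for n
    using inverse_fourier_weight_gaussian[OF temp_pos, of n "0::'a"]
    by (simp add: inverse_fourier_weight_def field_simps flip: of_real_power of_real_mult of_real_divide)
  then show ?thesis using summable_heat_kernel_0 by (simp add: summable_mult)
qed

lemma AE_nonzero: "AE p in lborel. (p::'a) \<noteq> 0"
  by (rule AE_lborel_singleton)

text \<open>The geometric series for \<open>occ\<close> is integrated term by term against a plane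
  wave; the origin, where the series diverges, is a null set. The case \<open>z = 0\<close> also
  yields the integrability of \<open>occ\<close>.\<close>

lemma gaussian_series:
  fixes z :: 'a
  defines "F \<equiv> \<lambda>n p. complex_of_real (exp (- temp n * (norm (p::'a))\<^sup>2)) * exp (\<i> * of_real (p \<bullet> z))"
  shows "integrable lborel (\<lambda>p. \<Sum>n. F n p)" "(\<lambda>n. LINT p|lborel. F n p) sums (LINT p|lborel. (\<Sum>n. F n p))"
    "AE p in lborel. (\<Sum>n. F n p) = of_real (occ p) * exp (\<i> * of_real (p \<bullet> z))"
proof -
  have int: "integrable lborel (F n)" for n
    unfolding F_def
    by (rule Bochner_Integration.integrable_bound[OF gaussian_fourier(1)[OF temp_pos[of n]]]) (auto simp: norm_mult norm_exp_eq_Re)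
  have nF: "norm (F n p) = exp (- temp n * (norm p)\<^sup>2)" for n p
    by (simp add: F_def norm_mult norm_exp_eq_Re)
  have sm: "AE p in lborel. summable (\<lambda>n. norm (F n p))"
    using AE_nonzero by eventually_elim (unfold nF, rule sums_summable[OF gaussian_sums_occ])
  have si: "summable (\<lambda>n. LINT p|lborel. norm (F n p))"
    unfolding nF by (rule gaussian_series_integrals)
  show "integrable lborel (\<lambda>p. \<Sum>n. F n p)" "(\<lambda>n. LINT p|lborel. F n p) sums (LINT p|lborel. (\<Sum>n. F n p))"
    using integrable_suminf[OF int sm si] sums_integral[OF int sm si] by auto
  show "AE p in lborel. (\<Sum>n. F n p) = of_real (occ p) * exp (\<i> * of_real (p \<bullet> z))"
    using AE_nonzero
  proof eventually_elim
    fix p :: 'a assume "p \<noteq> 0"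
    from sums_mult2[OF sums_of_real[OF gaussian_sums_occ[OF this]]]
    show "(\<Sum>n. F n p) = of_real (occ p) * exp (\<i> * of_real (p \<bullet> z))"
      unfolding F_def by (rule sums_unique[symmetric])
  qed
qed

lemma occ_integrable: "integrable lborel occ"
proof -
  have "integrable lborel (\<lambda>p::'a. complex_of_real (occ p) * exp (\<i> * of_real (p \<bullet> 0)))"
    using gaussian_series(1,3)[of 0] by (subst integrable_cong_AE[THEN iffD1]) auto
  then show ?thesis by (simp add: complex_of_real_integrable_eq)
qed

lemma inverse_fourier_weight_occ: "inverse_fourier_weight occ z = of_real (A z)"
proof -
  let ?F = "\<lambda>n p. complex_of_real (exp (- temp n * (norm (p::'a))\<^sup>2)) * exp (\<i> * of_real (p \<bullet> z))"
  have "(LINT p|lborel. (\<Sum>n. ?F n p)) = (LINT p|lborel. of_real (occ p) * exp (\<i> * of_real (p \<bullet> z)))"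
    by (rule integral_cong_AE) (use gaussian_series(1,3)[of z] in \<open>auto dest: borel_measurable_integrable\<close>)
  with sums_divide[OF gaussian_series(2)[of z], of "of_real ((2 * pi) ^ DIM('a))"]
  have "(\<lambda>n. inverse_fourier_weight (\<lambda>p. exp (- temp n * (norm p)\<^sup>2)) z) sums inverse_fourier_weight occ z"
    by (simp only: inverse_fourier_weight_def)
  then have "(\<lambda>n. complex_of_real (heat_kernel (temp n) z)) sums inverse_fourier_weight occ z"
    unfolding inverse_fourier_weight_gaussian[OF temp_pos] .
  moreover have "(\<lambda>n. complex_of_real (heat_kernel (temp n) z)) sums of_real (A z)"
    unfolding bose_kernel_def by (intro sums_of_real summable_sums summable_heat_kernel)
  ultimately show ?thesis by (rule sums_unique2)
qed

lemma rho_c_eq: "rho_c = A 0"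
proof -
  have "complex_of_real (A 0) = of_real (LINT p|lborel. occ p) / of_real ((2 * pi) ^ DIM('a))"
    unfolding inverse_fourier_weight_occ[symmetric] inverse_fourier_weight_def by simp
  then have "A 0 = (LINT p|lborel. occ p) / (2 * pi) ^ DIM('a)"
    by (simp only: of_real_divide[symmetric] of_real_eq_iff)
  also have "\<dots> = (LINT p|lborel. occ p / (2 * pi) ^ DIM('a))" by simp
  finally show ?thesis unfolding critical_density_def occupation_def by simp
qed

lemma rho_c_nonneg: "0 \<le> rho_c"
  unfolding rho_c_eq by (rule A_nonneg)

lemma A_bounds: "0 \<le> A z" "A z \<le> rho_c" "\<bar>A z\<bar> \<le> rho_c"
  using A_nonneg[of z] A_le[of z] by (auto simp: rho_c_eq)

end

lemma laplacian_symbol_eq: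
  "sqrt (exp (\<beta> * - (norm p)\<^sup>2) / (1 - exp (\<beta> * - (norm p)\<^sup>2))) = sqrt (occupation \<beta> p)"
proof -
  define x where "x = \<beta> * (norm p)\<^sup>2"
  have "exp (- x) / (1 - exp (- x)) = 1 / (exp x - 1)"
    \<comment> \<open>At \<open>x = 0\<close> both sides are 0 by the convention on
      division.\<close>
    by (cases "x = 0") (simp_all add: exp_minus field_simps)
  then show ?thesis by (simp add: occupation_def x_def)
qed

section \<open>The operator K: kernel, factorization and norms\<close>

text \<open>\<open>s\<close> stands for sqrt (1 - exp (- f)) with a test function f, and
  \<open>R\<close> for a radius outside which it vanishes.\<close>

locale bose_region = bose \<beta> dimension for \<beta> and dimension :: "'a::euclidean_space itself" +
  fixes s :: "'a \<Rightarrow> real" and R :: real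
  assumes s_meas [measurable]: "s \<in> borel_measurable borel"
    and s_nonneg: "0 \<le> s x" and s_le_1: "s x \<le> 1" and s_supp: "R < norm x \<Longrightarrow> s x = 0"
begin

definition sm :: "('a \<Rightarrow> complex) \<Rightarrow> 'a \<Rightarrow> complex" where
  "sm h x = of_real (s x) * h x"

definition kern :: "'a \<Rightarrow> 'a \<Rightarrow> real" where
  "kern x y = s x * A (x - y) * s y"

definition K :: "('a \<Rightarrow> complex) \<Rightarrow> 'a \<Rightarrow> complex" where
  "K h x = (LINT y|lborel. of_real (kern x y) * h y)"

text \<open>\<open>Wf\<close> is \<open>W\<^sub>f\<close> followed by the Fourier transform, so that \<open>K = Wf\<^sup>* Wf\<close>; it needs no extension of the
  transform to \<open>L\<^sup>2\<close>, since \<open>sm h\<close> is integrable.\<close>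

definition Wf :: "('a \<Rightarrow> complex) \<Rightarrow> 'a \<Rightarrow> complex" where
  "Wf h p = of_real (sqrt (occ p)) * fourier_L1 (sm h) p"

definition S2 :: real where "S2 = (LINT x|lborel. (s x)\<^sup>2)"

text \<open>The square of the Hilbert-Schmidt norm of \<open>K\<close>; accordingly
  \<open>sqrt HS\<close> bounds the operator norm.\<close>

definition HS :: real where "HS = (LINT x|lborel. (LINT y|lborel. (kern x y)\<^sup>2))"

lemma kern_meas [measurable]: "(\<lambda>(x, y). kern x y) \<in> borel_measurable (borel \<Otimes>\<^sub>M borel)"
  unfolding kern_def[abs_def] split_beta' by measurable

lemma kern_nonneg: "0 \<le> kern x y"
  by (simp add: kern_def s_nonneg A_nonneg)

lemma kern_bound: "kern x y \<le> rho_c * (indicator (cball 0 R) x * indicator (cball 0 R) y)"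
proof (cases "R < norm x \<or> R < norm y")
  case True
  then have "kern x y = 0" using s_supp by (auto simp: kern_def)
  then show ?thesis using rho_c_nonneg by simp
next
  case False
  have "s x * A (x - y) * s y \<le> 1 * rho_c * 1"
    by (intro mult_mono s_le_1 s_nonneg A_bounds mult_nonneg_nonneg rho_c_nonneg) auto
  then show ?thesis using False by (simp add: kern_def)
qed

lemma sm_L2:
  assumes h: "h \<in> L2"
  shows "sm h \<in> L2" "integrable lborel (sm h)" "R < norm x \<Longrightarrow> sm h x = 0"
proof -
  have [measurable]: "h \<in> borel_measurable borel" using h by (rule L2_measurable)
  show L: "sm h \<in> L2"
  proof (rule L2_I_bound[OF _ L2_integrable[OF h]])
    show "sm h \<in> borel_measurable borel" unfolding sm_def[abs_def] by measurable
    show "(cmod (sm h x))\<^sup>2 \<le> (cmod (h x))\<^sup>2" for x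
      using s_nonneg[of x] s_le_1[of x] by (intro power_mono) (auto simp: sm_def norm_mult intro: mult_left_le_one_le)
  qed
  show "R < norm x \<Longrightarrow> sm h x = 0" for x by (simp add: sm_def s_supp)
  then show "integrable lborel (sm h)" by (rule bounded_support_L2_integrable[OF L])
qed

lemma s_L2: "(\<lambda>x. of_real (s x)) \<in> L2" "integrable lborel (\<lambda>x. (s x)\<^sup>2)"
proof -
  show L: "(\<lambda>x. complex_of_real (s x)) \<in> L2"
    by (rule bounded_support_integrable(1)[of _ 1 R]) (use s_nonneg s_le_1 s_supp in auto)
  show "integrable lborel (\<lambda>x. (s x)\<^sup>2)"
    using L2_integrable[OF L] by simp
qed

lemma S2_eq: "S2 = (L2_norm (\<lambda>x. of_real (s x)))\<^sup>2"
  unfolding S2_def L2_norm_power2 by simp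

text \<open>The transform of \<open>sm h\<close> is bounded because \<open>sm h\<close> is
  integrable, and the integrability of \<open>occ\<close> does the rest.\<close>

lemma Wf_L2:
  assumes h: "h \<in> L2"
  shows "Wf h \<in> L2"
proof -
  note smh = sm_L2[OF h]
  define C where "C = (2 * pi) powr (- real DIM('a) / 2) * (LINT x|lborel. cmod (sm h x))"
  have [measurable]: "sm h \<in> borel_measurable borel" using smh(1) by (rule L2_measurable)
  show ?thesis
  proof (rule L2_I_bound)
    show "Wf h \<in> borel_measurable borel" unfolding Wf_def[abs_def] by measurable
    show "integrable lborel (\<lambda>p. occ p * C\<^sup>2)" by (intro integrable_mult_left occ_integrable)
    show "(cmod (Wf h p))\<^sup>2 \<le> occ p * C\<^sup>2" for p
    proof -
      have "(cmod (fourier_L1 (sm h) p))\<^sup>2 \<le> C\<^sup>2"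
        unfolding C_def by (intro power_mono norm_fourier_L1_le) auto
      then show ?thesis using occ_nonneg[of p] by (simp add: Wf_def norm_mult power_mult_distrib mult_left_mono)
    qed
  qed
qed

lemma kern_L2: "(\<lambda>y. complex_of_real (kern x y)) \<in> L2"
proof (rule bounded_support_integrable(1)[of _ rho_c R])
  have [measurable]: "x \<in> space borel" by simp
  show "(\<lambda>y. complex_of_real (kern x y)) \<in> borel_measurable borel"
    unfolding kern_def by measurable
  show "cmod (complex_of_real (kern x y)) \<le> rho_c" for y
    using kern_bound[of x y] kern_nonneg[of x y] rho_c_nonneg by (auto split: split_indicator_asm)
  show "R < norm y \<Longrightarrow> complex_of_real (kern x y) = 0" for y by (simp add: kern_def s_supp)
qed

lemma K_eq_inner: "K h x = L2_inner (\<lambda>y. of_real (kern x y)) h"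
  by (simp add: K_def L2_inner_def)

lemma K_eq: "K h x = of_real (s x) * (LINT y|lborel. of_real (A (x - y)) * sm h y)"
  unfolding K_def kern_def sm_def by (simp add: mult_ac flip: integral_mult_right_zero)

lemma kern_row_integrable: "integrable lborel (\<lambda>y. (kern x y)\<^sup>2)"
  using L2_integrable[OF kern_L2[of x]] kern_nonneg by simp

lemma kern_row_norm: "(LINT y|lborel. (kern x y)\<^sup>2) = (L2_norm (\<lambda>y. of_real (kern x y)))\<^sup>2"
  unfolding L2_norm_power2 by simp

lemma HS_integrable: "integrable lborel (\<lambda>x. LINT y|lborel. (kern x y)\<^sup>2)"
proof (rule Bochner_Integration.integrable_bound)
  let ?C = "LINT (y::'a)|lborel. rho_c\<^sup>2 * indicator (cball 0 R) y"
  show "integrable lborel (\<lambda>x::'a. ?C * indicator (cball 0 R) x)" by (rule integrable_indicator_cball)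
  show "(\<lambda>x. LINT y|lborel. (kern x y)\<^sup>2) \<in> borel_measurable lborel" by measurable
  show "AE x in lborel. norm (LINT y|lborel. (kern x y)\<^sup>2) \<le> norm (?C * indicator (cball 0 R) x)"
  proof (intro AE_I2)
    fix x :: 'a
    have "(LINT y|lborel. (kern x y)\<^sup>2) \<le> (LINT y|lborel. (rho_c\<^sup>2 * indicator (cball 0 R) (y::'a)) * indicator (cball 0 R) x)"
    proof (rule integral_mono)
      show "integrable lborel (\<lambda>y. (kern x y)\<^sup>2)" by (rule kern_row_integrable)
      show "integrable lborel (\<lambda>y. (rho_c\<^sup>2 * indicator (cball 0 R) y) * indicator (cball 0 R) x)"
        by (intro integrable_mult_left integrable_indicator_cball)
      show "(kern x y)\<^sup>2 \<le> (rho_c\<^sup>2 * indicator (cball 0 R) y) * indicator (cball 0 R) x" for y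
        using power_mono[OF kern_bound kern_nonneg, of x y 2] by (auto simp: power_mult_distrib split: split_indicator)
    qed
    also have "\<dots> = ?C * indicator (cball 0 R) x" by simp
    finally show "norm (LINT y|lborel. (kern x y)\<^sup>2) \<le> norm (?C * indicator (cball 0 R) x)"
      by (simp add: abs_mult order_trans[OF _ abs_ge_self])
  qed
qed

lemma HS_nonneg: "0 \<le> HS"
  unfolding HS_def by (intro integral_nonneg_AE AE_I2) simp

text \<open>Cauchy-Schwarz in every row of the kernel.\<close>

lemma K_L2:
  assumes h: "h \<in> L2"
  shows "K h \<in> L2" "L2_norm (K h) \<le> sqrt HS * L2_norm h"
proof -
  have [measurable]: "h \<in> borel_measurable borel" using h by (rule L2_measurable)
  have le: "(cmod (K h x))\<^sup>2 \<le> (LINT y|lborel. (kern x y)\<^sup>2) * (L2_norm h)\<^sup>2" for x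
    using power_mono[OF L2_Cauchy_Schwarz[OF kern_L2 h], of x 2]
    by (simp add: K_eq_inner kern_row_norm power_mult_distrib)
  have int: "integrable lborel (\<lambda>x. (LINT y|lborel. (kern x y)\<^sup>2) * (L2_norm h)\<^sup>2)"
    by (intro integrable_mult_left HS_integrable)
  show KL: "K h \<in> L2"
  proof (rule L2_I_bound[OF _ int le])
    show "K h \<in> borel_measurable borel" unfolding K_def[abs_def] by measurable
  qed
  have "(L2_norm (K h))\<^sup>2 \<le> (LINT x|lborel. (LINT y|lborel. (kern x y)\<^sup>2) * (L2_norm h)\<^sup>2)"
    unfolding L2_norm_power2 by (intro integral_mono L2_integrable[OF KL] int[unfolded L2_norm_power2]) (use le in \<open>simp add: L2_norm_power2\<close>)
  also have "\<dots> = (sqrt HS * L2_norm h)\<^sup>2"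
    using HS_nonneg by (simp add: HS_def power_mult_distrib)
  finally show "L2_norm (K h) \<le> sqrt HS * L2_norm h"
    by (rule power2_le_imp_le) (simp add: HS_nonneg)
qed

text \<open>Symmetry and positivity of \<open>K\<close> are read off from this factorization, in
  which the symbol \<open>occ\<close> turns into the kernel \<open>A\<close> by
  \<open>inverse_fourier_weight_occ\<close>.\<close>

lemma Wf_inner:
  assumes g: "g \<in> L2" and h: "h \<in> L2"
  shows "L2_inner (Wf g) (Wf h) = L2_inner g (K h)"
proof -
  have "L2_inner (Wf g) (Wf h) = (LINT p|lborel. of_real (occ p) * (cnj (fourier_L1 (sm g) p) * fourier_L1 (sm h) p))"
    unfolding L2_inner_def
  proof (intro Bochner_Integration.integral_cong refl)
    fix p
    have "complex_of_real (sqrt (occ p)) * of_real (sqrt (occ p)) = of_real (occ p)"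
      using occ_nonneg[of p] by (simp flip: of_real_mult)
    then show "cnj (Wf g p) * Wf h p = of_real (occ p) * (cnj (fourier_L1 (sm g) p) * fourier_L1 (sm h) p)"
      unfolding Wf_def by (simp add: mult_ac)
  qed
  also have "\<dots> = (LINT x|lborel. cnj (sm g x) * (LINT y|lborel. inverse_fourier_weight occ (x - y) * sm h y))"
    by (rule fourier_weighted_inner[OF occ_integrable sm_L2(2)[OF g] sm_L2(2)[OF h]])
  also have "\<dots> = L2_inner g (K h)"
    unfolding L2_inner_def inverse_fourier_weight_occ
    by (intro Bochner_Integration.integral_cong refl) (simp add: K_eq sm_def[of g])
  finally show ?thesis .
qed

lemma K_symmetric:
  assumes g: "g \<in> L2" and h: "h \<in> L2"
  shows "L2_inner g (K h) = L2_inner (K g) h"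
  unfolding Wf_inner[OF g h, symmetric] L2_inner_commute[of "K g"] Wf_inner[OF h g, symmetric]
  by (rule L2_inner_commute)

lemma Wf_norm:
  assumes "h \<in> L2"
  shows "L2_inner h (K h) = of_real ((L2_norm (Wf h))\<^sup>2)"
  unfolding Wf_inner[OF assms assms, symmetric] L2_inner_self ..

end

section \<open>Fredholm determinant and resolvent of \<open>K\<^sub>f\<close>\<close>

lemma sums_from_ennreal:
  fixes a :: "nat \<Rightarrow> real"
  assumes "\<And>i. 0 \<le> a i" "(\<Sum>i. ennreal (a i)) = ennreal T" "0 \<le> T"
  shows "a sums T"
proof -
  have s: "summable a" using assms by (intro summable_suminf_not_top) auto
  have "ennreal (suminf a) = ennreal T"
    using suminf_ennreal2[OF assms(1) s] assms(2) by simp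
  then have "suminf a = T" using assms(3) suminf_nonneg[OF s assms(1)] by simp
  with s show ?thesis by (simp add: sums_iff)
qed

lemma L2_orthonormal_basis_exists: "\<exists>e :: nat \<Rightarrow> 'a::euclidean_space \<Rightarrow> complex. L2_orthonormal_basis e"
  by (rule L2_orthonormal_basis_regular) (rule exI)

lemma L2_norm_uminus [simp]: "L2_norm (\<lambda>x. - h x) = L2_norm h"
  by (simp add: L2_norm_def)

lemma L2_eq_AE:
  assumes "g \<in> L2" "h \<in> L2" "\<And>f. f \<in> L2 \<Longrightarrow> L2_inner f g = L2_inner f h"
  shows "AE x in lborel. g x = h x"
proof -
  have d: "(\<lambda>x. g x - h x) \<in> L2" using assms by (intro L2_diff)
  have "complex_of_real ((L2_norm (\<lambda>x. g x - h x))\<^sup>2) = 0"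
    unfolding L2_inner_self[symmetric] L2_inner_diff_right[OF d assms(1,2)] assms(3)[OF d] by simp
  then have "L2_norm (\<lambda>x. g x - h x) = 0" by simp
  then have "AE x in lborel. g x - h x = 0" unfolding L2_norm_eq_0_iff[OF d] .
  then show ?thesis by eventually_elim simp
qed

section \<open>Trace and Fredholm determinant\<close>

context bose_region
begin

abbreviation sc :: "'a \<Rightarrow> complex" where "sc \<equiv> \<lambda>x. of_real (s x)"

definition Q :: real where "Q = (L2_norm (Wf sc))\<^sup>2"

lemma K_diff:
  assumes "g \<in> L2" "h \<in> L2"
  shows "K (\<lambda>x. g x - h x) = (\<lambda>x. K g x - K h x)"
  unfolding fun_eq_iff K_eq_inner by (intro allI L2_inner_diff_right[OF kern_L2 assms])

text \<open>Bessel's inequality in both variables: for the coefficients of \<open>K (e j)\<close>,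
  and then at each fixed x for the row of the kernel.\<close>

lemma HS_norm_bound:
  assumes e: "L2_orthonormal e"
  shows "(\<Sum>i<n. \<Sum>j<n. (cmod (L2_inner (e i) (K (e j))))\<^sup>2) \<le> HS"
proof -
  have eL: "e i \<in> L2" and on: "L2_inner (e i) (e j) = (if i = j then 1 else 0)" for i j
    using e by (auto simp: L2_orthonormal_def)
  have "(\<Sum>i<n. \<Sum>j<n. (cmod (L2_inner (e i) (K (e j))))\<^sup>2) = (\<Sum>j<n. \<Sum>i<n. (cmod (L2_inner (e i) (K (e j))))\<^sup>2)"
    by (rule sum.swap)
  also have "\<dots> \<le> (\<Sum>j<n. (L2_norm (K (e j)))\<^sup>2)"
    by (intro sum_mono L2_Bessel eL on K_L2)
  also have "\<dots> = (LINT x|lborel. (\<Sum>j<n. (cmod (K (e j) x))\<^sup>2))"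
    unfolding L2_norm_power2 by (rule Bochner_Integration.integral_sum[symmetric]) (intro L2_integrable K_L2 eL)
  also have "\<dots> \<le> (LINT x|lborel. (LINT y|lborel. (kern x y)\<^sup>2))"
  proof (rule integral_mono)
    show "integrable lborel (\<lambda>x. \<Sum>j<n. (cmod (K (e j) x))\<^sup>2)"
      by (intro Bochner_Integration.integrable_sum L2_integrable K_L2 eL)
    show "integrable lborel (\<lambda>x. LINT y|lborel. (kern x y)\<^sup>2)" by (rule HS_integrable)
    fix x
    have "(\<Sum>j<n. (cmod (K (e j) x))\<^sup>2) = (\<Sum>j<n. (cmod (L2_inner (e j) (\<lambda>y. of_real (kern x y))))\<^sup>2)"
      unfolding K_eq_inner by (subst L2_inner_commute) simp
    also have "\<dots> \<le> (L2_norm (\<lambda>y. of_real (kern x y)))\<^sup>2"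
      by (intro L2_Bessel eL on kern_L2)
    finally show "(\<Sum>j<n. (cmod (K (e j) x))\<^sup>2) \<le> (LINT y|lborel. (kern x y)\<^sup>2)"
      by (simp only: kern_row_norm)
  qed
  finally show ?thesis by (simp add: HS_def)
qed

text \<open>The trace of \<open>K\<close>. For fixed p, \<open>Wf h p\<close> is sqrt (occ p) times
  the inner product of h with a plane wave damped by s. Parseval's identity sums the squares over
  the basis to the squared norm of that wave, and the integral of \<open>occ\<close> over p supplies
  \<open>rho_c\<close>.\<close>

lemma trace_sums:
  assumes e: "L2_orthonormal_basis e"
  shows "(\<lambda>i. (L2_norm (Wf (e i)))\<^sup>2) sums (rho_c * S2)"
proof (rule sums_from_ennreal)
  have eL: "e i \<in> L2" for i using e by (auto simp: L2_orthonormal_basis_def)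
  have [measurable]: "e i \<in> borel_measurable borel" for i using eL by (rule L2_measurable)
  define c where "c = (2 * pi) powr (- real DIM('a) / 2)"
  have "complex_of_real (c * c) = of_real (1 / (2 * pi) ^ DIM('a))"
    using fourier_const_power2[of "DIM('a)"] unfolding c_def[symmetric]
    by (simp only: of_real_mult of_real_divide of_real_1)
  then have c2: "c * c = 1 / (2 * pi) ^ DIM('a)" by (simp only: of_real_eq_iff)
  define \<psi> where "\<psi> p x = of_real c * (exp (\<i> * of_real (p \<bullet> x)) * of_real (s x))" for p x :: 'a
  have psi_norm: "cmod (\<psi> p x) = \<bar>c\<bar> * s x" for p x
    using s_nonneg[of x] by (simp add: \<psi>_def norm_mult)
  have psi_meas: "\<psi> p \<in> borel_measurable borel" for p unfolding \<psi>_def by measurable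
  have psi_L2: "\<psi> p \<in> L2" for p
  proof (rule bounded_support_integrable(1)[OF psi_meas])
    show "cmod (\<psi> p x) \<le> \<bar>c\<bar>" for x
      unfolding psi_norm using s_le_1[of x] s_nonneg[of x] by (simp add: mult_left_le)
    show "R < norm x \<Longrightarrow> \<psi> p x = 0" for x by (simp add: \<psi>_def s_supp)
  qed
  have psi_L2norm: "(L2_norm (\<psi> p))\<^sup>2 = S2 / (2 * pi) ^ DIM('a)" for p
  proof -
    have "(L2_norm (\<psi> p))\<^sup>2 = (LINT x|lborel. (c * c) * (s x)\<^sup>2)"
      unfolding L2_norm_power2 psi_norm by (simp add: power2_eq_square mult_ac)
    then show ?thesis by (simp add: c2 S2_def)
  qed
  have F: "fourier_L1 (sm h) p = L2_inner (\<psi> p) h" for h p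
    unfolding fourier_L1_def L2_inner_def \<psi>_def c_def[symmetric] sm_def
    by (simp add: exp_cnj mult_ac flip: integral_mult_right_zero)
  have Wn: "ennreal ((cmod (Wf h p))\<^sup>2) = ennreal (occ p) * ennreal ((cmod (L2_inner (\<psi> p) h))\<^sup>2)" for h p
    using occ_nonneg[of p] by (simp add: Wf_def F norm_mult power_mult_distrib ennreal_mult)
  have "(\<Sum>i. ennreal ((L2_norm (Wf (e i)))\<^sup>2)) = (\<Sum>i. \<integral>\<^sup>+p. ennreal ((cmod (Wf (e i) p))\<^sup>2) \<partial>lborel)"
    by (simp add: nn_integral_L2[OF Wf_L2[OF eL]])
  also have "\<dots> = (\<integral>\<^sup>+p. (\<Sum>i. ennreal ((cmod (Wf (e i) p))\<^sup>2)) \<partial>lborel)"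
    by (rule nn_integral_suminf[symmetric]) (use Wf_L2[OF eL] in \<open>auto intro!: L2_measurable\<close>)
  also have "\<dots> = (\<integral>\<^sup>+p. ennreal (occ p * (S2 / (2 * pi) ^ DIM('a))) \<partial>lborel)"
  proof (intro nn_integral_cong)
    fix p :: 'a
    have sums: "(\<lambda>i. (cmod (L2_inner (\<psi> p) (e i)))\<^sup>2) sums (S2 / (2 * pi) ^ DIM('a))"
    proof -
      have "cmod (L2_inner (\<psi> p) (e i)) = cmod (L2_inner (e i) (\<psi> p))" for i
        by (subst L2_inner_commute) simp
      then show ?thesis using L2_Parseval[OF e psi_L2[of p]] by (simp add: psi_L2norm)
    qed
    have "(\<Sum>i. ennreal ((cmod (Wf (e i) p))\<^sup>2)) = ennreal (occ p) * (\<Sum>i. ennreal ((cmod (L2_inner (\<psi> p) (e i)))\<^sup>2))"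
      unfolding Wn by (rule ennreal_suminf_cmult)
    also have "(\<Sum>i. ennreal ((cmod (L2_inner (\<psi> p) (e i)))\<^sup>2)) = ennreal (S2 / (2 * pi) ^ DIM('a))"
      by (rule suminf_ennreal_eq[OF _ sums]) simp
    finally show "(\<Sum>i. ennreal ((cmod (Wf (e i) p))\<^sup>2)) = ennreal (occ p * (S2 / (2 * pi) ^ DIM('a)))"
      by (simp only: ennreal_mult'[OF occ_nonneg])
  qed
  also have "\<dots> = ennreal (LINT p|lborel. occ (p::'a) * (S2 / (2 * pi) ^ DIM('a)))"
    using occ_nonneg S2_eq by (intro nn_integral_eq_integral integrable_mult_left occ_integrable) auto
  also have "(LINT p|lborel. occ (p::'a) * (S2 / (2 * pi) ^ DIM('a))) = rho_c * S2"
  proof -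
    have "rho_c = (LINT p|lborel. occ (p::'a) / (2 * pi) ^ DIM('a))"
      unfolding critical_density_def occupation_def ..
    then show ?thesis by simp
  qed
  finally show "(\<Sum>i. ennreal ((L2_norm (Wf (e i)))\<^sup>2)) = ennreal (rho_c * S2)" .
  show "0 \<le> rho_c * S2" using rho_c_nonneg S2_eq by simp
qed simp

text \<open>Adjoint of \<open>Wf\<close> as an explicit integral, which converges since sqrt occ and
  f are both in \<open>L2\<close>. It identifies the limit of the transposed Gram matrices.\<close>

definition Wadj :: "('a \<Rightarrow> complex) \<Rightarrow> 'a \<Rightarrow> complex" where
  "Wadj f x = of_real (s x) * (of_real ((2 * pi) powr (- real DIM('a) / 2))
     * (LINT p|lborel. exp (\<i> * of_real (p \<bullet> x)) * (of_real (sqrt (occ p)) * f p)))"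

lemma sqrt_occ_mult_integrable:
  assumes "f \<in> L2"
  shows "integrable lborel (\<lambda>p. of_real (sqrt (occ p)) * f p)"
proof -
  have "(\<lambda>p. complex_of_real (sqrt (occ p))) \<in> L2"
    by (rule L2_I) (use occ_integrable occ_nonneg in auto)
  from L2_inner_integrable[OF this assms] show ?thesis by simp
qed

lemma Wadj_L2:
  assumes f: "f \<in> L2"
  shows "Wadj f \<in> L2"
proof (rule bounded_support_integrable(1))
  have [measurable]: "f \<in> borel_measurable borel" using f by (rule L2_measurable)
  define C where "C = (LINT p|lborel. cmod (of_real (sqrt (occ p)) * f p))"
  show "Wadj f \<in> borel_measurable borel" unfolding Wadj_def[abs_def] by measurable
  show "cmod (Wadj f x) \<le> 1 * (\<bar>(2 * pi) powr (- real DIM('a) / 2)\<bar> * C)" for x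
    unfolding Wadj_def norm_mult norm_of_real
  proof (intro mult_mono order_refl)
    show "cmod (LINT p|lborel. exp (\<i> * of_real (p \<bullet> x)) * (of_real (sqrt (occ p)) * f p)) \<le> C"
      using integral_norm_bound[of lborel "\<lambda>p. exp (\<i> * of_real (p \<bullet> x)) * (of_real (sqrt (occ p)) * f p)"]
      by (simp add: norm_mult C_def)
  qed (use s_nonneg[of x] s_le_1[of x] in \<open>auto simp: C_def\<close>)
  show "R < norm x \<Longrightarrow> Wadj f x = 0" for x by (simp add: Wadj_def s_supp)
qed

lemma Wadj_inner:
  assumes f: "f \<in> L2" and h: "h \<in> L2"
  shows "L2_inner f (Wf h) = L2_inner (Wadj f) h"
proof -
  define c where "c = complex_of_real ((2 * pi) powr (- real DIM('a) / 2))"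
  have u: "integrable lborel (\<lambda>p. cnj (of_real (sqrt (occ p)) * f p))"
    using sqrt_occ_mult_integrable[OF f] by (simp only: integrable_cnj)
  have "L2_inner f (Wf h) = (LINT p|lborel. c * (cnj (of_real (sqrt (occ p)) * f p) * (LINT x|lborel. exp (- \<i> * of_real (p \<bullet> x)) * sm h x)))"
    unfolding L2_inner_def Wf_def fourier_L1_def c_def by (intro Bochner_Integration.integral_cong refl) simp
  also have "\<dots> = c * (LINT x|lborel. sm h x * (LINT p|lborel. exp (- \<i> * of_real (p \<bullet> x)) * cnj (of_real (sqrt (occ p)) * f p)))"
    unfolding integral_mult_right_zero
    by (subst lborel_kernel_swap[OF u sm_L2(2)[OF h], of "\<lambda>(p::'a) x. exp (- \<i> * of_real (p \<bullet> x))" 1])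
       (auto simp: norm_exp_eq_Re)
  also have "\<dots> = L2_inner (Wadj f) h"
    unfolding L2_inner_def integral_mult_right_zero[symmetric]
  proof (intro Bochner_Integration.integral_cong refl)
    fix x
    have "cnj (Wadj f x) = of_real (s x) * (c * (LINT p|lborel. exp (- \<i> * of_real (p \<bullet> x)) * cnj (of_real (sqrt (occ p)) * f p)))"
      unfolding Wadj_def c_def complex_cnj_mult
      by (simp add: exp_cnj flip: Bochner_Integration.integral_cnj)
    then show "(LINT p|lborel. c * (sm h x * (exp (- \<i> * of_real (p \<bullet> x)) * cnj (of_real (sqrt (occ p)) * f p)))) = cnj (Wadj f x) * h x"
      unfolding integral_mult_right_zero by (simp add: sm_def)
  qed
  finally show ?thesis .
qed

lemma inner_Ke:
  assumes "L2_orthonormal_basis e"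
  shows "L2_inner (e i) (K (e j)) = L2_inner (Wf (e i)) (Wf (e j))"
  using assms by (intro Wf_inner[symmetric]) (auto simp: L2_orthonormal_basis_def)

definition Kmat :: "(nat \<Rightarrow> 'a \<Rightarrow> complex) \<Rightarrow> nat \<Rightarrow> complex mat" where
  "Kmat e n = Matrix.mat n n (\<lambda>(i, j). L2_inner (e i) (K (e j)))"

lemma one_plus_Kmat:
  "Matrix.mat n n (\<lambda>(i, j). (if i = j then 1 else 0) + L2_inner (e i) (K (e j))) = 1\<^sub>m n + Kmat e n"
  by (intro eq_matI) (auto simp: Kmat_def)

lemma psd_Kmat:
  assumes e: "L2_orthonormal_basis e"
  shows "psd_mat n (Kmat e n)"
proof (rule psd_of_quadratic_form)
  have eL: "e i \<in> L2" for i using e by (auto simp: L2_orthonormal_basis_def)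
  note W = Wf_L2[OF eL]
  fix c :: "nat \<Rightarrow> complex"
  let ?g = "\<lambda>p. \<Sum>i<n. c i * Wf (e i) p"
  have g: "?g \<in> L2" by (intro L2_sum L2_cmult W)
  have "L2_inner ?g ?g = (\<Sum>i<n. L2_inner (\<lambda>p. c i * Wf (e i) p) ?g)"
    by (rule L2_inner_sum_left[OF g]) (intro L2_cmult W)
  also have "\<dots> = (\<Sum>i<n. \<Sum>j<n. L2_inner (\<lambda>p. c i * Wf (e i) p) (\<lambda>p. c j * Wf (e j) p))"
    by (intro sum.cong refl L2_inner_sum_right L2_cmult W)
  also have "\<dots> = (\<Sum>i<n. \<Sum>j<n. cnj (c i) * Kmat e n $$ (i, j) * c j)"
    by (intro sum.cong refl) (simp add: Kmat_def inner_Ke[OF e])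
  finally have "(\<Sum>i<n. \<Sum>j<n. cnj (c i) * Kmat e n $$ (i, j) * c j) = of_real ((L2_norm ?g)\<^sup>2)"
    by (simp only: L2_inner_self)
  then show "0 \<le> (\<Sum>i<n. \<Sum>j<n. cnj (c i) * Kmat e n $$ (i, j) * c j)"
    by (simp only:) (simp add: less_eq_complex_def)
qed (simp add: Kmat_def)

text \<open>The truncated determinants of \<open>K\<close> in the basis e have the same limit as
  those of the product in the other order, \<open>Wf\<close> after \<open>Wadj\<close>, in one fixed
  basis f. The second family does not involve e, so the limit is common to all bases.\<close>

lemma fredholm_det_exists:
  obtains D :: real where
    "\<And>e. L2_orthonormal_basis e \<Longrightarrow> (\<lambda>n. Determinant.det (1\<^sub>m n + Kmat e n)) \<longlonglongrightarrow> of_real D"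
proof -
  obtain f :: "nat \<Rightarrow> 'a \<Rightarrow> complex" where f: "L2_orthonormal_basis f"
    using L2_orthonormal_basis_exists by blast
  have fL: "f i \<in> L2" for i using f by (auto simp: L2_orthonormal_basis_def)
  define L where "L k l = L2_inner (Wadj (f k)) (Wadj (f l))" for k l
  have main: "\<exists>D::real. (\<lambda>n. Determinant.det (1\<^sub>m n + Kmat e n)) \<longlonglongrightarrow> of_real D
      \<and> (\<lambda>n. Determinant.det (Matrix.mat n n (\<lambda>(k, l). (if k = l then 1 else 0) + L k l))) \<longlonglongrightarrow> of_real D"
    if e: "L2_orthonormal_basis e" for e
  proof -
    have eL: "e i \<in> L2" for i using e by (auto simp: L2_orthonormal_basis_def)
    note W = Wf_L2[OF eL]
    \<comment> \<open>Matrix of \<open>Wf\<close> from the basis e to the basis f: products of its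
      columns sum to the entries of \<open>K\<close>, products of its rows to those of
      \<open>L\<close>.\<close>
    define X where "X k i = L2_inner (f k) (Wf (e i))" for k i
    have X_adj: "X k i = cnj (L2_inner (e i) (Wadj (f k)))" for k i
      unfolding X_def Wadj_inner[OF fL eL] by (rule L2_inner_commute)
    show ?thesis
    proof (rule lim_det_gram_swap[of X "\<lambda>i j. L2_inner (e i) (K (e j))" L "rho_c * S2"])
      show "(\<lambda>N. \<Sum>k<N. cnj (X k i) * X k j) \<longlonglongrightarrow> L2_inner (e i) (K (e j))" for i j
        unfolding X_def inner_Ke[OF e] by (rule L2_Parseval_inner[OF f W W])
      show "(\<lambda>n. \<Sum>i<n. X k i * cnj (X l i)) \<longlonglongrightarrow> L k l" for k l
        unfolding X_adj complex_cnj_cnj L_def by (rule L2_Parseval_inner[OF e Wadj_L2[OF fL] Wadj_L2[OF fL]])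
      show "(\<Sum>i<n. \<Sum>k<N. (cmod (X k i))\<^sup>2) \<le> rho_c * S2" for n N
      proof -
        have "(\<Sum>i<n. \<Sum>k<N. (cmod (X k i))\<^sup>2) \<le> (\<Sum>i<n. (L2_norm (Wf (e i)))\<^sup>2)"
          unfolding X_def by (intro sum_mono L2_Bessel W) (use f in \<open>auto simp: L2_orthonormal_basis_def\<close>)
        also have "\<dots> \<le> rho_c * S2"
          using trace_sums[OF e] sum_le_suminf[of "\<lambda>i. (L2_norm (Wf (e i)))\<^sup>2" "{..<n}"] by (simp add: sums_iff)
        finally show ?thesis .
      qed
    next
      fix D :: real
      assume "(\<lambda>n. Determinant.det (Matrix.mat n n (\<lambda>(i, j). (if i = j then 1 else 0) + L2_inner (e i) (K (e j))))) \<longlonglongrightarrow> of_real D"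
        "(\<lambda>n. Determinant.det (Matrix.mat n n (\<lambda>(k, l). (if k = l then 1 else 0) + L k l))) \<longlonglongrightarrow> of_real D"
      then show ?thesis unfolding one_plus_Kmat by blast
    qed
  qed
  obtain D :: real where D: "(\<lambda>n. Determinant.det (Matrix.mat n n (\<lambda>(k, l). (if k = l then 1 else 0) + L k l))) \<longlonglongrightarrow> of_real D"
    using main[OF f] by blast
  have "(\<lambda>n. Determinant.det (1\<^sub>m n + Kmat e n)) \<longlonglongrightarrow> of_real D" if e: "L2_orthonormal_basis e" for e
  proof -
    obtain D' :: real where D': "(\<lambda>n. Determinant.det (1\<^sub>m n + Kmat e n)) \<longlonglongrightarrow> of_real D'"
      "(\<lambda>n. Determinant.det (Matrix.mat n n (\<lambda>(k, l). (if k = l then 1 else 0) + L k l))) \<longlonglongrightarrow> of_real D'"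
      using main[OF e] by blast
    have "complex_of_real D = of_real D'" by (rule LIMSEQ_unique[OF D D'(2)])
    with D'(1) show ?thesis by simp
  qed
  then show ?thesis by (rule that)
qed

text \<open>The bounds for finite matrices pass to the limit: the traces converge to
  \<open>rho_c * S2\<close>, and the traces of the squares stay below \<open>HS\<close>.\<close>

lemma fredholm_det_bounds:
  assumes e: "L2_orthonormal_basis e" and D: "(\<lambda>n. Determinant.det (1\<^sub>m n + Kmat e n)) \<longlonglongrightarrow> complex_of_real D"
  shows "exp (rho_c * S2 - HS) \<le> D" "D \<le> exp (rho_c * S2)"
proof -
  have eL: "e i \<in> L2" for i using e by (auto simp: L2_orthonormal_basis_def)
  have ReD: "(\<lambda>n. Re (Determinant.det (1\<^sub>m n + Kmat e n))) \<longlonglongrightarrow> D"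
    using tendsto_Re[OF D] by simp
  have tr: "Re (mat_trace (Kmat e n)) = (\<Sum>i<n. (L2_norm (Wf (e i)))\<^sup>2)" for n
    unfolding mat_trace_def Kmat_def by (simp add: inner_Ke[OF e] L2_inner_self flip: of_real_power)
  have trlim: "(\<lambda>n. Re (mat_trace (Kmat e n))) \<longlonglongrightarrow> rho_c * S2"
    unfolding tr using trace_sums[OF e] by (simp add: sums_def)
  have tr2: "Re (mat_trace (Kmat e n * Kmat e n)) \<le> HS" for n
  proof -
    have cc: "L2_inner (e j) (K (e i)) = cnj (L2_inner (e i) (K (e j)))" for i j
      unfolding inner_Ke[OF e] by (rule L2_inner_commute)
    have "mat_trace (Kmat e n * Kmat e n) = (\<Sum>i<n. \<Sum>j<n. L2_inner (e i) (K (e j)) * L2_inner (e j) (K (e i)))"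
      unfolding mat_trace_def Kmat_def by (simp add: scalar_prod_def lessThan_atLeast0)
    also have "\<dots> = (\<Sum>i<n. \<Sum>j<n. of_real ((cmod (L2_inner (e i) (K (e j))))\<^sup>2))"
      by (intro sum.cong refl, subst cc, rule complex_norm_square[symmetric])
    also have "\<dots> = of_real (\<Sum>i<n. \<Sum>j<n. (cmod (L2_inner (e i) (K (e j))))\<^sup>2)" by simp
    finally have "Re (mat_trace (Kmat e n * Kmat e n)) = (\<Sum>i<n. \<Sum>j<n. (cmod (L2_inner (e i) (K (e j))))\<^sup>2)"
      by (simp only: Re_complex_of_real)
    also have "\<dots> \<le> HS"
      by (rule HS_norm_bound) (use e in \<open>auto simp: L2_orthonormal_def L2_orthonormal_basis_def\<close>)
    finally show ?thesis .
  qed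
  show "D \<le> exp (rho_c * S2)"
    by (rule LIMSEQ_le[OF ReD tendsto_exp[OF trlim]]) (use det_one_plus_psd_bounds(3)[OF psd_Kmat[OF e]] in blast)
  show "exp (rho_c * S2 - HS) \<le> D"
  proof (rule LIMSEQ_le[OF _ ReD])
    show "(\<lambda>n. exp (Re (mat_trace (Kmat e n)) - HS)) \<longlonglongrightarrow> exp (rho_c * S2 - HS)"
      by (intro tendsto_intros trlim)
    have "exp (Re (mat_trace (Kmat e n)) - HS) \<le> Re (Determinant.det (1\<^sub>m n + Kmat e n))" for n
    proof -
      have "exp (Re (mat_trace (Kmat e n)) - HS) \<le> exp (Re (mat_trace (Kmat e n)) - Re (mat_trace (Kmat e n * Kmat e n)))"
        using tr2[of n] by simp
      then show ?thesis using det_one_plus_psd_bounds(4)[OF psd_Kmat[OF e, of n]] by linarith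
    qed
    then show "\<exists>N. \<forall>n\<ge>N. exp (Re (mat_trace (Kmat e n)) - HS) \<le> Re (Determinant.det (1\<^sub>m n + Kmat e n))" by blast
  qed
qed

section \<open>The resolvent\<close>

text \<open>Iteration of u \<mapsto> s - K u, a contraction because \<open>sqrt HS\<close> is below
  1.\<close>

lemma resolvent_exists:
  assumes HS: "HS < 1"
  obtains u where "u \<in> L2" "AE x in lborel. u x + K u x = sc x"
proof -
  define q where "q = sqrt HS"
  have q: "0 \<le> q" "q < 1" using HS HS_nonneg by (auto simp: q_def)
  have K: "L2_norm (K h) \<le> q * L2_norm h" if "h \<in> L2" for h unfolding q_def by (rule K_L2(2)[OF that])
  define u where "u = rec_nat (\<lambda>x. 0) (\<lambda>_ g x. sc x - K g x)"
  have u0: "u 0 = (\<lambda>x. 0)" and uS: "u (Suc n) = (\<lambda>x. sc x - K (u n) x)" for n by (simp_all add: u_def)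
  have uL: "u n \<in> L2" for n
    by (induction n) (auto simp: u0 uS intro!: L2_diff s_L2(1) K_L2(1))
  \<comment> \<open>The solution of C = || s || + q C, hence a bound that the iteration
    preserves.\<close>
  define C where "C = L2_norm sc / (1 - q)"
  have u_bound: "L2_norm (u n) \<le> C" for n
  proof (induction n)
    case 0 then show ?case using q by (simp add: u0 C_def)
  next
    case (Suc n)
    have "L2_norm (u (Suc n)) \<le> L2_norm sc + L2_norm (K (u n))"
      using L2_norm_triangle[OF s_L2(1) L2_cmult[OF K_L2(1)[OF uL[of n]], of "-1"]] by (simp add: uS)
    also have "\<dots> \<le> L2_norm sc + q * C"
      using K[OF uL[of n]] mult_left_mono[OF Suc q(1)] by linarith
    also have "\<dots> = C" using q by (simp add: C_def field_simps)
    finally show ?case .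
  qed
  have step: "L2_norm (\<lambda>x. u (Suc m) x - u (Suc n) x) \<le> q * L2_norm (\<lambda>x. u m x - u n x)" for m n
  proof -
    have "L2_norm (\<lambda>x. u (Suc m) x - u (Suc n) x) = L2_norm (K (\<lambda>x. u n x - u m x))"
      by (simp add: uS K_diff[OF uL uL])
    also have "\<dots> \<le> q * L2_norm (\<lambda>x. u n x - u m x)" by (intro K L2_diff uL)
    finally show ?thesis by (subst L2_norm_minus_commute)
  qed
  have cauchy: "L2_norm (\<lambda>x. u (n + k) x - u n x) \<le> q ^ n * C" for n k
  proof (induction n)
    case 0 then show ?case using u_bound by (simp add: u0)
  next
    case (Suc n)
    show ?case using step[of "n + k" n] mult_left_mono[OF Suc q(1)] by simp
  qed
  have C0: "0 \<le> C" using q by (simp add: C_def)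
  have "\<exists>N. \<forall>m\<ge>N. \<forall>n\<ge>N. L2_norm (\<lambda>x. u m x - u n x) < d" if d: "0 < d" for d
  proof -
    have "(\<lambda>n. q ^ n * C) \<longlonglongrightarrow> 0 * C" using q by (intro tendsto_intros LIMSEQ_realpow_zero) auto
    then have "eventually (\<lambda>n. q ^ n * C < d) sequentially" using d by (intro order_tendstoD(2)) auto
    then obtain N where N: "\<And>n. N \<le> n \<Longrightarrow> q ^ n * C < d" by (auto simp: eventually_sequentially)
    have "L2_norm (\<lambda>x. u m x - u n x) < d" if "N \<le> m" "N \<le> n" for m n
    proof (cases "n \<le> m")
      case True
      then show ?thesis using cauchy[of n "m - n"] N[OF that(2)] by simp
    next
      case False
      then show ?thesis using cauchy[of m "n - m"] N[OF that(1)] by (subst L2_norm_minus_commute) simp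
    qed
    then show ?thesis by blast
  qed
  then obtain v where v: "v \<in> L2" "(\<lambda>n. L2_norm (\<lambda>x. u n x - v x)) \<longlonglongrightarrow> 0"
    using L2_complete[of u] uL by blast
  \<comment> \<open>The limit v agrees with s - K v only almost everywhere; the distance between the
    two is estimated through the next iterate.\<close>
  define w where "w = (\<lambda>x. sc x - K v x)"
  have w: "w \<in> L2" unfolding w_def by (intro L2_diff s_L2(1) K_L2(1) v(1))
  have "L2_norm (\<lambda>x. v x - w x) \<le> L2_norm (\<lambda>x. u (Suc n) x - v x) + q * L2_norm (\<lambda>x. u n x - v x)" for n
  proof -
    have "L2_norm (\<lambda>x. u (Suc n) x - w x) = L2_norm (K (\<lambda>x. v x - u n x))"
      by (simp add: uS w_def K_diff[OF v(1) uL])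
    also have "\<dots> \<le> q * L2_norm (\<lambda>x. u n x - v x)"
      using K[OF L2_diff[OF v(1) uL[of n]]] by (subst L2_norm_minus_commute)
    finally show ?thesis
      using L2_norm_triangle_diff[OF v(1) uL[of "Suc n"] w] L2_norm_minus_commute[of v "u (Suc n)"] by linarith
  qed
  moreover have "(\<lambda>n. L2_norm (\<lambda>x. u (Suc n) x - v x) + q * L2_norm (\<lambda>x. u n x - v x)) \<longlonglongrightarrow> 0 + q * 0"
    by (intro tendsto_intros v(2) LIMSEQ_Suc[OF v(2)])
  ultimately have "L2_norm (\<lambda>x. v x - w x) \<le> 0"
    by (intro LIMSEQ_le_const[where X = "\<lambda>n. L2_norm (\<lambda>x. u (Suc n) x - v x) + q * L2_norm (\<lambda>x. u n x - v x)"]) auto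
  then have "L2_norm (\<lambda>x. v x - w x) = 0" using L2_norm_nonneg[of "\<lambda>x. v x - w x"] by linarith
  then have "AE x in lborel. v x - w x = 0" unfolding L2_norm_eq_0_iff[OF L2_diff[OF v(1) w]] .
  then have "AE x in lborel. v x + K v x = sc x" by eventually_elim (simp add: w_def algebra_simps)
  with v(1) that show ?thesis by blast
qed

text \<open>|| K h ||^2 is the inner product of W K h with W h, and || W K h ||^2 = <K h, K K h> is
  at most sqrt HS || K h ||^2. In contrast to \<open>K_L2\<close> the norm on the right is that of W
  h, which for h = s stays bounded in the scaling limit while \<open>S2\<close> grows.\<close>

lemma K_norm_le_Wf:
  assumes h: "h \<in> L2"
  shows "L2_norm (K h) \<le> sqrt (sqrt HS) * L2_norm (Wf h)"
proof -
  let ?N = "L2_norm (K h)"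
  note Kh = K_L2(1)[OF h]
  have "complex_of_real ((L2_norm (Wf (K h)))\<^sup>2) = L2_inner (K h) (K (K h))"
    by (rule Wf_norm[OF Kh, symmetric])
  then have "(L2_norm (Wf (K h)))\<^sup>2 = cmod (L2_inner (K h) (K (K h)))"
    by (metis abs_of_nonneg norm_of_real zero_le_power2)
  also have "\<dots> \<le> ?N * (sqrt HS * ?N)"
    by (rule order_trans[OF L2_Cauchy_Schwarz[OF Kh K_L2(1)[OF Kh]]])
       (intro mult_left_mono K_L2(2)[OF Kh] L2_norm_nonneg)
  also have "\<dots> = (sqrt (sqrt HS) * ?N)\<^sup>2"
    using HS_nonneg by (simp add: power_mult_distrib power2_eq_square[of ?N] mult_ac)
  finally have W: "L2_norm (Wf (K h)) \<le> sqrt (sqrt HS) * ?N"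
    by (rule power2_le_imp_le) (simp add: HS_nonneg)
  have "complex_of_real (?N\<^sup>2) = L2_inner (Wf (K h)) (Wf h)"
    unfolding Wf_inner[OF Kh h] L2_inner_self ..
  then have "?N\<^sup>2 = cmod (L2_inner (Wf (K h)) (Wf h))"
    by (metis abs_of_nonneg norm_of_real zero_le_power2)
  also have "\<dots> \<le> (sqrt (sqrt HS) * ?N) * L2_norm (Wf h)"
    by (rule order_trans[OF L2_Cauchy_Schwarz[OF Wf_L2[OF Kh] Wf_L2[OF h]]])
       (intro mult_right_mono W L2_norm_nonneg)
  finally have "?N * ?N \<le> ?N * (sqrt (sqrt HS) * L2_norm (Wf h))"
    by (simp add: power2_eq_square mult_ac)
  then show ?thesis
    using L2_norm_nonneg[of "K h"] HS_nonneg by (cases "?N = 0") (auto simp: mult_le_cancel_left)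
qed

text \<open>Inserting u = s - K u twice leaves the remainder <K s, K u>, whose two factors are each
  bounded by \<open>K_norm_le_Wf\<close>.\<close>

lemma resolvent_inner:
  assumes u: "u \<in> L2" "AE x in lborel. u x + K u x = sc x"
  shows "cmod (L2_inner sc u - of_real (S2 - Q)) \<le> sqrt HS * Q"
proof -
  note sL = s_L2(1)
  note Ks = K_L2(1)[OF sL] and Ku = K_L2(1)[OF u(1)]
  have d: "(\<lambda>x. sc x - K u x) \<in> L2" by (intro L2_diff sL Ku)
  have ae: "AE x in lborel. u x = sc x - K u x"
    using u(2) by eventually_elim (simp add: algebra_simps)
  have ind: "L2_inner g u = L2_inner g sc - L2_inner g (K u)" if g: "g \<in> L2" for g
  proof -
    have "L2_inner g u = L2_inner g (\<lambda>x. sc x - K u x)"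
      by (rule L2_inner_AE_cong[OF _ ae]) (use g u d in \<open>auto intro: L2_measurable\<close>)
    also have "\<dots> = L2_inner g sc - L2_inner g (K u)" by (rule L2_inner_diff_right[OF g sL Ku])
    finally show ?thesis .
  qed
  have Qeq: "L2_inner (K sc) sc = of_real Q"
    unfolding K_symmetric[OF sL sL, symmetric] Q_def by (rule Wf_norm[OF sL])
  have "L2_inner sc u = L2_inner sc sc - L2_inner (K sc) u"
    unfolding ind[OF sL] K_symmetric[OF sL u(1)] ..
  also have "\<dots> = of_real S2 - of_real Q + L2_inner (K sc) (K u)"
    unfolding ind[OF Ks] Qeq L2_inner_self S2_eq by simp
  finally have err: "L2_inner sc u - of_real (S2 - Q) = L2_inner (K sc) (K u)" by simp
  have CS: "cmod (L2_inner (K sc) (K u)) \<le> L2_norm (K sc) * L2_norm (K u)"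
    by (rule L2_Cauchy_Schwarz[OF Ks Ku])
  \<comment> \<open>Energy estimate: pairing the equation with \<open>K u\<close> gives || W u ||^2
    + || K u ||^2 = <W u, W s>.\<close>
  have Wu: "L2_norm (Wf u) \<le> L2_norm (Wf sc)"
  proof -
    have "complex_of_real ((L2_norm (Wf u))\<^sup>2) = L2_inner (K u) u"
      unfolding Wf_norm[OF u(1), symmetric] by (rule K_symmetric[OF u(1) u(1)])
    also have "\<dots> = L2_inner (K u) sc - L2_inner (K u) (K u)" by (rule ind[OF Ku])
    also have "L2_inner (K u) sc = L2_inner (Wf u) (Wf sc)"
      unfolding K_symmetric[OF u(1) sL, symmetric] by (rule Wf_inner[OF u(1) sL, symmetric])
    finally have "complex_of_real ((L2_norm (Wf u))\<^sup>2) + of_real ((L2_norm (K u))\<^sup>2) = L2_inner (Wf u) (Wf sc)"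
      by (simp add: L2_inner_self)
    then have "(L2_norm (Wf u))\<^sup>2 + (L2_norm (K u))\<^sup>2 = Re (L2_inner (Wf u) (Wf sc))"
      by (metis Re_complex_of_real of_real_add)
    then have "(L2_norm (Wf u))\<^sup>2 \<le> Re (L2_inner (Wf u) (Wf sc))"
      using zero_le_power2[of "L2_norm (K u)"] by linarith
    also have "\<dots> \<le> cmod (L2_inner (Wf u) (Wf sc))" by (rule complex_Re_le_cmod)
    also have "\<dots> \<le> L2_norm (Wf u) * L2_norm (Wf sc)"
      by (rule L2_Cauchy_Schwarz[OF Wf_L2[OF u(1)] Wf_L2[OF sL]])
    finally have "L2_norm (Wf u) * L2_norm (Wf u) \<le> L2_norm (Wf u) * L2_norm (Wf sc)"
      by (simp add: power2_eq_square)
    then show ?thesis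
      using L2_norm_nonneg[of "Wf u"] by (cases "L2_norm (Wf u) = 0") (auto simp: mult_le_cancel_left)
  qed
  have "L2_norm (K sc) * L2_norm (K u) \<le> (sqrt (sqrt HS) * L2_norm (Wf sc)) * (sqrt (sqrt HS) * L2_norm (Wf sc))"
  proof (rule mult_mono)
    show "L2_norm (K sc) \<le> sqrt (sqrt HS) * L2_norm (Wf sc)" by (rule K_norm_le_Wf[OF sL])
    show "L2_norm (K u) \<le> sqrt (sqrt HS) * L2_norm (Wf sc)"
      by (rule order_trans[OF K_norm_le_Wf[OF u(1)]]) (intro mult_left_mono Wu, simp add: HS_nonneg)
  qed (auto simp: HS_nonneg)
  also have "\<dots> = (sqrt (sqrt HS))\<^sup>2 * Q"
    unfolding Q_def by (simp only: power2_eq_square mult_ac)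
  also have "\<dots> = sqrt HS * Q" by (simp add: HS_nonneg)
  finally show ?thesis using CS unfolding err by linarith
qed

section \<open>Identification with the operators that define the field\<close>

lemma W_op:
  assumes f: "sqrt_one_minus_exp f = sc" and h: "h \<in> L2"
  shows "W_op \<beta> f h \<in> L2" "AE p in lborel. fourier_L2 (W_op \<beta> f h) p = Wf h p"
proof -
  let ?\<phi> = "\<lambda>s. sqrt (exp (\<beta> * s) / (1 - exp (\<beta> * s)))"
  note smh = sm_L2[OF h]
  have eq: "W_op \<beta> f h = fun_laplacian ?\<phi> (sm h)"
    unfolding W_op_def f sm_def[abs_def] ..
  have ae: "AE p in lborel. of_real (?\<phi> (- (norm p)\<^sup>2)) * fourier_L2 (sm h) p = Wf h p"
  proof -
    have "AE p in lborel. fourier_L2 (sm h) p = fourier_L1 (sm h) p"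
      by (rule fourier_L2_bounded_support[OF smh(1), of R]) (rule smh(3))
    then show ?thesis by eventually_elim (simp only: laplacian_symbol_eq Wf_def)
  qed
  have "fourier_L2 (sm h) \<in> borel_measurable borel" by (intro L2_measurable fourier_L2(1) smh(1))
  then have L: "(\<lambda>p. of_real (?\<phi> (- (norm p)\<^sup>2)) * fourier_L2 (sm h) p) \<in> L2"
    by (intro L2_AE_cong[OF Wf_L2[OF h] _ ae]) measurable
  show "W_op \<beta> f h \<in> L2" unfolding eq by (rule fun_laplacian(1)[OF L])
  show "AE p in lborel. fourier_L2 (W_op \<beta> f h) p = Wf h p"
    using fun_laplacian(2)[OF L] ae unfolding eq by eventually_elim simp
qed

lemma W_op_inner:
  assumes f: "sqrt_one_minus_exp f = sc" and g: "g \<in> L2" and h: "h \<in> L2"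
  shows "L2_inner (W_op \<beta> f g) (W_op \<beta> f h) = L2_inner g (K h)"
proof -
  note Wg = W_op[OF f g] and Wh = W_op[OF f h]
  have "L2_inner (W_op \<beta> f g) (W_op \<beta> f h) = L2_inner (fourier_L2 (W_op \<beta> f g)) (fourier_L2 (W_op \<beta> f h))"
    by (rule fourier_L2_inner[OF Wg(1) Wh(1), symmetric])
  also have "\<dots> = L2_inner (Wf g) (Wf h)"
    by (rule L2_inner_AE_cong[OF Wg(2) Wh(2)]) (intro L2_measurable fourier_L2(1) Wg(1) Wh(1) Wf_L2 g h)+
  finally show ?thesis by (simp only: Wf_inner[OF g h])
qed

text \<open>\<open>K\<close> is a witness for the adjoint chosen by \<open>SOME\<close>, and an
  element of \<open>L2\<close> is determined almost everywhere by its inner products.\<close>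

lemma K_op:
  assumes f: "sqrt_one_minus_exp f = sc" and h: "h \<in> L2"
  shows "K_op \<beta> f h \<in> L2" "AE x in lborel. K_op \<beta> f h x = K h x" "g \<in> L2 \<Longrightarrow> L2_inner g (K_op \<beta> f h) = L2_inner g (K h)"
proof -
  have "\<exists>k. k \<in> L2 \<and> (\<forall>g\<in>L2. L2_inner g k = L2_inner (W_op \<beta> f g) (W_op \<beta> f h))"
    using W_op_inner[OF f _ h] K_L2(1)[OF h] by (intro exI[of _ "K h"]) auto
  from someI_ex[OF this]
  have k: "K_op \<beta> f h \<in> L2" "\<And>g. g \<in> L2 \<Longrightarrow> L2_inner g (K_op \<beta> f h) = L2_inner (W_op \<beta> f g) (W_op \<beta> f h)"
    unfolding K_op_def L2_adjoint_def by blast+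
  show "K_op \<beta> f h \<in> L2" by (rule k)
  show inner: "L2_inner g (K_op \<beta> f h) = L2_inner g (K h)" if "g \<in> L2" for g
    using k(2)[OF that] W_op_inner[OF f that h] by simp
  show "AE x in lborel. K_op \<beta> f h x = K h x"
    by (rule L2_eq_AE[OF k(1) K_L2(1)[OF h] inner])
qed

lemma fredholm_det_K_op:
  assumes f: "sqrt_one_minus_exp f = sc"
  obtains D where "fredholm_det (K_op \<beta> f) = complex_of_real D" "exp (rho_c * S2 - HS) \<le> D" "D \<le> exp (rho_c * S2)"
proof -
  obtain D :: real where D: "\<And>e. L2_orthonormal_basis e \<Longrightarrow> (\<lambda>n. Determinant.det (1\<^sub>m n + Kmat e n)) \<longlonglongrightarrow> of_real D"
    using fredholm_det_exists by blast
  \<comment> \<open>A basis must exist for the condition under \<open>THE\<close> to single out the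
    limit.\<close>
  obtain e :: "nat \<Rightarrow> 'a \<Rightarrow> complex" where e: "L2_orthonormal_basis e"
    using L2_orthonormal_basis_exists by blast
  have eq: "Matrix.mat n n (\<lambda>(i, j). (if i = j then 1 else 0) + L2_inner (e i) (K_op \<beta> f (e j))) = 1\<^sub>m n + Kmat e n"
    if e: "L2_orthonormal_basis e" for e n
  proof -
    have "L2_inner (e i) (K_op \<beta> f (e j)) = L2_inner (e i) (K (e j))" for i j
      by (rule K_op(3)[OF f]) (use e in \<open>auto simp: L2_orthonormal_basis_def\<close>)
    then show ?thesis by (simp only: one_plus_Kmat)
  qed
  have "fredholm_det (K_op \<beta> f) = of_real D"
    unfolding fredholm_det_def
  proof (rule the_equality)
    show "\<forall>e. L2_orthonormal_basis e \<longrightarrow> (\<lambda>n. Determinant.det (Matrix.mat n n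
       (\<lambda>(i, j). (if i = j then 1 else 0) + L2_inner (e i) (K_op \<beta> f (e j))))) \<longlonglongrightarrow> complex_of_real D"
      using D eq by simp
    fix D' assume D': "\<forall>e. L2_orthonormal_basis e \<longrightarrow> (\<lambda>n. Determinant.det (Matrix.mat n n
       (\<lambda>(i, j). (if i = j then 1 else 0) + L2_inner (e i) (K_op \<beta> f (e j))))) \<longlonglongrightarrow> D'"
    have "(\<lambda>n. Determinant.det (1\<^sub>m n + Kmat e n)) \<longlonglongrightarrow> D'"
      using D'[rule_format, OF e] unfolding eq[OF e] .
    then show "D' = of_real D" using D[OF e] LIMSEQ_unique by blast
  qed
  with that fredholm_det_bounds[OF e D[OF e]] show ?thesis by blast
qed

text \<open>The estimate of \<open>resolvent_inner\<close> holds for every solution, hence for the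
  chosen one.\<close>

lemma inv_one_plus_K_op:
  assumes f: "sqrt_one_minus_exp f = sc" and HS: "HS < 1"
  shows "cmod (L2_inner sc (inv_one_plus (K_op \<beta> f) sc) - of_real (S2 - Q)) \<le> sqrt HS * Q"
proof -
  obtain u where u: "u \<in> L2" "AE x in lborel. u x + K u x = sc x" by (rule resolvent_exists[OF HS])
  have "AE x in lborel. u x + K_op \<beta> f u x = sc x"
    using u(2) K_op(2)[OF f u(1)] by eventually_elim simp
  then have "\<exists>u. u \<in> L2 \<and> (AE x in lborel. u x + K_op \<beta> f u x = sc x)" using u(1) by blast
  from someI_ex[OF this]
  have v: "inv_one_plus (K_op \<beta> f) sc \<in> L2" "AE x in lborel. inv_one_plus (K_op \<beta> f) sc x + K_op \<beta> f (inv_one_plus (K_op \<beta> f) sc) x = sc x"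
    unfolding inv_one_plus_def by blast+
  have "AE x in lborel. inv_one_plus (K_op \<beta> f) sc x + K (inv_one_plus (K_op \<beta> f) sc) x = sc x"
    using v(2) K_op(2)[OF f v(1)] by eventually_elim simp
  from resolvent_inner[OF v(1) this] show ?thesis .
qed

text \<open>Taking logarithms, \<open>(\<rho> - rho_c) * S2\<close> from the resolvent and
  \<open>rho_c * S2\<close> from the determinant merge into \<open>\<rho> * S2\<close>. The two
  error terms belong to the resolvent and to the determinant respectively.\<close>

lemma laplace_transform_bound:
  assumes f: "sqrt_one_minus_exp f = sc" "test_function f" and HS: "HS < 1"
    and \<nu>: "boson_field \<beta> \<rho> \<nu>" and \<rho>: "rho_c \<le> \<rho>"
  shows "0 < (LINT \<xi>|\<nu>. exp (- pairing f \<xi>))"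
    and "\<bar>ln (LINT \<xi>|\<nu>. exp (- pairing f \<xi>)) + \<rho> * S2 - (\<rho> - rho_c) * Q\<bar> \<le> (\<rho> - rho_c) * (sqrt HS * Q) + HS"
proof -
  let ?L = "LINT \<xi>|\<nu>. exp (- pairing f \<xi>)"
  obtain D where D: "fredholm_det (K_op \<beta> f) = complex_of_real D" "exp (rho_c * S2 - HS) \<le> D" "D \<le> exp (rho_c * S2)"
    using fredholm_det_K_op[OF f(1)] by blast
  have D0: "0 < D" using D(2) exp_gt_zero less_le_trans by blast
  have rc: "critical_density TYPE('a) \<beta> = rho_c" by (simp add: critical_density_def)
  define r where "r = Re (L2_inner sc (inv_one_plus (K_op \<beta> f) sc)) - (S2 - Q)"
  have r: "\<bar>r\<bar> \<le> sqrt HS * Q"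
    using abs_Re_le_cmod[of "L2_inner sc (inv_one_plus (K_op \<beta> f) sc) - of_real (S2 - Q)"] inv_one_plus_K_op[OF f(1) HS]
    by (simp add: r_def)
  have "complex_of_real ?L = exp (- of_real (\<rho> - rho_c) * L2_inner sc (inv_one_plus (K_op \<beta> f) sc)) / of_real D"
    using \<nu> f unfolding boson_field_def rc D(1)[symmetric] f(1)[symmetric] by blast
  \<comment> \<open>Taking moduli leaves only the real part of the inner product in the exponent;
    the left side is a nonnegative real number already.\<close>
  then have "cmod (complex_of_real ?L) = cmod (exp (- of_real (\<rho> - rho_c) * L2_inner sc (inv_one_plus (K_op \<beta> f) sc)) / of_real D)"
    by (simp only:)
  moreover have "0 \<le> ?L" by (intro integral_nonneg_AE AE_I2) simp
  ultimately have L: "?L = exp (- (\<rho> - rho_c) * (S2 - Q + r)) / D"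
    using D0 by (simp add: norm_divide r_def)
  then show "0 < ?L" using D0 by simp
  have lnL: "ln ?L = - (\<rho> - rho_c) * (S2 - Q + r) - ln D"
    unfolding L using D0 by (simp add: ln_div)
  have lnD: "rho_c * S2 - HS \<le> ln D" using D(2) D0 by (simp add: ln_ge_iff)
  have "ln D \<le> ln (exp (rho_c * S2))" using D(3) D0 by (subst ln_le_cancel_iff) auto
  note lnD = lnD this[unfolded ln_exp]
  have "ln ?L + \<rho> * S2 - (\<rho> - rho_c) * Q = - ((\<rho> - rho_c) * r) + (rho_c * S2 - ln D)"
    unfolding lnL by (simp add: algebra_simps)
  moreover have "\<bar>(\<rho> - rho_c) * r\<bar> \<le> (\<rho> - rho_c) * (sqrt HS * Q)"
    using r \<rho> by (simp add: abs_mult mult_left_mono)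
  ultimately show "\<bar>ln ?L + \<rho> * S2 - (\<rho> - rho_c) * Q\<bar> \<le> (\<rho> - rho_c) * (sqrt HS * Q) + HS"
    using lnD by linarith
qed

lemma Q_fourier: "Q = (LINT p|lborel. occ p * (cmod (fourier_L1 (\<lambda>x. of_real ((s x)\<^sup>2)) p))\<^sup>2)"
proof -
  have "sm sc = (\<lambda>x. of_real ((s x)\<^sup>2))" by (simp add: sm_def fun_eq_iff power2_eq_square)
  then show ?thesis
    unfolding Q_def L2_norm_power2 Wf_def using occ_nonneg by (simp add: norm_mult power_mult_distrib)
qed

text \<open>Since \<open>A\<close> vanishes at infinity, \<open>A\<^sup>2 \<le> \<eta> A\<close> outside a ball.\<close>

lemma HS_bound:
  assumes \<eta>: "\<And>z. M < norm z \<Longrightarrow> A z \<le> \<eta>" and \<eta>0: "0 \<le> \<eta>" and b: "\<And>x. (s x)\<^sup>2 \<le> b"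
  shows "HS \<le> \<eta> * Q + rho_c\<^sup>2 * b * measure lborel (cball (0::'a) M) * S2"
proof -
  let ?V = "measure lborel (cball (0::'a) M)"
  have b0: "0 \<le> b" using order_trans[OF zero_le_power2 b] .
  have Ksc: "K sc x = of_real (LINT y|lborel. kern x y * s y)" for x
    unfolding K_def by (simp flip: of_real_mult)
  have "complex_of_real Q = (LINT x|lborel. of_real (s x * (LINT y|lborel. kern x y * s y)))"
    unfolding Q_def Wf_norm[OF s_L2(1), symmetric] L2_inner_def Ksc by simp
  then have Q: "Q = (LINT x|lborel. s x * (LINT y|lborel. kern x y * s y))"
    by (simp only: integral_complex_of_real of_real_eq_iff)
  have Qint: "integrable lborel (\<lambda>x. s x * (LINT y|lborel. kern x y * s y))"
    using L2_inner_integrable[OF s_L2(1) K_L2(1)[OF s_L2(1)]] unfolding Ksc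
    by (simp flip: of_real_mult add: complex_of_real_integrable_eq)
  have ks_int: "integrable lborel (\<lambda>y. kern x y * s y)" for x
    using L2_inner_integrable[OF kern_L2 s_L2(1), of x] by (simp flip: of_real_mult add: complex_of_real_integrable_eq)
  have ind_int: "integrable lborel (\<lambda>y. indicator (cball x M) y :: real)" for x :: 'a
    using integrable_indicator_cball[of 1 x M] by simp
  have ind_val: "(LINT y|lborel. indicator (cball x M) y) = ?V" for x :: 'a
  proof -
    have "(LINT y|lborel. indicator (cball x M) (y::'a)) = \<bar>1\<bar> ^ DIM('a) *\<^sub>R (LINT y|lborel. indicator (cball x M) (x + 1 *\<^sub>R (y::'a)) :: real)"
      by (rule integral_lborel_affine) (auto intro!: borel_measurable_indicator)
    also have "(\<lambda>y. indicator (cball x M) (x + 1 *\<^sub>R y) :: real) = indicator (cball 0 M)"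
      by (auto simp: fun_eq_iff dist_norm split: split_indicator)
    finally show ?thesis by simp
  qed
  \<comment> \<open>Within distance M, \<open>A\<close> is bounded by \<open>rho_c\<close> and the
    square of s at y by \<open>b\<close>, so that integration over y gives the volume of the ball.
    Farther away the factors other than the replaced \<open>A\<close> form the integrand of
    \<open>Q\<close>.\<close>
  have point: "(kern x y)\<^sup>2 \<le> \<eta> * (s x * (kern x y * s y)) + (rho_c\<^sup>2 * b * (s x)\<^sup>2) * indicator (cball x M) y" for x y
  proof (cases "dist x y \<le> M")
    case True
    have "(kern x y)\<^sup>2 = (A (x - y))\<^sup>2 * ((s x)\<^sup>2 * (s y)\<^sup>2)" by (simp add: kern_def power_mult_distrib)
    also have "\<dots> \<le> rho_c\<^sup>2 * ((s x)\<^sup>2 * b)"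
      by (intro mult_mono power_mono A_bounds b) (auto simp: b0 s_nonneg)
    finally have "(kern x y)\<^sup>2 \<le> (rho_c\<^sup>2 * b * (s x)\<^sup>2) * indicator (cball x M) y"
      using True by (simp add: mult_ac)
    moreover have "0 \<le> \<eta> * (s x * (kern x y * s y))"
      by (intro mult_nonneg_nonneg \<eta>0 s_nonneg kern_nonneg)
    ultimately show ?thesis by linarith
  next
    case False
    then have "A (x - y) \<le> \<eta>" by (intro \<eta>) (simp add: dist_norm)
    then have "A (x - y) * (s x * (kern x y * s y)) \<le> \<eta> * (s x * (kern x y * s y))"
      by (intro mult_right_mono mult_nonneg_nonneg s_nonneg kern_nonneg)
    moreover have "(kern x y)\<^sup>2 = A (x - y) * (s x * (kern x y * s y))"
      by (simp add: kern_def power2_eq_square mult_ac)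
    ultimately show ?thesis using False by simp
  qed
  have row: "(LINT y|lborel. (kern x y)\<^sup>2) \<le> \<eta> * (s x * (LINT y|lborel. kern x y * s y)) + (rho_c\<^sup>2 * b * ?V) * (s x)\<^sup>2" for x
  proof -
    have "(LINT y|lborel. (kern x y)\<^sup>2) \<le> (LINT y|lborel. \<eta> * (s x * (kern x y * s y)) + (rho_c\<^sup>2 * b * (s x)\<^sup>2) * indicator (cball x M) y)"
      by (intro integral_mono kern_row_integrable Bochner_Integration.integrable_add integrable_mult_right ks_int ind_int point)
    also have "\<dots> = \<eta> * (s x * (LINT y|lborel. kern x y * s y)) + (rho_c\<^sup>2 * b * (s x)\<^sup>2) * ?V"
      using ks_int[of x] ind_int[of x] ind_val[of x] by (subst Bochner_Integration.integral_add) (auto intro!: integrable_mult_right)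
    finally show ?thesis by (simp add: mult_ac)
  qed
  have "HS \<le> (LINT x|lborel. \<eta> * (s x * (LINT y|lborel. kern x y * s y)) + (rho_c\<^sup>2 * b * ?V) * (s x)\<^sup>2)"
    unfolding HS_def
    by (intro integral_mono HS_integrable Bochner_Integration.integrable_add integrable_mult_right Qint s_L2(2) row)
  also have "\<dots> = \<eta> * Q + (rho_c\<^sup>2 * b * ?V) * S2"
    unfolding Q S2_def using Qint s_L2(2) by (subst Bochner_Integration.integral_add) (auto intro!: integrable_mult_right)
  finally show ?thesis by simp
qed

end

section \<open>Scaling limit\<close>

lemma one_minus_exp_bounds:
  fixes y :: real
  assumes "0 \<le> y"
  shows "0 \<le> 1 - exp (- y)" "1 - exp (- y) \<le> y" "y - y\<^sup>2 \<le> 1 - exp (- y)"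
proof -
  show "0 \<le> 1 - exp (- y)" using assms by simp
  show "1 - exp (- y) \<le> y" using exp_ge_add_one_self[of "- y"] by linarith
  have "exp (- y) \<le> 1 / (1 + y)"
    using exp_ge_add_one_self[of y] assms by (simp add: exp_minus field_simps)
  \<comment> \<open>The product equals 1 + y^3.\<close>
  also have "1 \<le> (1 + y) * (1 - y + y\<^sup>2)"
    using assms by (simp add: algebra_simps power2_eq_square)
  then have "1 / (1 + y) \<le> 1 - y + y\<^sup>2" using assms by (simp add: field_simps)
  finally show "y - y\<^sup>2 \<le> 1 - exp (- y)" by linarith
qed

section \<open>Comparison of the symbols at low momentum\<close>

context bose
begin

text \<open>Symbol of (-\<beta>\<Delta>)^-1, equal to 0 at the origin by the convention on
  division.\<close>

definition weight :: "'a \<Rightarrow> real" where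
  "weight q = 1 / (\<beta> * (norm q)\<^sup>2)"

text \<open>The \<open>L\<^sup>2\<close> norm of \<open>weighted h\<close> is that of \<open>(-\<beta>\<Delta>)\<^bsup>-1/2\<^esup> h\<close>, and \<open>scaled_weighted k\<close> is what
  \<open>(G(1-G)\<^sup>-\<^sup>1)\<^bsup>1/2\<^esup>\<close> becomes after rescaling momenta by \<open>k\<close>.\<close>

definition weighted :: "('a \<Rightarrow> complex) \<Rightarrow> 'a \<Rightarrow> complex" where
  "weighted h q = of_real (sqrt (weight q)) * fourier_L1 h q"

definition scaled_occ :: "real \<Rightarrow> 'a \<Rightarrow> real" where
  "scaled_occ k q = occ (q /\<^sub>R k) / k\<^sup>2"

definition scaled_weighted :: "real \<Rightarrow> ('a \<Rightarrow> complex) \<Rightarrow> 'a \<Rightarrow> complex" where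
  "scaled_weighted k h q = of_real (sqrt (scaled_occ k q)) * fourier_L1 h q"

lemma weight_measurable [measurable]: "weight \<in> borel_measurable borel"
  unfolding weight_def[abs_def] by measurable

lemma scaled_occ_measurable [measurable]: "scaled_occ k \<in> borel_measurable borel"
  unfolding scaled_occ_def[abs_def] by measurable

lemma weight_nonneg: "0 \<le> weight q"
  using beta_pos by (simp add: weight_def)

text \<open>exp x - 1 >= x gives a majorant that does not depend on k, as dominated convergence
  requires.\<close>

lemma scaled_occ_bounds:
  assumes k: "0 < k"
  shows "0 \<le> scaled_occ k q" "scaled_occ k q \<le> weight q"
proof -
  show "0 \<le> scaled_occ k q" by (simp add: scaled_occ_def occ_nonneg)
  show "scaled_occ k q \<le> weight q"
  proof (cases "q = 0")
    case True then show ?thesis by (simp add: scaled_occ_def weight_def occupation_def)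
  next
    case False
    define x where "x = \<beta> * (norm (q /\<^sub>R k))\<^sup>2"
    have x: "0 < x" "x * k\<^sup>2 = \<beta> * (norm q)\<^sup>2"
      using False k beta_pos by (auto simp: x_def power_mult_distrib field_simps)
    have "x \<le> exp x - 1" using exp_ge_add_one_self[of x] by linarith
    then have "x * k\<^sup>2 \<le> (exp x - 1) * k\<^sup>2" by (rule mult_right_mono) simp
    then have "1 / ((exp x - 1) * k\<^sup>2) \<le> 1 / (x * k\<^sup>2)"
      using x(1) k by (intro divide_left_mono mult_pos_pos) auto
    then show ?thesis
      unfolding scaled_occ_def weight_def occupation_def x_def[symmetric] x(2)[symmetric] by simp
  qed
qed

text \<open>On the unit ball the weight is at most exp \<beta> times the integrable
  \<open>occ\<close>, by exp x - 1 \<le> x exp x with x \<le> \<beta>; outside it is at most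
  1/\<beta>.\<close>

lemma weight_le: "weight q \<le> exp \<beta> * occ q + (if norm q \<le> 1 then 0 else 1 / \<beta>)"
proof (cases "norm q \<le> 1 \<and> q \<noteq> 0")
  case True
  define x where "x = \<beta> * (norm q)\<^sup>2"
  have "(norm q)\<^sup>2 \<le> 1\<^sup>2" using True by (intro power_mono) auto
  then have x: "0 < x" "x \<le> \<beta>" using True beta_pos by (auto simp: x_def)
  have "1 - x \<le> exp (- x)" using exp_ge_add_one_self[of "- x"] by simp
  then have "(1 - x) * exp x \<le> exp (- x) * exp x" by (intro mult_right_mono) auto
  then have "exp x - 1 \<le> x * exp x" by (simp add: exp_minus algebra_simps)
  also have "\<dots> \<le> x * exp \<beta>" using x by simp
  finally have "1 / x \<le> exp \<beta> * (1 / (exp x - 1))" using x by (simp add: field_simps)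
  then show ?thesis using True by (simp add: weight_def occupation_def x_def)
next
  case False
  have "0 \<le> exp \<beta> * occ q" using occ_nonneg by simp
  moreover have "weight q \<le> 1 / \<beta>" if "1 < norm q"
  proof -
    have "1\<^sup>2 \<le> (norm q)\<^sup>2" using that by (intro power_mono) auto
    then have "\<beta> \<le> \<beta> * (norm q)\<^sup>2" using beta_pos by simp
    moreover have "0 < norm q" using that by linarith
    ultimately show ?thesis unfolding weight_def using beta_pos by (intro divide_left_mono mult_pos_pos) auto
  qed
  ultimately show ?thesis using False by (cases "q = 0") (auto simp: weight_def)
qed

text \<open>The singularity of the weight at the origin is paid for with the L^1 norm of h, the rest
  with its L^2 norm. The explicit bound is applied to the difference between \<open>kf\<close> and
  f.\<close>

lemma weighted_L2:
  assumes h: "integrable lborel h" "h \<in> L2"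
  shows "weighted h \<in> L2"
    and "(L2_norm (weighted h))\<^sup>2 \<le> exp \<beta> * ((2 * pi) powr (- real DIM('a) / 2))\<^sup>2 * (LINT q|lborel. occ (q::'a)) * (LINT x|lborel. cmod (h x))\<^sup>2 + (L2_norm h)\<^sup>2 / \<beta>"
proof -
  have [measurable]: "h \<in> borel_measurable borel" using h(2) by (rule L2_measurable)
  define c where "c = (2 * pi) powr (- real DIM('a) / 2)"
  define C where "C = exp \<beta> * (c * (LINT x|lborel. cmod (h x)))\<^sup>2"
  note F = fourier_L1_contraction[OF h]
  have bound: "(cmod (weighted h q))\<^sup>2 \<le> C * occ q + (1 / \<beta>) * (cmod (fourier_L1 h q))\<^sup>2" for q
  proof -
    have "(cmod (weighted h q))\<^sup>2 = weight q * (cmod (fourier_L1 h q))\<^sup>2"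
      using weight_nonneg[of q] by (simp add: weighted_def norm_mult power_mult_distrib)
    also have "\<dots> \<le> (exp \<beta> * occ q + 1 / \<beta>) * (cmod (fourier_L1 h q))\<^sup>2"
    proof (intro mult_right_mono)
      show "weight q \<le> exp \<beta> * occ q + 1 / \<beta>"
      proof -
        have "(if norm q \<le> 1 then 0 else 1 / \<beta>) \<le> 1 / \<beta>" using beta_pos by simp
        then show ?thesis using weight_le[of q] by linarith
      qed
    qed simp
    also have "\<dots> = (exp \<beta> * occ q) * (cmod (fourier_L1 h q))\<^sup>2 + (1 / \<beta>) * (cmod (fourier_L1 h q))\<^sup>2"
      by (rule distrib_right)
    also have "(exp \<beta> * occ q) * (cmod (fourier_L1 h q))\<^sup>2 \<le> (exp \<beta> * occ q) * (c * (LINT x|lborel. cmod (h x)))\<^sup>2"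
      unfolding c_def by (intro mult_left_mono power_mono norm_fourier_L1_le) (auto simp: occ_nonneg)
    finally show ?thesis by (simp add: C_def mult_ac)
  qed
  have int: "integrable lborel (\<lambda>q. C * occ q + (1 / \<beta>) * (cmod (fourier_L1 h q))\<^sup>2)"
    by (intro Bochner_Integration.integrable_add integrable_mult_right occ_integrable L2_integrable[OF F(1)])
  show L: "weighted h \<in> L2"
  proof (rule L2_I_bound[OF _ int bound])
    show "weighted h \<in> borel_measurable borel" unfolding weighted_def[abs_def] by measurable
  qed
  have "(L2_norm (weighted h))\<^sup>2 \<le> (LINT q|lborel. C * occ q + (1 / \<beta>) * (cmod (fourier_L1 h q))\<^sup>2)"
    unfolding L2_norm_power2 by (intro integral_mono L2_integrable[OF L] int bound)
  also have "\<dots> = C * (LINT q|lborel. occ (q::'a)) + (1 / \<beta>) * (L2_norm (fourier_L1 h))\<^sup>2"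
    unfolding L2_norm_power2 using occ_integrable L2_integrable[OF F(1)]
    by (subst Bochner_Integration.integral_add) auto
  also have "L2_norm (fourier_L1 h) = L2_norm h" by (rule fourier_L1_isometry[OF h])
  finally show "(L2_norm (weighted h))\<^sup>2 \<le> exp \<beta> * ((2 * pi) powr (- real DIM('a) / 2))\<^sup>2 * (LINT q|lborel. occ (q::'a)) * (LINT x|lborel. cmod (h x))\<^sup>2 + (L2_norm h)\<^sup>2 / \<beta>"
    unfolding C_def c_def by (simp add: power_mult_distrib mult_ac)
qed

lemma scaled_weighted_L2:
  assumes h: "integrable lborel h" "h \<in> L2" and k: "0 < k"
  shows "scaled_weighted k h \<in> L2" "L2_norm (scaled_weighted k h) \<le> L2_norm (weighted h)"
proof -
  have [measurable]: "h \<in> borel_measurable borel" using h(2) by (rule L2_measurable)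
  note W = weighted_L2(1)[OF h]
  have bound: "(cmod (scaled_weighted k h q))\<^sup>2 \<le> (cmod (weighted h q))\<^sup>2" for q
    using scaled_occ_bounds[OF k, of q] weight_nonneg[of q]
    by (simp add: weighted_def scaled_weighted_def norm_mult power_mult_distrib mult_right_mono)
  show S: "scaled_weighted k h \<in> L2"
  proof (rule L2_I_bound[OF _ L2_integrable[OF W] bound])
    show "scaled_weighted k h \<in> borel_measurable borel" unfolding scaled_weighted_def[abs_def] by measurable
  qed
  show "L2_norm (scaled_weighted k h) \<le> L2_norm (weighted h)"
    unfolding L2_norm_def by (intro real_sqrt_le_mono integral_mono L2_integrable S W bound)
qed

lemma scaled_occ_tendsto:
  assumes k: "filterlim k at_top sequentially" "\<And>n. 0 < k n"
  shows "(\<lambda>n. scaled_occ (k n) q) \<longlonglongrightarrow> weight q"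
proof (cases "q = 0")
  case True
  then show ?thesis by (simp add: scaled_occ_def weight_def occupation_def)
next
  case False
  define a where "a = \<beta> * (norm q)\<^sup>2"
  have a: "0 < a" using False beta_pos by (simp add: a_def)
  define y where "y n = inverse ((k n)\<^sup>2)" for n
  have "filterlim (\<lambda>n. (k n)\<^sup>2) at_top sequentially"
    by (rule filterlim_pow_at_top[OF _ k(1)]) simp
  then have y: "y \<longlonglongrightarrow> 0" unfolding y_def by (rule tendsto_inverse_0_at_top)
  have ypos: "y n \<noteq> 0" for n using k(2)[of n] by (simp add: y_def)
  \<comment> \<open>The limit is the derivative of exp (a t) at t = 0, taken along t =
    1/k^2.\<close>
  have "((\<lambda>t. exp (a * t)) has_field_derivative a) (at 0)"
    by (auto intro!: derivative_eq_intros)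
  then have "(\<lambda>n. (exp (a * y n) - 1) / y n) \<longlonglongrightarrow> a"
    unfolding DERIV_def tendsto_at_iff_sequentially using y ypos by (auto simp: o_def)
  then have "(\<lambda>n. 1 / ((exp (a * y n) - 1) / y n)) \<longlonglongrightarrow> 1 / a"
    using a by (intro tendsto_intros) auto
  moreover have "1 / ((exp (a * y n) - 1) / y n) = scaled_occ (k n) q" for n
    using k(2)[of n] by (simp add: scaled_occ_def occupation_def y_def a_def power_mult_distrib power_inverse field_simps)
  ultimately show ?thesis by (simp add: weight_def a_def)
qed

lemma scaled_weighted_tendsto:
  assumes h: "integrable lborel h" "h \<in> L2" and k: "filterlim k at_top sequentially" "\<And>n. 0 < k n"
  shows "(\<lambda>n. L2_norm (scaled_weighted (k n) h)) \<longlonglongrightarrow> L2_norm (weighted h)"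
proof -
  have [measurable]: "h \<in> borel_measurable borel" using h(2) by (rule L2_measurable)
  note W = weighted_L2(1)[OF h]
  have eq: "(cmod (scaled_weighted (k n) h q))\<^sup>2 = scaled_occ (k n) q * (cmod (fourier_L1 h q))\<^sup>2" for n q
    using scaled_occ_bounds(1)[OF k(2)[of n], of q] by (simp add: scaled_weighted_def norm_mult power_mult_distrib)
  have eqw: "(cmod (weighted h q))\<^sup>2 = weight q * (cmod (fourier_L1 h q))\<^sup>2" for q
    using weight_nonneg[of q] by (simp add: weighted_def norm_mult power_mult_distrib)
  have "(\<lambda>n. LINT q|lborel. (cmod (scaled_weighted (k n) h q))\<^sup>2) \<longlonglongrightarrow> (LINT q|lborel. (cmod (weighted h q))\<^sup>2)"
  proof (rule integral_dominated_convergence[OF _ _ L2_integrable[OF W]])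
    show "AE q in lborel. (\<lambda>n. (cmod (scaled_weighted (k n) h q))\<^sup>2) \<longlonglongrightarrow> (cmod (weighted h q))\<^sup>2"
      unfolding eq eqw by (intro AE_I2 tendsto_intros scaled_occ_tendsto k)
    show "AE q in lborel. norm ((cmod (scaled_weighted (k n) h q))\<^sup>2) \<le> (cmod (weighted h q))\<^sup>2" for n
      unfolding eq eqw using scaled_occ_bounds[OF k(2)[of n]]
      by (intro AE_I2) (simp add: abs_mult mult_right_mono)
  qed (use W scaled_weighted_L2(1)[OF h k(2)] in \<open>auto dest: L2_measurable\<close>)
  then show ?thesis unfolding L2_norm_def by (rule tendsto_real_sqrt)
qed

lemma scaled_weighted_diff:
  assumes "integrable lborel g" "integrable lborel h"
  shows "scaled_weighted k (\<lambda>x. g x - h x) q = scaled_weighted k g q - scaled_weighted k h q"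
  unfolding scaled_weighted_def fourier_L1_diff[OF assms] by (rule right_diff_distrib)

end

section \<open>Asymptotics along a sequence of scales\<close>

text \<open>\<open>k n\<close> is the scale, and \<open>\<epsilon> n\<close> is the Laplace variable
  u divided by the normalization at that scale. That \<epsilon>^2 k^(d+2) is constant expresses the
  normalization by k^((d+2)/2); the constant c becomes u^2/\<sigma>^2.\<close>

locale bose_scaling = bose \<beta> dimension for \<beta> and dimension :: "'a::euclidean_space itself" +
  fixes f :: "'a \<Rightarrow> real" and B R c :: real and k \<epsilon> :: "nat \<Rightarrow> real"
  assumes f_meas [measurable]: "f \<in> borel_measurable borel"
    and f_nonneg: "0 \<le> f x" and f_le: "f x \<le> B" and f_supp: "R < norm x \<Longrightarrow> f x = 0"
    and k_pos: "0 < k n" and k_lim: "filterlim k at_top sequentially"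
    and eps_pos: "0 < \<epsilon> n" and eps: "(\<epsilon> n)\<^sup>2 * k n ^ (DIM('a) + 2) = c"
begin

definition s :: "nat \<Rightarrow> 'a \<Rightarrow> real" where
  "s n x = sqrt (1 - exp (- (\<epsilon> n * f (x /\<^sub>R k n))))"

text \<open>The square of \<open>s n\<close> is \<epsilon> times the rescaled \<open>kf n\<close>,
  which lies between f - \<epsilon> f^2 and f and thus takes the place of f.\<close>

definition kf :: "nat \<Rightarrow> 'a \<Rightarrow> real" where
  "kf n x = (1 - exp (- (\<epsilon> n * f x))) / \<epsilon> n"

lemma s_power2: "(s n x)\<^sup>2 = \<epsilon> n * kf n (x /\<^sub>R k n)"
proof -
  have "0 \<le> 1 - exp (- (\<epsilon> n * f (x /\<^sub>R k n)))"
    using eps_pos[of n] f_nonneg by simp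
  then show ?thesis using eps_pos[of n] by (simp add: s_def kf_def)
qed

lemma kf_measurable [measurable]: "kf n \<in> borel_measurable borel"
  unfolding kf_def[abs_def] by measurable

lemma kf_bounds: "0 \<le> kf n x" "kf n x \<le> f x" "f x - \<epsilon> n * (f x)\<^sup>2 \<le> kf n x"
proof -
  have e: "0 < \<epsilon> n" by (rule eps_pos)
  have y: "0 \<le> \<epsilon> n * f x" using e f_nonneg by simp
  show "0 \<le> kf n x" "kf n x \<le> f x"
    using one_minus_exp_bounds(1,2)[OF y] e by (simp_all add: kf_def field_simps)
  have "\<epsilon> n * kf n x = 1 - exp (- (\<epsilon> n * f x))" using e by (simp add: kf_def)
  moreover have "\<epsilon> n * (f x - \<epsilon> n * (f x)\<^sup>2) = \<epsilon> n * f x - (\<epsilon> n * f x)\<^sup>2"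
    by (simp add: power2_eq_square algebra_simps)
  ultimately have "\<epsilon> n * (f x - \<epsilon> n * (f x)\<^sup>2) \<le> \<epsilon> n * kf n x"
    using one_minus_exp_bounds(3)[OF y] by linarith
  then show "f x - \<epsilon> n * (f x)\<^sup>2 \<le> kf n x" using e by simp
qed

sublocale r: bose_region \<beta> dimension "s n" "R * k n" for n
proof
  show "s n \<in> borel_measurable borel" unfolding s_def[abs_def] by measurable
  fix x
  have y: "0 \<le> \<epsilon> n * f (x /\<^sub>R k n)" using eps_pos[of n] f_nonneg by simp
  show "0 \<le> s n x" "s n x \<le> 1" using y by (simp_all add: s_def)
  assume "R * k n < norm x"
  then have "R < norm (x /\<^sub>R k n)" using k_pos[of n] by (simp add: field_simps)
  then show "s n x = 0" by (simp add: s_def f_supp)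
qed

abbreviation HS :: "nat \<Rightarrow> real" where "HS n \<equiv> bose_region.HS \<beta> (s n)"
abbreviation Q :: "nat \<Rightarrow> real" where "Q n \<equiv> bose_region.Q \<beta> (s n)"
abbreviation S2 :: "nat \<Rightarrow> real" where "S2 n \<equiv> bose_region.S2 (s n)"

abbreviation fc :: "'a \<Rightarrow> complex" where "fc \<equiv> \<lambda>x. of_real (f x)"
abbreviation kc :: "nat \<Rightarrow> 'a \<Rightarrow> complex" where "kc n \<equiv> \<lambda>x. of_real (kf n x)"

lemma fc: "fc \<in> L2" "integrable lborel fc"
  by (rule bounded_support_integrable[of _ B R]; use f_nonneg f_le f_supp in auto)+

lemma f_integrable: "integrable lborel f" "integrable lborel (\<lambda>x. (f x)\<^sup>2)"
  using fc(2) L2_integrable[OF fc(1)] by (simp_all add: complex_of_real_integrable_eq)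

lemma f4_integrable: "integrable lborel (\<lambda>x. ((f x)\<^sup>2)\<^sup>2)"
proof -
  have "(\<lambda>x. complex_of_real ((f x)\<^sup>2)) \<in> L2"
    by (rule bounded_support_integrable(1)[of _ "B\<^sup>2" R])
       (use f_nonneg f_le f_supp in \<open>auto simp del: of_real_power intro!: power_mono\<close>)
  from L2_integrable[OF this] show ?thesis by (simp only: norm_of_real power2_abs)
qed

lemma kc: "kc n \<in> L2" "integrable lborel (kc n)"
proof -
  have "cmod (kc n x) \<le> B" for x using kf_bounds(1,2)[of n x] f_le[of x] by simp
  moreover have "kc n x = 0" if "R < norm x" for x using f_supp[OF that] by (simp add: kf_def)
  ultimately show "kc n \<in> L2" "integrable lborel (kc n)"
    by (intro bounded_support_integrable[of _ B R]; simp)+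
qed

lemma kf_integrable: "integrable lborel (kf n)"
  using kc(2)[of n] by (simp add: complex_of_real_integrable_eq)

text \<open>\<epsilon>^2 k^d equals c / k^2.\<close>

lemma eps_tendsto: "\<epsilon> \<longlonglongrightarrow> 0" and eps2_tendsto: "(\<lambda>n. (\<epsilon> n)\<^sup>2 * k n ^ DIM('a)) \<longlonglongrightarrow> 0"
proof -
  have inv: "(\<lambda>n. c * inverse (k n ^ m)) \<longlonglongrightarrow> c * 0" if "0 < m" for m
    by (intro tendsto_mult tendsto_const tendsto_inverse_0_at_top filterlim_pow_at_top that k_lim)
  have e2: "(\<epsilon> n)\<^sup>2 = c * inverse (k n ^ (DIM('a) + 2))" for n
  proof -
    have nz: "k n ^ (DIM('a) + 2) \<noteq> 0" using k_pos[of n] by simp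
    show ?thesis
      unfolding eps[of n, symmetric] by (simp only: mult.assoc right_inverse[OF nz] mult_1_right)
  qed
  have "(\<lambda>n. (\<epsilon> n)\<^sup>2) \<longlonglongrightarrow> 0" using inv[of "DIM('a) + 2"] by (simp add: e2)
  from tendsto_real_sqrt[OF this] show "\<epsilon> \<longlonglongrightarrow> 0" using eps_pos by (simp add: less_imp_le)
  have "(\<epsilon> n)\<^sup>2 * k n ^ DIM('a) = c * inverse ((k n)\<^sup>2)" for n
    unfolding eps[of n, symmetric] using k_pos[of n] by (simp add: power_add power2_eq_square field_simps)
  then show "(\<lambda>n. (\<epsilon> n)\<^sup>2 * k n ^ DIM('a)) \<longlonglongrightarrow> 0" using inv[of 2] by simp
qed

lemma S2_eq: "S2 n = \<epsilon> n * k n ^ DIM('a) * (LINT x|lborel. kf n x)"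
proof -
  have "S2 n = \<bar>k n\<bar> ^ DIM('a) *\<^sub>R (LINT x|lborel. (s n (0 + k n *\<^sub>R x))\<^sup>2)"
    unfolding r.S2_def by (rule integral_lborel_affine) (use k_pos[of n] r.s_meas in auto)
  then show ?thesis using k_pos[of n] by (simp add: s_power2)
qed

text \<open>This is where the centring is matched: \<open>S2\<close> differs from \<epsilon> k^d
  times the integral of f by O(\<epsilon>^2 k^d), which tends to 0.\<close>

lemma S2_bounds:
  "S2 n \<le> \<epsilon> n * k n ^ DIM('a) * (LINT x|lborel. f x)"
  "\<epsilon> n * k n ^ DIM('a) * (LINT x|lborel. f x) - S2 n \<le> (\<epsilon> n)\<^sup>2 * k n ^ DIM('a) * (LINT x|lborel. (f x)\<^sup>2)"
proof -
  have e: "0 \<le> \<epsilon> n * k n ^ DIM('a)" using eps_pos[of n] k_pos[of n] by simp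
  have "(LINT x|lborel. kf n x) \<le> (LINT x|lborel. f x)"
    by (intro integral_mono kf_integrable f_integrable kf_bounds)
  then show "S2 n \<le> \<epsilon> n * k n ^ DIM('a) * (LINT x|lborel. f x)"
    unfolding S2_eq using e by (intro mult_left_mono)
  have "(LINT x|lborel. f x) - (LINT x|lborel. kf n x) = (LINT x|lborel. f x - kf n x)"
    using f_integrable(1) kf_integrable by simp
  also have "\<dots> \<le> (LINT x|lborel. \<epsilon> n * (f x)\<^sup>2)"
  proof (rule integral_mono)
    show "f x - kf n x \<le> \<epsilon> n * (f x)\<^sup>2" for x using kf_bounds(3)[of x n] by linarith
  qed (use f_integrable kf_integrable in auto)
  finally have "(LINT x|lborel. f x) - (LINT x|lborel. kf n x) \<le> \<epsilon> n * (LINT x|lborel. (f x)\<^sup>2)" by simp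
  from mult_left_mono[OF this e]
  show "\<epsilon> n * k n ^ DIM('a) * (LINT x|lborel. f x) - S2 n \<le> (\<epsilon> n)\<^sup>2 * k n ^ DIM('a) * (LINT x|lborel. (f x)\<^sup>2)"
    unfolding S2_eq by (simp add: algebra_simps power2_eq_square)
qed

text \<open>Origin of the exponent d+2: the substitution q = k p contributes k^-d, the amplitude
  (\<epsilon> k^d)^2, and the passage to \<open>scaled_occ\<close> releases k^2. The product is
  \<epsilon>^2 k^(d+2) = c.\<close>

lemma Q_eq: "Q n = c * (L2_norm (scaled_weighted (k n) (kc n)))\<^sup>2"
proof -
  have kn: "0 < k n" by (rule k_pos)
  let ?d = "DIM('a)"
  have four: "fourier_L1 (\<lambda>x. of_real ((s n x)\<^sup>2)) p = of_real (\<epsilon> n * k n ^ ?d) * fourier_L1 (kc n) (k n *\<^sub>R p)" for p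
  proof -
    have "(LINT x|lborel. exp (- \<i> * of_real (p \<bullet> x)) * of_real ((s n x)\<^sup>2))
        = \<bar>k n\<bar> ^ ?d *\<^sub>R (LINT x|lborel. exp (- \<i> * of_real (p \<bullet> (0 + k n *\<^sub>R x))) * complex_of_real ((s n (0 + k n *\<^sub>R x))\<^sup>2))"
      by (rule integral_lborel_affine) (use kn in auto)
    also have "\<dots> = of_real (\<epsilon> n * k n ^ ?d) * (LINT x|lborel. exp (- \<i> * of_real ((k n *\<^sub>R p) \<bullet> x)) * kc n x)"
      using kn by (simp add: s_power2 scaleR_conv_of_real mult_ac flip: integral_mult_right_zero del: of_real_power)
    finally show ?thesis unfolding fourier_L1_def by (simp add: mult_ac del: of_real_power)
  qed
  have "Q n = (LINT p|lborel. occ p * (cmod (of_real (\<epsilon> n * k n ^ ?d) * fourier_L1 (kc n) (k n *\<^sub>R p)))\<^sup>2)"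
    unfolding r.Q_fourier four ..
  also have "\<dots> = \<bar>inverse (k n)\<bar> ^ ?d *\<^sub>R (LINT q|lborel. occ (0 + inverse (k n) *\<^sub>R q)
      * (cmod (of_real (\<epsilon> n * k n ^ ?d) * fourier_L1 (kc n) (k n *\<^sub>R (0 + inverse (k n) *\<^sub>R q))))\<^sup>2)"
    by (rule integral_lborel_affine) (use kn in auto)
  also have "\<dots> = inverse (k n) ^ ?d * (LINT q|lborel. ((\<epsilon> n * k n ^ ?d)\<^sup>2 * (k n)\<^sup>2) * (scaled_occ (k n) q * (cmod (fourier_L1 (kc n) q))\<^sup>2))"
    using kn by (simp add: scaled_occ_def norm_mult norm_power power_mult_distrib mult_ac del: integral_mult_right_zero integral_mult_left_zero)
  also have "\<dots> = (inverse (k n) ^ ?d * ((\<epsilon> n * k n ^ ?d)\<^sup>2 * (k n)\<^sup>2)) * (LINT q|lborel. scaled_occ (k n) q * (cmod (fourier_L1 (kc n) q))\<^sup>2)"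
    by simp
  also have "inverse (k n) ^ ?d * ((\<epsilon> n * k n ^ ?d)\<^sup>2 * (k n)\<^sup>2) = c"
    unfolding eps[of n, symmetric] using kn by (simp add: power_add power_mult_distrib power2_eq_square power_inverse)
  also have "(LINT q|lborel. scaled_occ (k n) q * (cmod (fourier_L1 (kc n) q))\<^sup>2) = (L2_norm (scaled_weighted (k n) (kc n)))\<^sup>2"
    unfolding L2_norm_power2 scaled_weighted_def using scaled_occ_bounds(1)[OF kn]
    by (simp add: norm_mult power_mult_distrib)
  finally show ?thesis .
qed

lemma Q_tendsto: "Q \<longlonglongrightarrow> c * (L2_norm (weighted fc))\<^sup>2"
proof -
  \<comment> \<open>The bound of \<open>weighted_L2\<close> evaluated at f^2, because
    \<open>kf\<close> differs from f by at most \<epsilon> f^2.\<close>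
  define C where "C = exp \<beta> * ((2 * pi) powr (- real DIM('a) / 2))\<^sup>2 * (LINT q|lborel. occ (q::'a)) * (LINT x|lborel. (f x)\<^sup>2)\<^sup>2 + (LINT x|lborel. ((f x)\<^sup>2)\<^sup>2) / \<beta>"
  have le: "\<bar>L2_norm (scaled_weighted (k n) (kc n)) - L2_norm (scaled_weighted (k n) fc)\<bar> \<le> \<epsilon> n * sqrt C" for n
  proof -
    have dL: "(\<lambda>x. kc n x - fc x) \<in> L2" "integrable lborel (\<lambda>x. kc n x - fc x)"
      using kc fc by (auto intro: L2_diff)
    have d: "cmod (kc n x - fc x) \<le> \<epsilon> n * (f x)\<^sup>2" for x
      using kf_bounds(1,2)[of n x] kf_bounds(3)[of x n] by (simp flip: of_real_diff)
    have "\<bar>L2_norm (scaled_weighted (k n) (kc n)) - L2_norm (scaled_weighted (k n) fc)\<bar>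
        \<le> L2_norm (\<lambda>q. scaled_weighted (k n) (kc n) q - scaled_weighted (k n) fc q)"
      by (rule L2_norm_diff_bound[OF scaled_weighted_L2(1)[OF kc(2,1) k_pos] scaled_weighted_L2(1)[OF fc(2,1) k_pos]])
    also have "\<dots> = L2_norm (scaled_weighted (k n) (\<lambda>x. kc n x - fc x))"
      by (intro arg_cong[of _ _ L2_norm] ext scaled_weighted_diff[OF kc(2) fc(2), symmetric])
    also have "\<dots> \<le> L2_norm (weighted (\<lambda>x. kc n x - fc x))"
      by (rule scaled_weighted_L2(2)[OF dL(2,1) k_pos])
    also have "\<dots> \<le> \<epsilon> n * sqrt C"
    proof (rule power2_le_imp_le)
      have I1: "(LINT x|lborel. cmod (kc n x - fc x)) \<le> \<epsilon> n * (LINT x|lborel. (f x)\<^sup>2)"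
      proof -
        have "(LINT x|lborel. cmod (kc n x - fc x)) \<le> (LINT x|lborel. \<epsilon> n * (f x)\<^sup>2)"
          by (intro integral_mono integrable_norm dL(2) integrable_mult_right f_integrable(2) d)
        then show ?thesis by simp
      qed
      have I2: "(L2_norm (\<lambda>x. kc n x - fc x))\<^sup>2 \<le> (\<epsilon> n)\<^sup>2 * (LINT x|lborel. ((f x)\<^sup>2)\<^sup>2)"
      proof -
        have "(L2_norm (\<lambda>x. kc n x - fc x))\<^sup>2 \<le> (LINT x|lborel. (\<epsilon> n)\<^sup>2 * ((f x)\<^sup>2)\<^sup>2)"
          unfolding L2_norm_power2
        proof (intro integral_mono L2_integrable dL(1) integrable_mult_right f4_integrable)
          show "(cmod (kc n x - fc x))\<^sup>2 \<le> (\<epsilon> n)\<^sup>2 * ((f x)\<^sup>2)\<^sup>2" for x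
            using power_mono[OF d[of x], of 2] by (simp only: power_mult_distrib norm_ge_zero)
        qed
        then show ?thesis by simp
      qed
      have J: "0 \<le> (LINT q|lborel. occ (q::'a))" by (intro integral_nonneg_AE AE_I2 occ_nonneg)
      have "(L2_norm (weighted (\<lambda>x. kc n x - fc x)))\<^sup>2
          \<le> exp \<beta> * ((2 * pi) powr (- real DIM('a) / 2))\<^sup>2 * (LINT q|lborel. occ (q::'a)) * (LINT x|lborel. cmod (kc n x - fc x))\<^sup>2 + (L2_norm (\<lambda>x. kc n x - fc x))\<^sup>2 / \<beta>"
        by (rule weighted_L2(2)[OF dL(2,1)])
      also have "\<dots> \<le> exp \<beta> * ((2 * pi) powr (- real DIM('a) / 2))\<^sup>2 * (LINT q|lborel. occ (q::'a)) * (\<epsilon> n * (LINT x|lborel. (f x)\<^sup>2))\<^sup>2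
          + ((\<epsilon> n)\<^sup>2 * (LINT x|lborel. ((f x)\<^sup>2)\<^sup>2)) / \<beta>"
        using beta_pos J by (intro add_mono mult_left_mono power_mono I1 divide_right_mono I2) auto
      also have "\<dots> = (\<epsilon> n)\<^sup>2 * C" unfolding C_def by (simp add: power_mult_distrib algebra_simps)
      also have "\<dots> = (\<epsilon> n * sqrt C)\<^sup>2"
      proof -
        have "0 \<le> C" unfolding C_def using beta_pos
          by (intro add_nonneg_nonneg mult_nonneg_nonneg divide_nonneg_pos integral_nonneg_AE AE_I2) (auto simp: occ_nonneg)
        then show ?thesis by (simp add: power_mult_distrib)
      qed
      finally show "(L2_norm (weighted (\<lambda>x. kc n x - fc x)))\<^sup>2 \<le> (\<epsilon> n * sqrt C)\<^sup>2" .
      show "0 \<le> \<epsilon> n * sqrt C"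
        using eps_pos[of n] beta_pos unfolding C_def
        by (intro mult_nonneg_nonneg real_sqrt_ge_zero add_nonneg_nonneg divide_nonneg_pos integral_nonneg_AE AE_I2)
           (auto simp: occ_nonneg less_imp_le)
    qed
    finally show ?thesis .
  qed
  have "(\<lambda>n. L2_norm (scaled_weighted (k n) (kc n)) - L2_norm (scaled_weighted (k n) fc)) \<longlonglongrightarrow> 0"
  proof (rule Lim_null_comparison)
    show "eventually (\<lambda>n. norm (L2_norm (scaled_weighted (k n) (kc n)) - L2_norm (scaled_weighted (k n) fc)) \<le> \<epsilon> n * sqrt C) sequentially"
      using le by (intro always_eventually) simp
    show "(\<lambda>n. \<epsilon> n * sqrt C) \<longlonglongrightarrow> 0" using tendsto_mult_left_zero[OF eps_tendsto] .
  qed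
  from tendsto_add[OF this scaled_weighted_tendsto[OF fc(2,1) k_lim k_pos]]
  have "(\<lambda>n. L2_norm (scaled_weighted (k n) (kc n))) \<longlonglongrightarrow> L2_norm (weighted fc)" by simp
  then show ?thesis unfolding Q_eq by (intro tendsto_intros)
qed

lemma HS_tendsto: "HS \<longlonglongrightarrow> 0"
proof (rule metric_LIMSEQ_I)
  fix d :: real assume d: "0 < d"
  obtain C where C: "\<And>n. \<bar>Q n\<bar> \<le> C" "0 < C"
    using convergent_imp_Bseq[OF convergentI[OF Q_tendsto]] unfolding Bseq_def real_norm_def by blast
  \<comment> \<open>With this choice the contribution of \<eta> Q is at most \<open>d / 2\<close>;
    the near-diagonal term vanishes with \<epsilon>^2 k^DIM.\<close>
  define \<eta> where "\<eta> = d / (2 * C)"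
  have \<eta>: "0 < \<eta>" using d C by (simp add: \<eta>_def)
  obtain M where M: "\<And>z. M < norm z \<Longrightarrow> A z \<le> \<eta>"
    using order_tendstoD(2)[OF A_at_infinity \<eta>] unfolding eventually_at_infinity by (meson less_imp_le)
  define V where "V = rho_c\<^sup>2 * B * measure lborel (cball (0::'a) M) * (LINT x|lborel. f x)"
  have "(\<lambda>n. (\<epsilon> n)\<^sup>2 * k n ^ DIM('a) * V) \<longlonglongrightarrow> 0" by (rule tendsto_mult_left_zero[OF eps2_tendsto])
  then have "eventually (\<lambda>n. (\<epsilon> n)\<^sup>2 * k n ^ DIM('a) * V < d / 2) sequentially"
    using d by (intro order_tendstoD(2)) auto
  then obtain N where N: "\<And>n. N \<le> n \<Longrightarrow> (\<epsilon> n)\<^sup>2 * k n ^ DIM('a) * V < d / 2"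
    by (auto simp: eventually_sequentially)
  have B0: "0 \<le> B" using order_trans[OF f_nonneg f_le] .
  have "HS n < d" if "N \<le> n" for n
  proof -
    have "(s n x)\<^sup>2 \<le> \<epsilon> n * B" for x
      unfolding s_power2 using eps_pos[of n] order_trans[OF kf_bounds(2) f_le] by (intro mult_left_mono) auto
    then have "HS n \<le> \<eta> * Q n + rho_c\<^sup>2 * (\<epsilon> n * B) * measure lborel (cball (0::'a) M) * S2 n"
      by (intro r.HS_bound M) (use \<eta> in auto)
    also have "\<dots> \<le> \<eta> * C + rho_c\<^sup>2 * (\<epsilon> n * B) * measure lborel (cball (0::'a) M) * (\<epsilon> n * k n ^ DIM('a) * (LINT x|lborel. f x))"
      using \<eta> C(1)[of n] B0 eps_pos[of n] by (intro add_mono mult_left_mono S2_bounds(1)) auto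
    also have "\<dots> = d / 2 + (\<epsilon> n)\<^sup>2 * k n ^ DIM('a) * V"
      using C(2) by (simp add: \<eta>_def V_def power2_eq_square mult_ac)
    also have "\<dots> < d" using N[OF that] by simp
    finally show ?thesis .
  qed
  then show "\<exists>N. \<forall>n\<ge>N. dist (HS n) 0 < d"
    using r.HS_nonneg by (intro exI[of _ N]) simp
qed

lemma test_function_scaled: "test_function (\<lambda>x. \<epsilon> n * f (x /\<^sub>R k n))"
proof -
  have "{x. \<epsilon> n * f (x /\<^sub>R k n) \<noteq> 0} \<subseteq> cball 0 (R * k n)"
  proof
    fix x assume "x \<in> {x. \<epsilon> n * f (x /\<^sub>R k n) \<noteq> 0}"
    then have "norm (x /\<^sub>R k n) \<le> R" using f_supp[of "x /\<^sub>R k n"] by (auto simp: not_less[symmetric])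
    then show "x \<in> cball 0 (R * k n)" using k_pos[of n] by (simp add: field_simps)
  qed
  then have "bounded {x. \<epsilon> n * f (x /\<^sub>R k n) \<noteq> 0}" using bounded_cball bounded_subset by blast
  then have "compactly_supported (\<lambda>x. \<epsilon> n * f (x /\<^sub>R k n))"
    unfolding compactly_supported_def compact_eq_bounded_closed by (simp add: bounded_closure)
  moreover have "bounded (range (\<lambda>x. \<epsilon> n * f (x /\<^sub>R k n)))"
    using f_nonneg f_le eps_pos[of n]
    by (intro boundedI[of _ "\<epsilon> n * B"]) (auto simp: abs_mult)
  moreover have "(\<lambda>x. \<epsilon> n * f (x /\<^sub>R k n)) \<in> borel_measurable borel" by measurable
  ultimately show ?thesis
    unfolding test_function_def using f_nonneg eps_pos[of n] by (simp add: less_imp_le)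
qed

text \<open>The logarithm splits into the error of \<open>laplace_transform_bound\<close>, \<rho>
  times the error of replacing the centring by \<open>S2\<close>, and
  \<open>(\<rho> - rho_c) * Q n\<close>, the only term that survives. The bounds apply as soon as
  \<open>HS n\<close> is below 1, hence for large n.\<close>

lemma laplace_asymptotics:
  assumes \<nu>: "boson_field \<beta> \<rho> \<nu>" and \<rho>: "rho_c \<le> \<rho>"
  defines "L n \<equiv> LINT \<xi>|\<nu>. exp (- pairing (\<lambda>x. \<epsilon> n * f (x /\<^sub>R k n)) \<xi>)"
  shows "eventually (\<lambda>n. 0 < L n) sequentially"
    and "(\<lambda>n. exp (\<epsilon> n * k n ^ DIM('a) * \<rho> * (LINT x|lborel. f x)) * L n)
      \<longlonglongrightarrow> exp ((\<rho> - rho_c) * (c * (L2_norm (weighted fc))\<^sup>2))"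
proof -
  have seq: "sqrt_one_minus_exp (\<lambda>x. \<epsilon> n * f (x /\<^sub>R k n)) = (\<lambda>x. of_real (s n x))" for n
    by (simp add: fun_eq_iff sqrt_one_minus_exp_def s_def)
  have HS1: "eventually (\<lambda>n. HS n < 1) sequentially" by (rule order_tendstoD(2)[OF HS_tendsto]) simp
  have pos: "0 < L n" if "HS n < 1" for n
    unfolding L_def by (rule r.laplace_transform_bound(1)[OF seq test_function_scaled that \<nu> \<rho>])
  show L_pos: "eventually (\<lambda>n. 0 < L n) sequentially"
    using HS1 by eventually_elim (rule pos)
  let ?m = "\<lambda>n. \<epsilon> n * k n ^ DIM('a) * (LINT x|lborel. f x)"
  have "(\<lambda>n. ln (L n) + \<rho> * S2 n - (\<rho> - rho_c) * Q n) \<longlonglongrightarrow> 0"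
  proof (rule Lim_null_comparison)
    show "eventually (\<lambda>n. norm (ln (L n) + \<rho> * S2 n - (\<rho> - rho_c) * Q n) \<le> (\<rho> - rho_c) * (sqrt (HS n) * Q n) + HS n) sequentially"
      using HS1 unfolding L_def real_norm_def
      by eventually_elim (rule r.laplace_transform_bound(2)[OF seq test_function_scaled _ \<nu> \<rho>])
    have "(\<lambda>n. (\<rho> - rho_c) * (sqrt (HS n) * Q n) + HS n) \<longlonglongrightarrow> (\<rho> - rho_c) * (sqrt 0 * (c * (L2_norm (weighted fc))\<^sup>2)) + 0"
      by (intro tendsto_intros HS_tendsto Q_tendsto)
    then show "(\<lambda>n. (\<rho> - rho_c) * (sqrt (HS n) * Q n) + HS n) \<longlonglongrightarrow> 0" by simp
  qed
  moreover have "(\<lambda>n. ?m n - S2 n) \<longlonglongrightarrow> 0"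
  proof (rule tendsto_sandwich[OF _ _ tendsto_const])
    show "eventually (\<lambda>n. 0 \<le> ?m n - S2 n) sequentially" using S2_bounds(1) by (intro always_eventually) simp
    show "eventually (\<lambda>n. ?m n - S2 n \<le> (\<epsilon> n)\<^sup>2 * k n ^ DIM('a) * (LINT x|lborel. (f x)\<^sup>2)) sequentially"
      using S2_bounds(2) by (intro always_eventually) blast
    show "(\<lambda>n. (\<epsilon> n)\<^sup>2 * k n ^ DIM('a) * (LINT x|lborel. (f x)\<^sup>2)) \<longlonglongrightarrow> 0"
      by (rule tendsto_mult_left_zero[OF eps2_tendsto])
  qed
  ultimately have "(\<lambda>n. (ln (L n) + \<rho> * S2 n - (\<rho> - rho_c) * Q n) + (\<rho> * (?m n - S2 n) + (\<rho> - rho_c) * Q n))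
      \<longlonglongrightarrow> 0 + (\<rho> * 0 + (\<rho> - rho_c) * (c * (L2_norm (weighted fc))\<^sup>2))"
    by (intro tendsto_intros Q_tendsto)
  then have "(\<lambda>n. \<rho> * ?m n + ln (L n)) \<longlonglongrightarrow> (\<rho> - rho_c) * (c * (L2_norm (weighted fc))\<^sup>2)"
    by (simp add: algebra_simps)
  then have lim: "(\<lambda>n. exp (\<rho> * ?m n + ln (L n))) \<longlonglongrightarrow> exp ((\<rho> - rho_c) * (c * (L2_norm (weighted fc))\<^sup>2))"
    by (rule tendsto_exp)
  have "eventually (\<lambda>n. exp (\<rho> * ?m n + ln (L n)) = exp (\<epsilon> n * k n ^ DIM('a) * \<rho> * (LINT x|lborel. f x)) * L n) sequentially"
    using L_pos by eventually_elim (simp add: exp_add mult_ac)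
  from Lim_transform_eventually[OF lim this]
  show "(\<lambda>n. exp (\<epsilon> n * k n ^ DIM('a) * \<rho> * (LINT x|lborel. f x)) * L n)
      \<longlonglongrightarrow> exp ((\<rho> - rho_c) * (c * (L2_norm (weighted fc))\<^sup>2))" .
qed

end

section \<open>Normalization and conclusion\<close>

context bose
begin

lemma inv_sqrt_laplacian_norm_eq:
  assumes h: "(\<lambda>x. complex_of_real (f x)) \<in> L2" and R: "\<And>x. R < norm x \<Longrightarrow> f x = 0"
  shows "inv_sqrt_laplacian_norm \<beta> f = L2_norm (weighted (\<lambda>x. of_real (f x)))"
proof -
  let ?f = "\<lambda>x. complex_of_real (f x)" and ?\<phi> = "\<lambda>s. (- \<beta> * s) powr (- 1 / 2)"
  have h1: "integrable lborel ?f" by (rule bounded_support_L2_integrable[OF h, of R]) (simp add: R)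
  have phi: "?\<phi> (- (norm p)\<^sup>2) = sqrt (weight p)" for p :: 'a
  proof (cases "p = 0")
    case False
    then have "0 < \<beta> * (norm p)\<^sup>2" using beta_pos by simp
    then show ?thesis by (simp add: weight_def powr_minus_divide powr_half_sqrt real_sqrt_divide)
  qed (simp add: weight_def)
  have "AE p in lborel. fourier_L2 ?f p = fourier_L1 ?f p"
    by (rule fourier_L2_bounded_support[OF h, of R]) (simp add: R)
  then have ae: "AE p in lborel. of_real (?\<phi> (- (norm p)\<^sup>2)) * fourier_L2 ?f p = weighted ?f p"
    by eventually_elim (simp only: phi weighted_def)
  have "fourier_L2 ?f \<in> borel_measurable borel" by (intro L2_measurable fourier_L2(1) h)
  then have L: "(\<lambda>p. of_real (?\<phi> (- (norm p)\<^sup>2)) * fourier_L2 ?f p) \<in> L2"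
    by (intro L2_AE_cong[OF weighted_L2(1)[OF h1 h] _ ae]) measurable
  have "AE p in lborel. fourier_L2 (fun_laplacian ?\<phi> ?f) p = weighted ?f p"
    using fun_laplacian(2)[OF L] ae by eventually_elim simp
  then have "L2_norm (fourier_L2 (fun_laplacian ?\<phi> ?f)) = L2_norm (weighted ?f)"
    by (rule L2_norm_AE_cong) (intro L2_measurable fourier_L2(1) fun_laplacian(1)[OF L] weighted_L2(1)[OF h1 h])+
  then show ?thesis
    unfolding inv_sqrt_laplacian_norm_def fourier_L2_norm[OF fun_laplacian(1)[OF L]] .
qed

text \<open>The weight is positive off the origin and the transform is isometric, so h can be
  recovered. This makes the denominator of the normalized variable positive.\<close>

lemma weighted_norm_pos:
  assumes h: "h \<in> L2" "integrable lborel h" and nz: "\<not> (AE x in lborel. h x = 0)"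
  shows "0 < L2_norm (weighted h)"
proof (rule ccontr)
  assume "\<not> ?thesis"
  then have "L2_norm (weighted h) = 0" using L2_norm_nonneg[of "weighted h"] by linarith
  then have "AE q in lborel. weighted h q = 0" unfolding L2_norm_eq_0_iff[OF weighted_L2(1)[OF h(2,1)]] .
  then have "AE q in lborel. fourier_L1 h q = 0"
    using AE_nonzero
  proof eventually_elim
    fix q :: 'a assume "weighted h q = 0" "q \<noteq> 0"
    then show "fourier_L1 h q = 0" using beta_pos by (simp add: weighted_def weight_def)
  qed
  then have "L2_norm (fourier_L1 h) = 0"
    unfolding L2_norm_eq_0_iff[OF fourier_L1_contraction(1)[OF h(2,1)]] .
  then have "L2_norm h = 0" unfolding fourier_L1_isometry[OF h(2,1)] .
  then show False using nz unfolding L2_norm_eq_0_iff[OF h(1)] by blast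
qed

end

theorem theorem1p2:
  fixes f :: "'a::euclidean_space \<Rightarrow> real"
    and \<nu> :: "'a measure measure"
    and \<beta> \<rho> t :: real
  assumes "DIM('a) > 2"
    and "\<beta> > 0"
    and "\<rho> > critical_density TYPE('a) \<beta>"
    and "boson_field \<beta> \<rho> \<nu>"
    and "f \<in> borel_measurable borel"
    and "\<forall>x. 0 \<le> f x"
    and "bounded (range f)"
    and "compactly_supported f"
    and "\<not> (AE x in lborel. f x = 0)"
  shows "((\<lambda>\<kappa>::real. LINT \<xi>|\<nu>. exp (\<i> * of_real (t * Z_normalized \<beta> \<rho> f \<kappa> \<xi>)))
            \<longlongrightarrow> complex_of_real (exp (- t\<^sup>2 / 2))) at_top"
proof -
  interpret bose \<beta> "TYPE('a)" by unfold_locales (use assms(1,2) in auto)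
  obtain B where B: "\<And>x. f x \<le> B"
    using assms(7) unfolding bounded_iff by (auto simp: abs_le_iff)
  have "bounded {x. f x \<noteq> 0}"
    using assms(8) unfolding compactly_supported_def by (meson bounded_subset closure_subset compact_imp_bounded)
  then obtain R where R: "{x. f x \<noteq> 0} \<subseteq> ball 0 R" using bounded_subset_ballD by blast
  have supp: "f x = 0" if "R < norm x" for x using R that by fastforce
  have fL2: "(\<lambda>x. complex_of_real (f x)) \<in> L2" "integrable lborel (\<lambda>x. complex_of_real (f x))"
    by (rule bounded_support_integrable[of _ B R]; use assms(5,6) B supp in auto)+
  define N where "N = L2_norm (weighted (\<lambda>x. complex_of_real (f x)))"
  have N: "inv_sqrt_laplacian_norm \<beta> f = N"
    unfolding N_def by (rule inv_sqrt_laplacian_norm_eq[OF fL2(1) supp])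
  have N0: "0 < N" unfolding N_def by (rule weighted_norm_pos[OF fL2]) (use assms(9) in simp)
  define \<sigma> where "\<sigma> = sqrt (2 * (\<rho> - rho_c)) * N"
  have \<sigma>: "0 < \<sigma>" "\<sigma>\<^sup>2 = 2 * (\<rho> - rho_c) * N\<^sup>2"
    using N0 assms(3) by (simp_all add: \<sigma>_def power_mult_distrib)
  \<comment> \<open>Denominator of the normalized variable; \<epsilon> will be
    \<open>u / b \<kappa>\<close>, so that \<epsilon>^2 \<kappa>^(d+2) = u^2/\<sigma>^2.\<close>
  define b where "b \<kappa> = \<sigma> * \<kappa> powr ((real DIM('a) + 2) / 2)" for \<kappa>
  define X where "X \<kappa> \<xi> = pairing (\<lambda>x. f (x /\<^sub>R \<kappa>)) \<xi>" for \<kappa> \<xi>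
  define m where "m \<kappa> = \<kappa> ^ DIM('a) * \<rho> * (LINT x|lborel. f x)" for \<kappa>
  have Z: "Z_normalized \<beta> \<rho> f \<kappa> \<xi> = (X \<kappa> \<xi> - m \<kappa>) / b \<kappa>" for \<kappa> \<xi>
    unfolding Z_normalized_def N X_def m_def b_def \<sigma>_def ..
  have X0: "0 \<le> X \<kappa> \<xi>" for \<kappa> \<xi>
    unfolding X_def pairing_def using assms(6) by (intro integral_nonneg_AE AE_I2) auto
  have b_pos: "0 < b \<kappa>" if "0 < \<kappa>" for \<kappa> using that \<sigma> by (simp add: b_def)
  have b2: "(b \<kappa>)\<^sup>2 = \<sigma>\<^sup>2 * \<kappa> ^ (DIM('a) + 2)" if "0 < \<kappa>" for \<kappa>
  proof -
    have "(\<kappa> powr ((real DIM('a) + 2) / 2))\<^sup>2 = \<kappa> powr (real (DIM('a) + 2))"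
      unfolding power2_eq_square powr_add[symmetric] by (simp add: add.commute)
    also have "\<dots> = \<kappa> ^ (DIM('a) + 2)" using that by (rule powr_realpow)
    finally show ?thesis by (simp only: b_def power_mult_distrib)
  qed
  have scaling: "bose_scaling \<beta> f B R (u\<^sup>2 / \<sigma>\<^sup>2) k (\<lambda>n. u / b (k n))"
    if u: "0 < u" and k: "filterlim k at_top sequentially" "\<And>n. 0 < k n" for u and k :: "nat \<Rightarrow> real"
  proof
    show "(u / b (k n))\<^sup>2 * k n ^ (DIM('a) + 2) = u\<^sup>2 / \<sigma>\<^sup>2" for n
      unfolding power_divide b2[OF k(2)] using k(2)[of n] by simp
    show "0 < u / b (k n)" for n using u b_pos[OF k(2)] by simp
  qed (use assms(5,6) B supp k in auto)
  \<comment> \<open>The centring becomes a deterministic factor, and the Laplace variable is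
    absorbed into the test function, to which the formula for the field applies.\<close>
  have exp_eq: "exp (- u * Z_normalized \<beta> \<rho> f \<kappa> \<xi>)
      = exp (u / b \<kappa> * \<kappa> ^ DIM('a) * \<rho> * (LINT x|lborel. f x)) * exp (- pairing (\<lambda>x. u / b \<kappa> * f (x /\<^sub>R \<kappa>)) \<xi>)" for u \<kappa> \<xi>
    unfolding Z exp_add[symmetric] by (simp add: X_def m_def pairing_def diff_divide_distrib algebra_simps)
  have prob: "prob_space \<nu>" using assms(4) by (simp add: boson_field_def)
  show ?thesis
  proof (rule tendsto_at_topI_sequentially)
    fix k0 :: "nat \<Rightarrow> real" assume k0: "filterlim k0 at_top sequentially"
    obtain N1 where N1: "\<And>n. N1 \<le> n \<Longrightarrow> 0 < k0 n"
      using k0 unfolding filterlim_at_top_dense eventually_sequentially by blast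
    \<comment> \<open>An arbitrary sequence may start with nonpositive scales; these are dropped
      here and restored at the end by \<open>LIMSEQ_offset\<close>.\<close>
    define k1 where "k1 n = k0 (n + N1)" for n
    have k1: "filterlim k1 at_top sequentially" "\<And>n. 0 < k1 n"
      unfolding k1_def using N1 by (auto intro!: filterlim_compose[OF k0] filterlim_add_const_nat_at_top)
    \<comment> \<open>The case u = 1 supplies positive transforms for large n, from which
      integrability and then measurability follow, at the price of a second shift by
      \<open>N2\<close>.\<close>
    interpret one: bose_scaling \<beta> "TYPE('a)" f B R "1\<^sup>2 / \<sigma>\<^sup>2" k1 "\<lambda>n. 1 / b (k1 n)"
      by (rule scaling[OF _ k1]) simp
    obtain N2 where N2: "\<And>n. N2 \<le> n \<Longrightarrow> 0 < (LINT \<xi>|\<nu>. exp (- pairing (\<lambda>x. 1 / b (k1 n) * f (x /\<^sub>R k1 n)) \<xi>))"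
      using one.laplace_asymptotics(1)[OF assms(4)] assms(3) unfolding eventually_sequentially by auto
    define k where "k n = k1 (n + N2)" for n
    have k: "filterlim k at_top sequentially" "\<And>n. 0 < k n"
      unfolding k_def using k1 by (auto intro!: filterlim_compose[OF k1(1)] filterlim_add_const_nat_at_top)
    have meas: "Z_normalized \<beta> \<rho> f (k n) \<in> borel_measurable \<nu>" for n
    proof -
      let ?e = "\<lambda>\<xi>. exp (- pairing (\<lambda>x. 1 / b (k n) * f (x /\<^sub>R k n)) \<xi>)"
      have "integrable \<nu> ?e"
        using N2[of "n + N2"] not_integrable_integral_eq[of \<nu> ?e] unfolding k_def by fastforce
      then have "?e \<in> borel_measurable \<nu>" by (rule borel_measurable_integrable)
      \<comment> \<open>The logarithm recovers the pairing from its exponential.\<close>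
      then have "(\<lambda>\<xi>. - ln (?e \<xi>) * b (k n)) \<in> borel_measurable \<nu>" by measurable
      moreover have "- ln (?e \<xi>) * b (k n) = X (k n) \<xi>" for \<xi>
        using b_pos[OF k(2)[of n]] by (simp add: X_def pairing_def)
      ultimately have "X (k n) \<in> borel_measurable \<nu>" by (simp only:)
      then show ?thesis unfolding Z[abs_def] by measurable
    qed
    have lower: "- m (k n) / b (k n) \<le> Z_normalized \<beta> \<rho> f (k n) \<xi>" for n \<xi>
      unfolding Z using X0[of "k n" \<xi>] b_pos[OF k(2)[of n]] by (intro divide_right_mono) auto
    have "(\<lambda>n. LINT \<xi>|\<nu>. exp (\<i> * of_real (t * Z_normalized \<beta> \<rho> f (k n) \<xi>))) \<longlonglongrightarrow> complex_of_real (exp (- t\<^sup>2 / 2))"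
    proof (rule laplace_convergence_imp_char_convergence[OF prob meas lower])
      fix u :: real assume u: "0 < u"
      interpret sc: bose_scaling \<beta> "TYPE('a)" f B R "u\<^sup>2 / \<sigma>\<^sup>2" k "\<lambda>n. u / b (k n)"
        by (rule scaling[OF u k])
      \<comment> \<open>The factor 2 in \<sigma>^2 produces the exponent u^2/2.\<close>
      have eq: "(\<rho> - rho_c) * (u\<^sup>2 / \<sigma>\<^sup>2 * N\<^sup>2) = u\<^sup>2 / 2"
        unfolding \<sigma>(2) using N0 assms(3) by (simp add: field_simps)
      show "(\<lambda>n. LINT \<xi>|\<nu>. exp (- u * Z_normalized \<beta> \<rho> f (k n) \<xi>)) \<longlonglongrightarrow> exp (u\<^sup>2 / 2)"
        using sc.laplace_asymptotics(2)[OF assms(4) less_imp_le[OF assms(3)]]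
        unfolding exp_eq integral_mult_right_zero N_def[symmetric] eq .
    qed
    then have "(\<lambda>n. LINT \<xi>|\<nu>. exp (\<i> * of_real (t * Z_normalized \<beta> \<rho> f (k0 (n + (N2 + N1))) \<xi>))) \<longlonglongrightarrow> complex_of_real (exp (- t\<^sup>2 / 2))"
      by (simp only: k_def k1_def add.assoc)
    then show "(\<lambda>n. LINT \<xi>|\<nu>. exp (\<i> * of_real (t * Z_normalized \<beta> \<rho> f (k0 n) \<xi>))) \<longlonglongrightarrow> complex_of_real (exp (- t\<^sup>2 / 2))"
      by (rule LIMSEQ_offset)
  qed
qed

end
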